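(* Let $q\in[1,\infty)$. There exists $C_q>0$ such that for all $T\ge\sqrt2$, $x=\binom uz\in\mathbb{R}\times\mathbb{C}$ and $v=\begin{pmatrix}v_{\mathbb{R}}\\ v_{\mathbb{C}}\end{pmatrix}\in\mathbb{R}\times\mathbb{C}$, the dual $\delta h$ of $$h=h(x,v,T)=-a_T^{*}\left(a_Ta_T^{*}\right)^{-1}\begin{pmatrix}1&0\\0&R(-u)\end{pmatrix}v$$ satisfies $$\mathbb{E}\left[|\delta h|^q\right]^{1/q}\le C_q\left(|v_{\mathbb{R}}|+\frac1{\sqrt T}|v_{\mathbb{C}}|\right).$$
   Context: Conventions: $\mathbb{C}$ is identified with $\mathbb{R}^2$ (complex numbers are real column vectors $\binom{\mathrm{Re}}{\mathrm{Im}}$), elements of $\mathbb{R}\times\mathbb{C}$ are column vectors of $\mathbb{R}^3$, $*$ is real transposition, and $R(u)=\begin{pmatrix}\cos u&-\sin u\\ \sin u&\cos u\end{pmatrix}$. Let $(B_t)_{t\ge0}$ be a standard real Brownian motion started at $0$, $H=L^2([0,T],\mathbb{R})$, and for $t\in[0,T]$ let $h_0(t)=1$, $h_1(t)=\int_0^t\sin(B_s)\,ds$, $h_2(t)=-\int_0^t\cos(B_s)\,ds$. The random linear map $a_T:H\to\mathbb{R}\times\mathbb{C}\simeq\mathbb{R}^3$ is $a_T(h)=(\langle h_0,h\rangle,\langle h_1,h\rangle,\langle h_2,h\rangle)^*$, with adjoint $a_T^*(\lambda_0,\lambda_1,\lambda_2)=\lambda_0h_0+\lambda_1h_1+\lambda_2h_2$,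 and $\mathcal{C}(T)=a_Ta_T^*=(\langle h_i,h_j\rangle_H)_{0\le i,j\le2}$, which is almost surely invertible. The Malliavin dual $\delta h$ is the real random variable given explicitly by $$\begin{aligned}-\delta h&=\begin{pmatrix}B_T\\-i\int_0^Te^{iB_t}(B_T-B_t)\,dt\end{pmatrix}^{*}\mathcal{C}(T)^{-1}\begin{pmatrix}1&0\\0&R(-u)\end{pmatrix}v\\&\quad+\int_0^T\int_0^t\begin{pmatrix}s\\ i\int_0^se^{iB_\rho}(\rho-s)\,d\rho\end{pmatrix}^{*}\mathcal{C}(T)^{-1}\mathscr{K}(t,s)\,\mathcal{C}(T)^{-1}\begin{pmatrix}1&0\\0&R(-u)\end{pmatrix}v\,ds\,dt,\end{aligned}$$ with $$\mathscr{K}(t,s)=\begin{pmatrix}0&\left(e^{iB_s}\right)^{*}\\ e^{iB_s}&-e^{iB_s}\left(i\int_0^te^{iB_r}dr\right)^{*}-i\int_0^te^{iB_r}dr\left(e^{iB_s}\right)^{*}\end{pmatrix}.$$ *)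

theory Defs
  imports "HOL-Probability.Probability"
begin

text \<open>The index set is the type of reals, but only the times \<open>t \<ge> 0\<close> matter.\<close>

locale standard_brownian_motion = prob_space M for M :: "'a measure" +
  fixes B :: "real \<Rightarrow> 'a \<Rightarrow> real"
  assumes measurable_B: "\<And>t. 0 \<le> t \<Longrightarrow> B t \<in> borel_measurable M"
    and start_zero: "\<And>\<omega>. \<omega> \<in> space M \<Longrightarrow> B 0 \<omega> = 0"
    and independent_increments:
      "\<And>(n::nat) t. 0 \<le> t 0 \<Longrightarrow> (\<And>i. i < n \<Longrightarrow> t i \<le> t (Suc i)) \<Longrightarrow>
        indep_vars (\<lambda>_. borel) (\<lambda>i \<omega>. B (t (Suc i)) \<omega> - B (t i) \<omega>) {..<n}"
    and gaussian_increments: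
      "\<And>s t. 0 \<le> s \<Longrightarrow> s < t \<Longrightarrow>
        distributed M lborel (\<lambda>\<omega>. B t \<omega> - B s \<omega>) (normal_density 0 (sqrt (t - s)))"
    and continuous_paths: "\<And>\<omega>. \<omega> \<in> space M \<Longrightarrow> continuous_on {0..} (\<lambda>t. B t \<omega>)"

definition cvec :: "complex \<Rightarrow> real^2" where
  "cvec c = vector [Re c, Im c]"

definition col :: "real \<Rightarrow> complex \<Rightarrow> real^3" where
  "col a c = vector [a, Re c, Im c]"

text \<open>\<open>outer p q\<close> is the matrix product of the column \<open>p\<close> with the row \<open>q\<close>, i.e. \<open>p q\<^sup>*\<close>.\<close>

definition outer :: "real^2 \<Rightarrow> real^2 \<Rightarrow> real^2^2" where
  "outer p q = (\<chi> i j. p $ i * q $ j)"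

text \<open>\<open>block a r c A\<close> is the matrix with first row \<open>(a, r)\<close> and lower blocks \<open>c\<close> (a column) and \<open>A\<close>.\<close>

definition block :: "real \<Rightarrow> real^2 \<Rightarrow> real^2 \<Rightarrow> real^2^2 \<Rightarrow> real^3^3" where
  "block a r c A =
     vector [vector [a, r $ 1, r $ 2],
             vector [c $ 1, A $ 1 $ 1, A $ 1 $ 2],
             vector [c $ 2, A $ 2 $ 1, A $ 2 $ 2]]"

definition rot :: "real \<Rightarrow> real^2^2" where
  "rot u = vector [vector [cos u, - sin u], vector [sin u, cos u]]"

text \<open>The following definitions are pathwise: \<open>b\<close> is one sample path of the Brownian motion.
  The functions \<open>h\<^sub>0, h\<^sub>1, h\<^sub>2\<close> are the components 1, 2, 3 of \<open>hvec b\<close>.\<close>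

definition hvec :: "(real \<Rightarrow> real) \<Rightarrow> real \<Rightarrow> real^3" where
  "hvec b t = vector [1, (LBINT s:{0..t}. sin (b s)), - (LBINT s:{0..t}. cos (b s))]"

definition ip :: "real \<Rightarrow> (real \<Rightarrow> real) \<Rightarrow> (real \<Rightarrow> real) \<Rightarrow> real" where
  "ip T f g = (LBINT t:{0..T}. f t * g t)"

definition a_op :: "(real \<Rightarrow> real) \<Rightarrow> real \<Rightarrow> (real \<Rightarrow> real) \<Rightarrow> real^3" where
  "a_op b T h = (\<chi> i. ip T (\<lambda>t. hvec b t $ i) h)"

definition a_adj :: "(real \<Rightarrow> real) \<Rightarrow> real^3 \<Rightarrow> real \<Rightarrow> real" where
  "a_adj b l t = (\<Sum>i\<in>UNIV. l $ i * hvec b t $ i)"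

definition Cmat :: "(real \<Rightarrow> real) \<Rightarrow> real \<Rightarrow> real^3^3" where
  "Cmat b T = (\<chi> i j. ip T (\<lambda>t. hvec b t $ i) (\<lambda>t. hvec b t $ j))"

definition rotated :: "real \<times> complex \<Rightarrow> real \<times> complex \<Rightarrow> real^3" where
  "rotated x v = block 1 0 0 (rot (- fst x)) *v col (fst v) (snd v)"

definition hdir :: "(real \<Rightarrow> real) \<Rightarrow> real \<times> complex \<Rightarrow> real \<times> complex \<Rightarrow> real \<Rightarrow> real \<Rightarrow> real" where
  "hdir b x v T = (\<lambda>t. - a_adj b (matrix_inv (Cmat b T) *v rotated x v) t)"

definition Kmat :: "(real \<Rightarrow> real) \<Rightarrow> real \<Rightarrow> real \<Rightarrow> real^3^3" where
  "Kmat b t s =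
    (let e = cvec (cis (b s)); g = cvec (\<i> * (LBINT r:{0..t}. cis (b r)))
     in block 0 e e (- outer e g - outer g e))"

text \<open>The Malliavin dual (Skorokhod integral) of \<open>hdir b x v T\<close>, given by its explicit pathwise
  formula. The product \<open>p\<^sup>* A w\<close> is written as the inner product of \<open>p\<close> and \<open>A w\<close>.
  Where \<open>Cmat b T\<close> is singular (a null event) \<open>matrix_inv\<close> is an unspecified constant matrix.\<close>

definition dual_hdir :: "(real \<Rightarrow> real) \<Rightarrow> real \<times> complex \<Rightarrow> real \<times> complex \<Rightarrow> real \<Rightarrow> real" where
  "dual_hdir b x v T =
    - (col (b T) (- \<i> * (LBINT t:{0..T}. cis (b t) * complex_of_real (b T - b t)))
         \<bullet> (matrix_inv (Cmat b T) *v rotated x v)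
       + (LBINT t:{0..T}. LBINT s:{0..t}.
            col s (\<i> * (LBINT r:{0..s}. cis (b r) * complex_of_real (r - s)))
              \<bullet> ((matrix_inv (Cmat b T) ** Kmat b t s ** matrix_inv (Cmat b T))
                    *v rotated x v)))"

text \<open>On continuous paths, \<open>Cmat b T\<close> is the matrix of the map \<open>a_op b T\<close> composed with its
  adjoint, so \<open>hdir\<close> solves the linear equation that determines it.\<close>

lemma continuous_on_hvec:
  assumes "continuous_on {0..} b"
  shows "continuous_on {0..T} (\<lambda>t. hvec b t $ i)"
proof -
  have ind: "continuous_on {0..T} (\<lambda>t. LBINT s:{0..t}. f s)"
    if f: "continuous_on {0..} f" for f :: "real \<Rightarrow> real"
  proof -
    have fT: "continuous_on {0..t} f" for t
      using f by (rule continuous_on_subset) auto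
    have "(LBINT s:{0..t}. f s) = integral {0..t} f" for t
      by (intro set_borel_integral_eq_integral(2) borel_integrable_atLeastAtMost' fT)
    then show ?thesis
      using indefinite_integral_continuous_1[OF integrable_continuous_real[OF fT]] by simp
  qed
  have "continuous_on {0..T} (\<lambda>t. LBINT s:{0..t}. sin (b s))"
    "continuous_on {0..T} (\<lambda>t. - (LBINT s:{0..t}. cos (b s)))"
    by (intro ind continuous_intros assms)+
  then show ?thesis
    using exhaust_3[of i] by (auto simp: hvec_def vector_3)
qed

lemma a_op_a_adj:
  assumes "continuous_on {0..} b"
  shows "a_op b T (a_adj b l) = Cmat b T *v l"
proof -
  have int: "set_integrable lborel {0..T} (\<lambda>t. hvec b t $ i * (l $ j * hvec b t $ j))" for i j
    by (intro borel_integrable_atLeastAtMost' continuous_intros continuous_on_hvec assms)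
  have "(LBINT t:{0..T}. hvec b t $ i * (\<Sum>j\<in>UNIV. l $ j * hvec b t $ j)) =
      (\<Sum>j\<in>UNIV. (LBINT t:{0..T}. hvec b t $ i * hvec b t $ j) * l $ j)" for i
  proof -
    have "(LBINT t:{0..T}. hvec b t $ i * (\<Sum>j\<in>UNIV. l $ j * hvec b t $ j)) =
      (LBINT t:{0..T}. (\<Sum>j\<in>UNIV. hvec b t $ i * (l $ j * hvec b t $ j)))"
      by (simp add: sum_distrib_left)
    also have "\<dots> = (\<Sum>j\<in>UNIV. LBINT t:{0..T}. hvec b t $ i * (l $ j * hvec b t $ j))"
      using int unfolding set_lebesgue_integral_def set_integrable_def scaleR_sum_right
      by (intro Bochner_Integration.integral_sum) auto
    also have "\<dots> = (\<Sum>j\<in>UNIV. (LBINT t:{0..T}. hvec b t $ i * hvec b t $ j) * l $ j)"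
      by (intro sum.cong refl, subst set_integral_mult_left[symmetric]) (simp add: mult_ac)
    finally show ?thesis .
  qed
  then show ?thesis
    by (simp add: vec_eq_iff a_op_def ip_def a_adj_def Cmat_def matrix_vector_mult_def)
qed

lemma a_op_hdir:
  assumes "continuous_on {0..} b" "invertible (Cmat b T)"
  shows "a_op b T (hdir b x v T) = - rotated x v"
proof -
  let ?l = "matrix_inv (Cmat b T) *v rotated x v"
  have "hdir b x v T = a_adj b (- ?l)"
    by (simp add: hdir_def a_adj_def fun_eq_iff sum_negf)
  then have "a_op b T (hdir b x v T) = - (Cmat b T *v ?l)"
    by (simp add: a_op_a_adj[OF assms(1)] matrix_vector_mult_def vec_eq_iff sum_negf)
  moreover have "Cmat b T ** matrix_inv (Cmat b T) = mat 1"
    using assms(2) unfolding invertible_def matrix_inv_def by (rule someI2_ex) blast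
  ultimately show ?thesis
    by (simp add: matrix_vector_mul_assoc)
qed

end

theory Submission
  imports Defs
begin

text \<open>Write \<open>Z\<^sub>t = \<integral>\<^sub>0\<^sup>t e\<^sup>i\<^sup>B\<^sup>s ds\<close>, so that \<open>h\<^sub>1 = Im Z\<close> and \<open>h\<^sub>2 = - Re Z\<close>. Since \<open>e\<^sup>i\<^sup>B\<close> is the derivative of
  \<open>Z\<close>, an integration by parts in the inner integral of \<open>\<delta>h\<close> gives a pathwise bound of \<open>\<delta>h\<close> by
  \<open>\<bar>v\<^sub>R\<bar> + \<bar>v\<^sub>C\<bar> / \<surd>T\<close> times a polynomial in \<open>T\<^sup>-\<^sup>2 \<integral> \<bar>Z\<bar>\<^sup>2\<close>, in rescaled increments of \<open>B\<close> and in the inverse of the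
  diffusively rescaled Gram matrix. Everything then reduces to moment bounds that are uniform in \<open>T\<close>.

  Positive moments of \<open>Z\<close> follow from a recursion: \<open>X\<^sup>p\<close>, for a coordinate \<open>X\<close> of \<open>Z\<close>, is a double
  integral whose expectation decays exponentially off the diagonal. For the inverse moments, cut
  \<open>[0, T]\<close> into \<open>N\<close> blocks. A quadratic form of the Gram matrix dominates the sum of the
  contributions of the blocks; these are independent and, since they do not change when the path is
  rotated, each has the law of the contribution of a Brownian motion started at \<open>0\<close>. A second
  moment argument bounds the Laplace transform of one contribution at its own scale by some
  \<open>\<rho> < 1\<close>. Hence the Laplace transform of the normalised smallest eigenvalue at \<open>const N\<^sup>4\<close> is at
  most \<open>\<rho>\<^sup>N\<close>, for every \<open>N\<close>, which yields all inverse moments.\<close>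

section \<open>Past and future of a Brownian path\<close>

text \<open>The bound from below has to hold for all affine functions
  \<open>c + Re (\<eta> * Z)\<close> at once, that is over a whole sphere of directions. A net on
  the sphere is avoided: differences at three equally spaced times remove \<open>c\<close>, and the
  two differences are a linear image of \<open>\<eta>\<close> whose least squared singular value is
  at least determinant squared over squared Hilbert-Schmidt norm. This quotient,
  \<open>triangle_form\<close>, depends on the path alone and is unchanged by rotations. It uses
  values at single times, whereas the Gram matrix integrates over time; so the starting time of the
  triangles runs over an interval of length \<open>a\<close>. For a fixed start the blocks are
  independent, and convexity of the exponential carries the Laplace bound over to the average. The
  power N^4 comes from short blocks. There the path is nearly straight, its transversal deviation is
  of order a^(3/2), the form of order a^3 instead of a, and a block contributes a^4 to the energy,
  with a proportional to T / N.\<close>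

definition path_algebra :: "'a measure \<Rightarrow> real set \<Rightarrow> (real \<Rightarrow> 'a \<Rightarrow> real) \<Rightarrow> 'a measure" where
  "path_algebra M I X =
     vimage_algebra (space M) (\<lambda>\<omega>. \<lambda>i\<in>I. X i \<omega>) (PiM I (\<lambda>_. borel))"

lemma space_path_algebra [simp]: "space (path_algebra M I X) = space M"
  by (simp add: path_algebra_def)

lemma measurable_path_algebra:
  assumes "i \<in> I"
  shows "X i \<in> borel_measurable (path_algebra M I X)"
proof -
  have "(\<lambda>\<omega>. \<lambda>i\<in>I. X i \<omega>) \<in> measurable (path_algebra M I X) (PiM I (\<lambda>_. borel))"
    unfolding path_algebra_def
    by (rule measurable_vimage_algebra1) (auto simp: space_PiM)
  from measurable_compose[OF this measurable_component_singleton[OF assms]]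
  show ?thesis using assms by simp
qed

lemma restrict_in_cylinder:
  assumes "J \<subseteq> I"
  shows "(\<lambda>i\<in>I. f i) \<in> prod_emb I (\<lambda>_. borel) J (\<Pi>\<^sub>E j\<in>J. E j) \<longleftrightarrow> (\<forall>j\<in>J. f j \<in> E j)"
  unfolding prod_emb_iff using assms
  by (simp add: restrict_PiE_iff Int_absorb1 subset_iff Pi_iff)

text \<open>The hypotheses give independence of increments only along one finite partition.
  Finite-dimensional cylinders form intersection-stable generators of both algebras, so one pair of
  cylinders suffices. All their times are merged into a single partition through \<open>t\<close>;
  the past cylinder then constrains increments before \<open>t\<close>, the future cylinder
  increments after \<open>t\<close>.\<close>

lemma (in standard_brownian_motion) indep_past_future:
  assumes t: "0 \<le> t"
  shows "indep_set (sets (path_algebra M {0..t} B))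
    (sets (path_algebra M {0..} (\<lambda>s \<omega>. B (t + s) \<omega> - B t \<omega>)))"
proof -
  define P where "P = (\<lambda>\<omega>. \<lambda>i\<in>{0..t}. B i \<omega>)"
  define F where "F = (\<lambda>\<omega>. \<lambda>i\<in>{0..}. B (t + i) \<omega> - B t \<omega>)"
  let ?GP = "{P -` A \<inter> space M | A. A \<in> prod_algebra {0..t} (\<lambda>_. borel :: real measure)}"
  let ?GF = "{F -` A \<inter> space M | A. A \<in> prod_algebra {0..} (\<lambda>_. borel :: real measure)}"
  have Pm: "P \<in> measurable M (PiM {0..t} (\<lambda>_. borel))"
    unfolding P_def by (intro measurable_restrict measurable_B) auto
  have Fm: "F \<in> measurable M (PiM {0..} (\<lambda>_. borel))"
    unfolding F_def using t by (intro measurable_restrict borel_measurable_diff measurable_B) auto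
  have gen: "sets (path_algebra M {0..t} B) = sigma_sets (space M) ?GP"
    "sets (path_algebra M {0..} (\<lambda>s \<omega>. B (t + s) \<omega> - B t \<omega>)) = sigma_sets (space M) ?GF"
    unfolding path_algebra_def P_def[symmetric] F_def[symmetric]
    by (subst sets_vimage_algebra2, (simp add: P_def F_def space_PiM; fail),
        simp only: sets_PiM, rule sigma_sets_vimage_commute,
        simp add: P_def F_def PiE_def extensional_def)+
  have IntS: "Int_stable {X -` A \<inter> space M | A. A \<in> prod_algebra I (\<lambda>_. borel :: real measure)}"
    for X :: "'a \<Rightarrow> real \<Rightarrow> real" and I
  proof (rule Int_stableI)
    fix a b
    assume "a \<in> {X -` A \<inter> space M | A. A \<in> prod_algebra I (\<lambda>_. borel :: real measure)}"
      "b \<in> {X -` A \<inter> space M | A. A \<in> prod_algebra I (\<lambda>_. borel :: real measure)}"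
    then obtain A A' where AA': "a = X -` A \<inter> space M" "b = X -` A' \<inter> space M"
      "A \<in> prod_algebra I (\<lambda>_. borel :: real measure)" "A' \<in> prod_algebra I (\<lambda>_. borel :: real measure)"
      by blast
    then have "A \<inter> A' \<in> prod_algebra I (\<lambda>_. borel :: real measure)"
      using Int_stable_prod_algebra unfolding Int_stable_def by blast
    moreover have "a \<inter> b = X -` (A \<inter> A') \<inter> space M" using AA' by auto
    ultimately show "a \<inter> b \<in> {X -` A \<inter> space M | A. A \<in> prod_algebra I (\<lambda>_. borel :: real measure)}"
      by blast
  qed
  have "indep_set ?GP ?GF"
  proof (rule indep_setI)
    have "\<And>A I. A \<in> prod_algebra I (\<lambda>_. borel :: real measure) \<Longrightarrow> A \<in> sets (PiM I (\<lambda>_. borel))"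
      unfolding sets_PiM by auto
    then show "?GP \<subseteq> events" "?GF \<subseteq> events"
      using Pm Fm by (auto intro: measurable_sets)
    fix a b assume a: "a \<in> ?GP" and b: "b \<in> ?GF"
    obtain A A' where A: "a = P -` A \<inter> space M" "A \<in> prod_algebra {0..t} (\<lambda>_. borel :: real measure)"
      and A': "b = F -` A' \<inter> space M" "A' \<in> prod_algebra {0..} (\<lambda>_. borel :: real measure)"
      using a b by blast
    obtain J E where J: "A = prod_emb {0..t} (\<lambda>_. borel :: real measure) J (\<Pi>\<^sub>E j\<in>J. E j)"
      "finite J" "J \<subseteq> {0..t}" "\<And>i. i \<in> J \<Longrightarrow> E i \<in> sets borel" "J \<noteq> {}"
      using A(2) t by (elim prod_algebraE) force
    obtain K G where K: "A' = prod_emb {0..} (\<lambda>_. borel :: real measure) K (\<Pi>\<^sub>E j\<in>K. G j)"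
      "finite K" "K \<subseteq> {0..}" "\<And>i. i \<in> K \<Longrightarrow> G i \<in> sets borel" "K \<noteq> {}"
      using A'(2) by (elim prod_algebraE) force
    \<comment> \<open>The time 0 is included so that \<open>B j\<close> is the sum of all increments
      up to \<open>j\<close>, by \<open>start_zero\<close>; the time \<open>t\<close> is included so
      that no increment straddles the cut.\<close>
    define S where "S = insert 0 (insert t (J \<union> (+) t ` K))"
    have S: "finite S" "S \<subseteq> {0..}" "0 \<in> S" "t \<in> S" using J K t by (auto simp: S_def)
    define l where "l = sorted_list_of_set S"
    have l: "set l = S" "sorted l" "distinct l" "l \<noteq> []" using S by (auto simp: l_def)
    define n where "n = length l - 1"
    have ln: "length l = Suc n" using l by (cases l) (auto simp: n_def)
    define \<tau> where "\<tau> = (\<lambda>i. l ! i)"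
    have mono: "\<tau> i \<le> \<tau> j" if "i \<le> j" "j \<le> n" for i j
      using that l ln by (auto simp: \<tau>_def intro: sorted_nth_mono)
    have ex: "\<exists>i\<le>n. \<tau> i = s" if "s \<in> S" for s
      using that l ln by (metis \<tau>_def in_set_conv_nth less_Suc_eq_le)
    have \<tau>S: "\<tau> i \<in> S" if "i \<le> n" for i using that l ln by (metis \<tau>_def nth_mem less_Suc_eq_le)
    have \<tau>0: "\<tau> 0 = 0"
    proof -
      obtain i where "i \<le> n" "\<tau> i = 0" using ex S by blast
      then have "\<tau> 0 \<le> 0" using mono[of 0 i] by simp
      moreover have "0 \<le> \<tau> 0" using \<tau>S[of 0] S by auto
      ultimately show ?thesis by simp
    qed
    obtain idx where idx: "\<And>s. s \<in> S \<Longrightarrow> idx s \<le> n \<and> \<tau> (idx s) = s"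
      using ex by metis
    have idx_mono: "idx s \<le> idx r" if "s \<in> S" "r \<in> S" "s \<le> r" for s r
    proof (rule ccontr)
      assume "\<not> idx s \<le> idx r"
      then have "idx r \<le> idx s" by simp
      then have "r \<le> s" using mono[of "idx r" "idx s"] idx that by auto
      then show False using that \<open>\<not> idx s \<le> idx r\<close> by auto
    qed
    define D where "D = (\<lambda>i \<omega>. B (\<tau> (Suc i)) \<omega> - B (\<tau> i) \<omega>)"
    have indD: "indep_vars (\<lambda>_. borel) D {..<n}"
      unfolding D_def using independent_increments[of \<tau> n] mono \<tau>0 by auto
    have tel: "(\<Sum>i\<in>{i..<j}. D i \<omega>) = B (\<tau> j) \<omega> - B (\<tau> i) \<omega>" if "i \<le> j" for i j \<omega>
      unfolding D_def using sum_Suc_diff'[OF that, of "\<lambda>i. B (\<tau> i) \<omega>"] by simp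
    define m where "m = idx t"
    have m: "m \<le> n" "\<tau> m = t" using idx S by (auto simp: m_def)
    have ind2: "indep_var (PiM {..<m} (\<lambda>_. borel)) (\<lambda>\<omega>. restrict (\<lambda>i. D i \<omega>) {..<m})
       (PiM {m..<n} (\<lambda>_. borel)) (\<lambda>\<omega>. restrict (\<lambda>i. D i \<omega>) {m..<n})"
      by (rule indep_var_restrict[OF indD]) (use m in auto)
    \<comment> \<open>Both cylinders become conditions on partial sums of increments, counted from 0
      for the past and from the cut \<open>m\<close> for the future.\<close>
    define XA where "XA = {x \<in> space (PiM {..<m} (\<lambda>_. borel)). \<forall>j\<in>J. (\<Sum>i\<in>{0..<idx j}. x i) \<in> E j}"
    define XB where "XB = {x \<in> space (PiM {m..<n} (\<lambda>_. borel)). \<forall>k\<in>K. (\<Sum>i\<in>{m..<idx (t + k)}. x i) \<in> G k}"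
    have idxJ: "idx j \<le> m" if "j \<in> J" for j
      unfolding m_def using that J(3) by (intro idx_mono) (auto simp: S_def)
    have idxK: "m \<le> idx (t + k)" "idx (t+k) \<le> n" if "k \<in> K" for k
    proof -
      have "t + k \<in> S" "0 \<le> k" using that K(3) by (auto simp: S_def)
      then show "m \<le> idx (t + k)" "idx (t+k) \<le> n"
        unfolding m_def using idx idx_mono S(4) by auto
    qed
    have XA: "XA \<in> sets (PiM {..<m} (\<lambda>_. borel))"
      unfolding XA_def
    proof (rule sets.sets_Collect_finite_All'[OF _ J(2,5)], goal_cases)
      case (1 j)
      have "(\<lambda>x. \<Sum>i\<in>{0..<idx j}. x i) \<in> borel_measurable (PiM {..<m} (\<lambda>_. borel :: real measure))"
        using idxJ[OF 1] by (intro borel_measurable_sum measurable_component_singleton) auto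
      from measurable_sets[OF this J(4)[OF 1]] show ?case
        by (simp add: vimage_def Int_def conj_commute)
    qed
    have XB: "XB \<in> sets (PiM {m..<n} (\<lambda>_. borel))"
      unfolding XB_def
    proof (rule sets.sets_Collect_finite_All'[OF _ K(2,5)], goal_cases)
      case (1 k)
      have "(\<lambda>x. \<Sum>i\<in>{m..<idx (t + k)}. x i) \<in> borel_measurable (PiM {m..<n} (\<lambda>_. borel :: real measure))"
        using idxK[OF 1] by (intro borel_measurable_sum measurable_component_singleton) auto
      from measurable_sets[OF this K(4)[OF 1]] show ?case
        by (simp add: vimage_def Int_def conj_commute)
    qed
    let ?U = "\<lambda>\<omega>. restrict (\<lambda>i. D i \<omega>) {..<m}" and ?V = "\<lambda>\<omega>. restrict (\<lambda>i. D i \<omega>) {m..<n}"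
    have "(\<Sum>i\<in>{0..<idx j}. ?U \<omega> i) = B j \<omega>" if "j \<in> J" "\<omega> \<in> space M" for j \<omega>
    proof -
      have "(\<Sum>i\<in>{0..<idx j}. ?U \<omega> i) = (\<Sum>i\<in>{0..<idx j}. D i \<omega>)"
        using idxJ[OF that(1)] by (intro sum.cong) auto
      also have "\<dots> = B j \<omega>"
        using tel[of 0 "idx j" \<omega>] that idx[of j] start_zero \<tau>0 by (auto simp: S_def)
      finally show ?thesis .
    qed
    note sumU = this
    have "?U \<omega> \<in> XA \<longleftrightarrow> P \<omega> \<in> A" if "\<omega> \<in> space M" for \<omega>
      unfolding J(1) P_def restrict_in_cylinder[OF J(3)] XA_def
      using sumU[OF _ that] by (simp add: space_PiM)
    then have aU: "a = ?U -` XA \<inter> space M"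
      unfolding A(1) by blast
    have "(\<Sum>i\<in>{m..<idx (t + k)}. ?V \<omega> i) = B (t + k) \<omega> - B t \<omega>" if "k \<in> K" "\<omega> \<in> space M" for k \<omega>
    proof -
      have "(\<Sum>i\<in>{m..<idx (t + k)}. ?V \<omega> i) = (\<Sum>i\<in>{m..<idx (t + k)}. D i \<omega>)"
        using idxK[OF that(1)] by (intro sum.cong) auto
      also have "\<dots> = B (t + k) \<omega> - B t \<omega>"
        using tel[of m "idx (t + k)" \<omega>] idxK[OF that(1)] that idx[of "t + k"] m by (auto simp: S_def)
      finally show ?thesis .
    qed
    note sumV = this
    have "?V \<omega> \<in> XB \<longleftrightarrow> F \<omega> \<in> A'" if "\<omega> \<in> space M" for \<omega>
      unfolding K(1) F_def restrict_in_cylinder[OF K(3)] XB_def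
      using sumV[OF _ that] by (simp add: space_PiM)
    then have bV: "b = ?V -` XB \<inter> space M"
      unfolding A'(1) by blast
    have "a \<inter> b = (\<lambda>x. (?U x, ?V x)) -` (XA \<times> XB) \<inter> space M"
      unfolding aU bV by auto
    then show "prob (a \<inter> b) = prob a * prob b"
      using indep_varD[OF ind2 XA XB] unfolding aU[symmetric] bV[symmetric] by (simp only:)
  qed
  then show ?thesis
    unfolding gen by (rule indep_set_sigma_sets[OF _ IntS[of P "{0..t}"] IntS[of F "{0..}"]])
qed


text \<open>The sigma-algebras generated by \<open>f\<close> and \<open>g\<close> lie in those of
  the past and of the future. This product rule and \<open>shifted_brownian_motion\<close> are the
  only channels through which independence of increments is used later.\<close>

lemma (in standard_brownian_motion) expectation_past_future:
  fixes f g :: "'a \<Rightarrow> real"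
  assumes t: "0 \<le> t"
    and f: "f \<in> borel_measurable (path_algebra M {0..t} B)"
    and g: "g \<in> borel_measurable (path_algebra M {0..} (\<lambda>s \<omega>. B (t + s) \<omega> - B t \<omega>))"
    and "integrable M f" "integrable M g"
  shows "expectation (\<lambda>\<omega>. f \<omega> * g \<omega>) = expectation f * expectation g"
    and "integrable M (\<lambda>\<omega>. f \<omega> * g \<omega>)"
proof -
  have rv: "random_variable borel f" "random_variable borel g"
    by (rule borel_measurable_integrable, fact)+
  let ?P = "path_algebra M {0..t} B"
  let ?F = "path_algebra M {0..} (\<lambda>s \<omega>. B (t + s) \<omega> - B t \<omega>)"
  have sub: "sigma_sets (space M) {h -` A \<inter> space M |A. A \<in> sets borel} \<subseteq> sets N"
    if "h \<in> borel_measurable N" "space N = space M" for N and h :: "'a \<Rightarrow> real"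
  proof -
    have "{h -` A \<inter> space M |A. A \<in> sets borel} \<subseteq> sets N"
      using measurable_sets[OF that(1)] that(2) by auto
    from sets.sigma_sets_subset[OF this] show ?thesis using that(2) by simp
  qed
  note ind = indep_past_future[OF t]
  note subf = sub[OF f space_path_algebra] and subg = sub[OF g space_path_algebra]
  have "indep_set (sigma_sets (space M) {f -` A \<inter> space M |A. A \<in> sets borel})
      (sigma_sets (space M) {g -` A \<inter> space M |A. A \<in> sets borel})"
  proof (rule indep_setI)
    show "sigma_sets (space M) {f -` A \<inter> space M |A. A \<in> sets borel} \<subseteq> events"
      by (rule order_trans[OF subf indep_setD_ev1[OF ind]])
    show "sigma_sets (space M) {g -` A \<inter> space M |A. A \<in> sets borel} \<subseteq> events"
      by (rule order_trans[OF subg indep_setD_ev2[OF ind]])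
    show "prob (a \<inter> b) = prob a * prob b"
      if "a \<in> sigma_sets (space M) {f -` A \<inter> space M |A. A \<in> sets borel}"
        "b \<in> sigma_sets (space M) {g -` A \<inter> space M |A. A \<in> sets borel}" for a b
      by (rule indep_setD[OF ind subsetD[OF subf that(1)] subsetD[OF subg that(2)]])
  qed
  then have "indep_var borel f borel g"
    unfolding indep_var_eq using rv by simp
  then show "expectation (\<lambda>\<omega>. f \<omega> * g \<omega>) = expectation f * expectation g"
    "integrable M (\<lambda>\<omega>. f \<omega> * g \<omega>)"
    using indep_var_lebesgue_integral[OF _ assms(4,5)] indep_var_integrable[OF _ assms(4,5)] by blast+
qed

text \<open>Restart at time \<open>t\<close>: through \<open>interpret\<close>, every estimate
  proved for a path issued from 0 becomes available for the increments after
  \<open>t\<close>.\<close>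

lemma (in standard_brownian_motion) shifted_brownian_motion:
  assumes t: "0 \<le> t"
  shows "standard_brownian_motion M (\<lambda>s \<omega>. B (t + s) \<omega> - B t \<omega>)"
proof
  show "(\<lambda>\<omega>. B (t + s) \<omega> - B t \<omega>) \<in> borel_measurable M" if "0 \<le> s" for s
    using that t by (intro borel_measurable_diff measurable_B) auto
  show "B (t + 0) \<omega> - B t \<omega> = 0" for \<omega> by simp
  show "indep_vars (\<lambda>_. borel)
       (\<lambda>i \<omega>. B (t + r (Suc i)) \<omega> - B t \<omega> - (B (t + r i) \<omega> - B t \<omega>)) {..<n}"
    if "0 \<le> r 0" "\<And>i. i < n \<Longrightarrow> r i \<le> r (Suc i)" for n and r :: "nat \<Rightarrow> real"
    using independent_increments[of "\<lambda>i. t + r i" n] that t by simp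
  show "distributed M lborel (\<lambda>\<omega>. B (t + u) \<omega> - B t \<omega> - (B (t + s) \<omega> - B t \<omega>))
      (normal_density 0 (sqrt (u - s)))" if "0 \<le> s" "s < u" for s u
    using gaussian_increments[of "t + s" "t + u"] that t by simp
  show "continuous_on {0..} (\<lambda>s. B (t + s) \<omega> - B t \<omega>)" if "\<omega> \<in> space M" for \<omega>
    using t by (intro continuous_intros continuous_on_compose2[OF continuous_paths[OF that]]) auto
qed

text \<open>By continuity the process is the limit of its values at the times rounded down to
  multiples of \<open>1 / Suc n\<close>. Each approximation involves only countably many random
  variables and is therefore jointly measurable.\<close>

lemma measurable_pair_continuous_paths:
  fixes X :: "real \<Rightarrow> 'a \<Rightarrow> 'b::metric_space"
  assumes X: "\<And>t. X t \<in> borel_measurable N"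
    and cont: "\<And>\<omega>. \<omega> \<in> space N \<Longrightarrow> continuous_on UNIV (\<lambda>t. X t \<omega>)"
  shows "(\<lambda>(t, \<omega>). X t \<omega>) \<in> borel_measurable (borel \<Otimes>\<^sub>M N)"
proof (rule borel_measurable_LIMSEQ_metric)
  let ?r = "\<lambda>n (t::real). real_of_int \<lfloor>t * Suc n\<rfloor> / Suc n"
  show "(\<lambda>p. X (?r n (fst p)) (snd p)) \<in> borel_measurable (borel \<Otimes>\<^sub>M N)" for n
  proof -
    have "(\<lambda>p. X (real_of_int k / Suc n) (snd p)) \<in> borel_measurable (borel \<Otimes>\<^sub>M N)" for k
      by (rule measurable_compose[OF measurable_snd X])
    moreover have "(\<lambda>p. \<lfloor>fst p * real (Suc n)\<rfloor>) \<in> measurable (borel \<Otimes>\<^sub>M N) (count_space UNIV)"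
      by (rule measurable_compose[OF measurable_fst]) measurable
    ultimately show ?thesis
      by (rule measurable_compose_countable[where f="\<lambda>k p. X (real_of_int k / Suc n) (snd p)"])
  qed
  fix p :: "real \<times> 'a" assume p: "p \<in> space (borel \<Otimes>\<^sub>M N)"
  have "(\<lambda>n. ?r n (fst p)) \<longlonglongrightarrow> fst p"
  proof (rule tendsto_sandwich[of "\<lambda>n. fst p - 1 / Suc n" _ _ "\<lambda>n. fst p"])
    show "\<forall>\<^sub>F n in sequentially. fst p - 1 / Suc n \<le> ?r n (fst p)"
    proof (intro always_eventually allI)
      fix n
      have "fst p * Suc n - 1 \<le> real_of_int \<lfloor>fst p * Suc n\<rfloor>" by linarith
      then have "(fst p * Suc n - 1) / Suc n \<le> ?r n (fst p)" by (intro divide_right_mono) auto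
      then show "fst p - 1 / Suc n \<le> ?r n (fst p)" by (simp add: diff_divide_distrib)
    qed
    show "\<forall>\<^sub>F n in sequentially. ?r n (fst p) \<le> fst p"
    proof (intro always_eventually allI)
      fix n
      have "real_of_int \<lfloor>fst p * Suc n\<rfloor> / Suc n \<le> fst p * Suc n / Suc n"
        by (intro divide_right_mono of_int_floor_le) auto
      then show "?r n (fst p) \<le> fst p" by simp
    qed
    show "(\<lambda>n. fst p - 1 / real (Suc n)) \<longlonglongrightarrow> fst p"
      using tendsto_diff[OF tendsto_const LIMSEQ_inverse_real_of_nat, of "fst p"]
      by (simp add: inverse_eq_divide)
  qed simp
  moreover have "isCont (\<lambda>t. X t (snd p)) (fst p)"
    using cont[of "snd p"] p by (auto simp: space_pair_measure continuous_on_eq_continuous_at)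
  ultimately have "(\<lambda>n. X (?r n (fst p)) (snd p)) \<longlonglongrightarrow> X (fst p) (snd p)"
    by (rule isCont_tendsto_compose[rotated])
  then show "(\<lambda>n. X (?r n (fst p)) (snd p)) \<longlonglongrightarrow> (case p of (t, \<omega>) \<Rightarrow> X t \<omega>)"
    by (simp add: case_prod_beta)
qed

section \<open>The integral of the rotating unit vector\<close>

lemma LBINT_eq_integral:
  fixes f :: "real \<Rightarrow> 'b::euclidean_space"
  assumes "continuous_on {a..b} f"
  shows "(LBINT t:{a..b}. f t) = integral {a..b} f"
  by (intro set_borel_integral_eq_integral(2) borel_integrable_atLeastAtMost' assms)

definition Zint :: "(real \<Rightarrow> real) \<Rightarrow> real \<Rightarrow> complex" where
  "Zint b t = (LBINT s:{0..t}. cis (b s))"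

lemma continuous_on_cis_path:
  assumes "continuous_on S b" shows "continuous_on S (\<lambda>s. cis (b s))"
  using assms by (intro continuous_intros)

lemma Zint_eq_integral:
  assumes "continuous_on {0..} b"
  shows "Zint b t = integral {0..t} (\<lambda>s. cis (b s))"
  unfolding Zint_def
  by (intro LBINT_eq_integral continuous_on_cis_path continuous_on_subset[OF assms]) auto

lemma Zint_0 [simp]: "Zint b 0 = 0"
proof -
  have "AE x in lborel. indicator {0} x *\<^sub>R cis (b x) = 0"
    using AE_lborel_singleton[of 0] by eventually_elim auto
  then show ?thesis by (simp add: Zint_def set_lebesgue_integral_def integral_eq_zero_AE)
qed

lemma Zint_has_vector_derivative:
  assumes "continuous_on {0..} b" "t \<in> {0..T}"
  shows "(Zint b has_vector_derivative cis (b t)) (at t within {0..T})"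
  unfolding Zint_eq_integral[OF assms(1), abs_def]
  by (intro integral_has_vector_derivative continuous_on_cis_path continuous_on_subset[OF assms(1)])
    (use assms in auto)

lemma continuous_on_Zint:
  assumes "continuous_on {0..} b"
  shows "continuous_on {0..T} (Zint b)"
  unfolding continuous_on_eq_continuous_within
  using Zint_has_vector_derivative[OF assms] has_vector_derivative_continuous by blast

lemma Zint_diff:
  assumes b: "continuous_on {0..} b" and "0 \<le> r" "0 \<le> s"
  shows "Zint b (r + s) - Zint b r = Zint (\<lambda>u. b (r + u)) s"
proof -
  have c: "continuous_on {0..} (\<lambda>u. b (r + u))"
    using assms by (intro continuous_on_compose2[OF b] continuous_intros) auto
  have "integral {0..r} (\<lambda>s. cis (b s)) + integral {r..r+s} (\<lambda>s. cis (b s)) = integral {0..r+s} (\<lambda>s. cis (b s))"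
    using assms by (intro Henstock_Kurzweil_Integration.integral_combine integrable_continuous_real
        continuous_on_cis_path continuous_on_subset[OF b]) auto
  moreover have "integral {r..r+s} (\<lambda>s. cis (b s)) = integral {0..s} (\<lambda>u. cis (b (r + u)))"
    using integral_shift_Icc_real[of 0 s "\<lambda>u. cis (b u)" r] by (simp add: o_def add.commute)
  ultimately show ?thesis
    unfolding Zint_eq_integral[OF b] Zint_eq_integral[OF c] by (simp add: algebra_simps)
qed

lemma Zint_minus_const: "Zint (\<lambda>s. b s - c) t = cis (- c) * Zint b t"
  unfolding Zint_def by (simp add: cis_mult[symmetric] diff_conv_add_uminus mult.commute
      set_integral_mult_right del: add_uminus_conv_diff)

lemma norm_Zint_le:
  assumes b: "continuous_on {0..} b" and "0 \<le> t"
  shows "norm (Zint b t) \<le> t"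
proof -
  have "norm (integral {0..t} (\<lambda>s. cis (b s))) \<le> 1 * (t - 0)"
    using assms by (intro integral_bound continuous_on_cis_path continuous_on_subset[OF b]) auto
  then show ?thesis by (simp add: Zint_eq_integral[OF b])
qed

text \<open>Trades one power of an integral for one time integration, which starts the moment
  recursion; with \<open>n = 0\<close> it is the fundamental theorem of calculus.\<close>

lemma power_primitive:
  fixes f f' :: "real \<Rightarrow> real"
  assumes f: "\<And>t. t \<in> {0..a} \<Longrightarrow> (f has_vector_derivative f' t) (at t within {0..a})"
    and f': "continuous_on {0..a} f'" and "f 0 = 0" "0 \<le> a"
  shows "f a ^ Suc n = real (Suc n) * (LBINT t:{0..a}. f t ^ n * f' t)"
proof -
  have cf: "continuous_on {0..a} f"
    unfolding continuous_on_eq_continuous_within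
    using f has_vector_derivative_continuous by blast
  have hi: "((\<lambda>t. real (Suc n) * (f t ^ n * f' t)) has_integral (f a ^ Suc n - f 0 ^ Suc n)) {0..a}"
  proof (rule fundamental_theorem_of_calculus[OF assms(4)])
    fix t assume "t \<in> {0..a}"
    from f[OF this] have "(f has_real_derivative f' t) (at t within {0..a})"
      by (simp add: has_real_derivative_iff_has_vector_derivative)
    from DERIV_power[OF this, of "Suc n"]
    show "((\<lambda>t. f t ^ Suc n) has_vector_derivative real (Suc n) * (f t ^ n * f' t)) (at t within {0..a})"
      by (simp add: has_real_derivative_iff_has_vector_derivative algebra_simps)
  qed
  have "f a ^ Suc n = integral {0..a} (\<lambda>t. real (Suc n) * (f t ^ n * f' t))"
    using integral_unique[OF hi] assms(3) by (simp only: power_0_Suc diff_zero)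
  also have "\<dots> = real (Suc n) * integral {0..a} (\<lambda>t. f t ^ n * f' t)"
    by (rule integral_mult_right)
  also have "integral {0..a} (\<lambda>t. f t ^ n * f' t) = (LBINT t:{0..a}. f t ^ n * f' t)"
    by (intro LBINT_eq_integral[symmetric] continuous_intros cf f')
  finally show ?thesis .
qed

lemma borel_measurable_LBINT_paths:
  fixes F :: "real \<Rightarrow> 'a \<Rightarrow> 'b::euclidean_space"
  assumes m: "\<And>s. 0 \<le> s \<Longrightarrow> s \<le> a \<Longrightarrow> F s \<in> borel_measurable N"
    and c: "\<And>\<omega>. \<omega> \<in> space N \<Longrightarrow> continuous_on {0..a} (\<lambda>s. F s \<omega>)"
    and "0 \<le> a"
  shows "(\<lambda>p. indicator {0..a} (fst p) *\<^sub>R F (fst p) (snd p)) \<in> borel_measurable (lborel \<Otimes>\<^sub>M N)"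
    and "(\<lambda>\<omega>. LBINT s:{0..a}. F s \<omega>) \<in> borel_measurable N"
proof -
  \<comment> \<open>Freezing time outside \<open>{0..a}\<close> gives a process continuous on the
    whole line, as \<open>measurable_pair_continuous_paths\<close> requires; the indicator removes
    the difference.\<close>
  let ?F = "\<lambda>s. F (max 0 (min a s))"
  have "(\<lambda>(s, \<omega>). ?F s \<omega>) \<in> borel_measurable (borel \<Otimes>\<^sub>M N)"
  proof (rule measurable_pair_continuous_paths)
    show "continuous_on UNIV (\<lambda>s. ?F s \<omega>)" if "\<omega> \<in> space N" for \<omega>
      using assms(3) by (intro continuous_on_compose2[OF c[OF that]] continuous_intros) auto
  qed (use assms(3) in \<open>auto intro!: m\<close>)
  then have F: "(\<lambda>p. ?F (fst p) (snd p)) \<in> borel_measurable (lborel \<Otimes>\<^sub>M N)"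
    by (simp add: case_prod_beta cong: measurable_cong_sets sets_pair_measure_cong)
  have "(\<lambda>p. indicator {0..a} (fst p) *\<^sub>R ?F (fst p) (snd p)) \<in> borel_measurable (lborel \<Otimes>\<^sub>M N)"
    by (intro borel_measurable_scaleR F) measurable
  moreover have eq: "indicator {0..a} s *\<^sub>R ?F s \<omega> = indicator {0..a} s *\<^sub>R F s \<omega>" for s \<omega>
    by (auto simp: indicator_def)
  ultimately show G: "(\<lambda>p. indicator {0..a} (fst p) *\<^sub>R F (fst p) (snd p)) \<in> borel_measurable (lborel \<Otimes>\<^sub>M N)"
    by simp
  have "(\<lambda>p. indicator {0..a} (snd p) *\<^sub>R F (snd p) (fst p)) \<in> borel_measurable (N \<Otimes>\<^sub>M lborel)"
    using measurable_compose[OF measurable_pair_swap' G] by (simp add: case_prod_beta)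
  then show "(\<lambda>\<omega>. LBINT s:{0..a}. F s \<omega>) \<in> borel_measurable N"
    unfolding set_lebesgue_integral_def
    by (intro sigma_finite_measure.borel_measurable_lebesgue_integral lborel.sigma_finite_measure_axioms)
      (simp add: case_prod_beta)
qed

lemma (in prob_space) expectation_LBINT:
  fixes F :: "real \<Rightarrow> 'a \<Rightarrow> real"
  assumes m: "\<And>s. 0 \<le> s \<Longrightarrow> s \<le> a \<Longrightarrow> F s \<in> borel_measurable M"
    and c: "\<And>\<omega>. \<omega> \<in> space M \<Longrightarrow> continuous_on {0..a} (\<lambda>s. F s \<omega>)"
    and a: "0 \<le> a"
    and K: "\<And>s \<omega>. 0 \<le> s \<Longrightarrow> s \<le> a \<Longrightarrow> \<omega> \<in> space M \<Longrightarrow> \<bar>F s \<omega>\<bar> \<le> K"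
  shows "expectation (\<lambda>\<omega>. LBINT s:{0..a}. F s \<omega>) = (LBINT s:{0..a}. expectation (F s))"
    and "set_integrable lborel {0..a} (\<lambda>s. expectation (F s))"
proof -
  let ?f = "\<lambda>p. indicator {0..a} (fst p) *\<^sub>R F (fst p) (snd p)"
  interpret P: pair_sigma_finite lborel M
    by standard
  have em: "emeasure (lborel \<Otimes>\<^sub>M M) ({0..a} \<times> space M) < \<infinity>"
    using a by (simp add: emeasure_pair_measure_Times emeasure_space_1)
  have int: "integrable (lborel \<Otimes>\<^sub>M M) ?f"
  proof (rule integrableI_bounded_set[OF _ _ em])
    show "?f \<in> borel_measurable (lborel \<Otimes>\<^sub>M M)"
      by (rule borel_measurable_LBINT_paths(1)[OF m c a])
    show "AE p in lborel \<Otimes>\<^sub>M M. p \<in> {0..a} \<times> space M \<longrightarrow> norm (?f p) \<le> K"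
      using K by (intro AE_I2) auto
    show "AE p in lborel \<Otimes>\<^sub>M M. p \<notin> {0..a} \<times> space M \<longrightarrow> ?f p = 0"
      by (intro AE_I2) (auto simp: space_pair_measure indicator_def)
  qed auto
  have E: "(LINT \<omega>|M. ?f (s, \<omega>)) = indicator {0..a} s *\<^sub>R expectation (F s)" for s
    by simp
  show "set_integrable lborel {0..a} (\<lambda>s. expectation (F s))"
    using P.integrable_fst'[OF int] unfolding E set_integrable_def .
  show "expectation (\<lambda>\<omega>. LBINT s:{0..a}. F s \<omega>) = (LBINT s:{0..a}. expectation (F s))"
  proof -
    have "integrable (lborel \<Otimes>\<^sub>M M) (\<lambda>(s, \<omega>). ?f (s, \<omega>))" using int by (simp add: case_prod_beta')
    from P.Fubini_integral[OF this] show ?thesis by (simp add: set_lebesgue_integral_def)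
  qed
qed

lemma borel_measurable_Zint:
  assumes m: "\<And>s. 0 \<le> s \<Longrightarrow> s \<le> t \<Longrightarrow> X s \<in> borel_measurable N"
    and c: "\<And>\<omega>. \<omega> \<in> space N \<Longrightarrow> continuous_on {0..} (\<lambda>s. X s \<omega>)"
    and t: "0 \<le> t"
  shows "(\<lambda>\<omega>. Zint (\<lambda>s. X s \<omega>) t) \<in> borel_measurable N"
  unfolding Zint_def
proof (intro borel_measurable_LBINT_paths(2) t)
  show "(\<lambda>\<omega>. cis (X s \<omega>)) \<in> borel_measurable N" if "0 \<le> s" "s \<le> t" for s
    by (intro borel_measurable_continuous_on[OF _ m[OF that]] continuous_intros)
  show "continuous_on {0..t} (\<lambda>s. cis (X s \<omega>))" if "\<omega> \<in> space N" for \<omega>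
    by (intro continuous_on_cis_path continuous_on_subset[OF c[OF that]]) auto
qed

context standard_brownian_motion
begin

text \<open>Real and imaginary parts of the characteristic function of a centred Gaussian with
  variance \<open>t - s\<close>. Frequency \<open>k = 1\<close> governs the decay of correlations,
  \<open>k = 2\<close> the squares of cosines.\<close>

lemma expectation_cis_increment:
  assumes "0 \<le> s" "s \<le> t"
  shows "expectation (\<lambda>\<omega>. cos (k * (B t \<omega> - B s \<omega>))) = exp (- k\<^sup>2 * (t - s) / 2)"
    and "expectation (\<lambda>\<omega>. sin (k * (B t \<omega> - B s \<omega>))) = 0"
proof -
  have "expectation (\<lambda>\<omega>. cos (k * (B t \<omega> - B s \<omega>))) = exp (- k\<^sup>2 * (t - s) / 2) \<and>
    expectation (\<lambda>\<omega>. sin (k * (B t \<omega> - B s \<omega>))) = 0"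
  proof (cases "s = t")
    case True then show ?thesis by (simp add: prob_space)
  next
    case False
    define \<sigma> where "\<sigma> = sqrt (t - s)"
    have \<sigma>: "\<sigma> > 0" "\<sigma>\<^sup>2 = t - s" using False assms by (auto simp: \<sigma>_def)
    let ?X = "\<lambda>\<omega>. B t \<omega> - B s \<omega>"
    have "distributed M lborel ?X (normal_density 0 \<sigma>)"
      unfolding \<sigma>_def using gaussian_increments[of s t] assms False by simp
    then have D: "distributed M lborel (\<lambda>\<omega>. ?X \<omega> / \<sigma>) std_normal_density"
      using normal_standard_normal_convert[OF \<sigma>(1), of ?X 0] by simp
    have "(CLINT x|std_normal_distribution. iexp ((k * \<sigma>) * x)) = exp (- (k * \<sigma>)\<^sup>2 / 2)"
      using fun_cong[OF char_std_normal_distribution, of "k * \<sigma>"] by (simp add: char_def)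
    then have "(CLINT x|std_normal_distribution. iexp ((k * \<sigma>) * x)) = exp (- k\<^sup>2 * (t - s) / 2)"
      by (simp add: power_mult_distrib \<sigma>)
    moreover have "std_normal_distribution = distr M lborel (\<lambda>\<omega>. ?X \<omega> / \<sigma>)"
      using D by (simp add: distributed_def)
    ultimately have "(CLINT x|distr M lborel (\<lambda>\<omega>. ?X \<omega> / \<sigma>). iexp ((k * \<sigma>) * x)) = exp (- k\<^sup>2 * (t - s) / 2)"
      by simp
    moreover have Xm[measurable]: "?X \<in> borel_measurable M"
      using assms by (intro borel_measurable_diff measurable_B) auto
    moreover have "(CLINT x|distr M lborel (\<lambda>\<omega>. ?X \<omega> / \<sigma>). iexp ((k * \<sigma>) * x)) = 
       (CLINT \<omega>|M. iexp ((k * \<sigma>) * (?X \<omega> / \<sigma>)))"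
      by (rule integral_distr) measurable
    ultimately have eq: "(CLINT \<omega>|M. cis (k * ?X \<omega>)) = exp (- k\<^sup>2 * (t - s) / 2)"
      using \<sigma> by (simp add: cis_conv_exp)
    have int: "complex_integrable M (\<lambda>\<omega>. cis (k * ?X \<omega>))"
      by (rule integrable_const_bound[where B=1])
        (auto intro!: borel_measurable_continuous_on[OF _ Xm] continuous_intros)
    have "expectation (\<lambda>\<omega>. Re (cis (k * ?X \<omega>))) = Re (CLINT \<omega>|M. cis (k * ?X \<omega>))"
      "expectation (\<lambda>\<omega>. Im (cis (k * ?X \<omega>))) = Im (CLINT \<omega>|M. cis (k * ?X \<omega>))"
      using int by (intro integral_Re integral_Im; assumption)+
    then show ?thesis unfolding eq by simp
  qed
  then show "expectation (\<lambda>\<omega>. cos (k * (B t \<omega> - B s \<omega>))) = exp (- k\<^sup>2 * (t - s) / 2)"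
    "expectation (\<lambda>\<omega>. sin (k * (B t \<omega> - B s \<omega>))) = 0" by auto
qed

lemma past_measurable:
  assumes "0 \<le> s" "s \<le> t"
  shows "B s \<in> borel_measurable (path_algebra M {0..t} B)"
    and "(\<lambda>\<omega>. Zint (\<lambda>s. B s \<omega>) s) \<in> borel_measurable (path_algebra M {0..t} B)"
  using assms
  by (auto intro!: measurable_path_algebra borel_measurable_Zint continuous_paths)

lemma future_measurable:
  assumes "0 \<le> t" "0 \<le> s"
  shows "(\<lambda>\<omega>. B (t + s) \<omega> - B t \<omega>) \<in> borel_measurable (path_algebra M {0..} (\<lambda>s \<omega>. B (t + s) \<omega> - B t \<omega>))"
    and "(\<lambda>\<omega>. Zint (\<lambda>s. B (t + s) \<omega> - B t \<omega>) s)
      \<in> borel_measurable (path_algebra M {0..} (\<lambda>s \<omega>. B (t + s) \<omega> - B t \<omega>))"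
proof -
  interpret S: standard_brownian_motion M "\<lambda>s \<omega>. B (t + s) \<omega> - B t \<omega>"
    by (rule shifted_brownian_motion[OF assms(1)])
  show "(\<lambda>\<omega>. Zint (\<lambda>s. B (t + s) \<omega> - B t \<omega>) s)
      \<in> borel_measurable (path_algebra M {0..} (\<lambda>s \<omega>. B (t + s) \<omega> - B t \<omega>))"
    using assms(2) S.continuous_paths
    by (intro borel_measurable_Zint) (auto intro: measurable_path_algebra)
qed (use assms in \<open>auto intro: measurable_path_algebra\<close>)

lemma Zint_measurable:
  "0 \<le> s \<Longrightarrow> (\<lambda>\<omega>. Zint (\<lambda>s. B s \<omega>) s) \<in> borel_measurable M"
  by (intro borel_measurable_Zint measurable_B continuous_paths)

end

section \<open>Coordinates of Z in a given direction and the recursion for their moments\<close>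

definition proj :: "(real \<Rightarrow> real) \<Rightarrow> real \<Rightarrow> real \<Rightarrow> real" where
  "proj b \<phi> t = Re (cis (- \<phi>) * Zint b t)"

lemma proj_has_vector_derivative:
  assumes "continuous_on {0..} b" "t \<in> {0..T}"
  shows "(proj b \<phi> has_vector_derivative cos (b t - \<phi>)) (at t within {0..T})"
proof -
  have "((\<lambda>t. Re (cis (- \<phi>) * Zint b t)) has_vector_derivative Re (cis (- \<phi>) * cis (b t))) (at t within {0..T})"
    by (intro bounded_linear.has_vector_derivative[OF bounded_linear_Re]
        has_vector_derivative_mult_right Zint_has_vector_derivative assms)
  then show ?thesis by (simp add: proj_def[abs_def] cis_mult del: times_complex.simps)
qed

lemma proj_0 [simp]: "proj b \<phi> 0 = 0" by (simp add: proj_def)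

lemma abs_proj_le:
  assumes "continuous_on {0..} b" "0 \<le> t"
  shows "\<bar>proj b \<phi> t\<bar> \<le> t"
  using abs_Re_le_cmod[of "cis (- \<phi>) * Zint b t"] norm_Zint_le[OF assms]
  by (simp add: proj_def norm_mult del: times_complex.simps)

lemma continuous_on_proj:
  assumes "continuous_on {0..} b"
  shows "continuous_on {0..T} (proj b \<phi>)"
  unfolding proj_def[abs_def] by (intro continuous_intros continuous_on_Zint assms)

text \<open>Constants of the induction in \<open>even_moment_X\<close>: differentiating a power
  twice gives (2m+2)(2m+1), the decaying kernel has mass at most 2, and integrating s^m gives
  1/(m+1). The product of the three is 4(2m+1).\<close>

primrec moment_const :: "nat \<Rightarrow> real" where
  "moment_const 0 = 1"
| "moment_const (Suc m) = 4 * (2 * real m + 1) * moment_const m"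

lemma moment_const_pos: "moment_const m > 0"
  by (induction m) auto

text \<open>The kernel is the correlation of the rotating unit vector at times \<open>r\<close> and
  \<open>s\<close>. The weight in the second integral belongs to
  \<open>cos (2 * \<phi>) = -1\<close>, the direction of least variance.\<close>

lemma LBINT_exp_decay:
  fixes s :: real
  assumes "0 \<le> s"
  shows "(LBINT r:{0..s}. exp (- (s - r) / 2)) = 2 * (1 - exp (- s / 2))"
    and "(LBINT r:{0..s}. exp (- (s - r) / 2) * ((1 - exp (- 2 * r)) / 2)) \<ge> (1 - exp (- s / 2))\<^sup>2"
proof -
  have "((\<lambda>r. exp (- (s - r) / 2)) has_integral 2 * exp (- (s - s) / 2) - 2 * exp (- (s - 0) / 2)) {0..s}"
    by (intro fundamental_theorem_of_calculus assms)
      (auto intro!: derivative_eq_intros simp: has_real_derivative_iff_has_vector_derivative[symmetric])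
  then show "(LBINT r:{0..s}. exp (- (s - r) / 2)) = 2 * (1 - exp (- s / 2))"
    by (subst LBINT_eq_integral) (auto intro!: continuous_intros simp: integral_unique)
  define x where "x = exp (- s / 2)"
  let ?f = "\<lambda>r. exp (- (s - r) / 2) + exp (- s / 2 - 3 * r / 2) / 3"
  have "((\<lambda>r. exp (- (s - r) / 2) * ((1 - exp (- 2 * r)) / 2)) has_integral ?f s - ?f 0) {0..s}"
  proof (intro fundamental_theorem_of_calculus assms)
    fix r
    have e: "exp (- (s - r) / 2) * exp (- 2 * r) = exp (- s / 2 - 3 * r / 2)"
      by (simp add: exp_add[symmetric]) (simp add: field_simps)
    have "(?f has_real_derivative exp (- (s - r) / 2) / 2 - exp (- s / 2 - 3 * r / 2) / 2) (at r within {0..s})"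
      by (auto intro!: derivative_eq_intros)
    then show "(?f has_vector_derivative exp (- (s - r) / 2) * ((1 - exp (- 2 * r)) / 2)) (at r within {0..s})"
      unfolding has_real_derivative_iff_has_vector_derivative[symmetric] e[symmetric]
      by (simp add: field_simps)
  qed
  note hi = this
  have "(LBINT r:{0..s}. exp (- (s - r) / 2) * ((1 - exp (- 2 * r)) / 2)) = ?f s - ?f 0"
    unfolding integral_unique[OF hi, symmetric] by (rule LBINT_eq_integral) (intro continuous_intros; simp)
  also have "exp (- s / 2 - 3 * s / 2) = x ^ 4"
    unfolding x_def exp_of_nat_mult[symmetric] by (simp add: field_simps)
  then have "?f s - ?f 0 = 1 + x ^ 4 / 3 - (x + x / 3)" by (simp add: x_def)
  \<comment> \<open>The quartic has a double root at \<open>x = 1\<close>; splitting it off leaves a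
    quadratic factor that is at least 3 for nonnegative \<open>x\<close>.\<close>
  also have "\<dots> = (1 - x)\<^sup>2 * ((x + 1)\<^sup>2 + 2) / 3" by (simp add: power2_eq_square power4_eq_xxxx field_simps)
  also have "\<dots> \<ge> (1 - x)\<^sup>2 * 3 / 3"
  proof (intro divide_right_mono mult_left_mono)
    have "(x + 1)\<^sup>2 \<ge> 1\<^sup>2" unfolding x_def by (intro power_mono) auto
    then show "3 \<le> (x + 1)\<^sup>2 + 2" by simp
  qed auto
  finally show "(LBINT r:{0..s}. exp (- (s - r) / 2) * ((1 - exp (- 2 * r)) / 2)) \<ge> (1 - exp (- s / 2))\<^sup>2"
    by (simp add: x_def)
qed

context standard_brownian_motion
begin

abbreviation X :: "real \<Rightarrow> real \<Rightarrow> 'a \<Rightarrow> real" where "X \<phi> t \<omega> \<equiv> proj (\<lambda>s. B s \<omega>) \<phi> t"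

lemma X_measurable:
  assumes "0 \<le> s" shows "X \<phi> s \<in> borel_measurable M"
  unfolding proj_def
  by (intro borel_measurable_continuous_on[OF _ Zint_measurable[OF assms]] continuous_intros)

lemma cos_measurable:
  assumes "0 \<le> s" shows "(\<lambda>\<omega>. cos (B s \<omega> - \<phi>)) \<in> borel_measurable M"
  by (intro borel_measurable_continuous_on[OF _ measurable_B[OF assms]] continuous_intros)

text \<open>In the addition formula for \<open>B s - \<phi> = (B r - \<phi>) + (B s - B r)\<close>
  the increment is independent of the past. Its cosine has mean \<open>exp (- (s - r) / 2)\<close>,
  and its sine has mean zero, so the sine term disappears.\<close>

lemma expectation_past_cos:
  assumes r: "0 \<le> r" "r \<le> s"
    and f: "f \<in> borel_measurable (path_algebra M {0..r} B)" "integrable M f"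
  shows "expectation (\<lambda>\<omega>. f \<omega> * cos (B s \<omega> - \<phi>))
    = exp (- (s - r) / 2) * expectation (\<lambda>\<omega>. f \<omega> * cos (B r \<omega> - \<phi>))"
proof -
  let ?D = "\<lambda>\<omega>. B (r + (s - r)) \<omega> - B r \<omega>"
  have D: "?D \<in> borel_measurable (path_algebra M {0..} (\<lambda>s \<omega>. B (r + s) \<omega> - B r \<omega>))"
    using future_measurable(1)[of r "s - r"] r by simp
  have DM: "?D \<in> borel_measurable M"
    using r by (intro borel_measurable_diff measurable_B) auto
  have g: "integrable M (\<lambda>\<omega>. f \<omega> * cos (B r \<omega> - \<phi>))" "integrable M (\<lambda>\<omega>. f \<omega> * sin (B r \<omega> - \<phi>))"
    by (rule Bochner_Integration.integrable_bound[OF f(2)];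
        auto simp: abs_mult mult_left_le intro!: borel_measurable_times
          borel_measurable_integrable[OF f(2)]
          borel_measurable_continuous_on[OF _ measurable_B[OF r(1)]] continuous_intros)+
  have gp: "(\<lambda>\<omega>. f \<omega> * cos (B r \<omega> - \<phi>)) \<in> borel_measurable (path_algebra M {0..r} B)"
    "(\<lambda>\<omega>. f \<omega> * sin (B r \<omega> - \<phi>)) \<in> borel_measurable (path_algebra M {0..r} B)"
    by (intro borel_measurable_times f(1) borel_measurable_continuous_on[OF _ past_measurable(1)]
        continuous_intros; use r in simp)+
  have h: "(\<lambda>\<omega>. cos (?D \<omega>)) \<in> borel_measurable (path_algebra M {0..} (\<lambda>s \<omega>. B (r + s) \<omega> - B r \<omega>))"
    "(\<lambda>\<omega>. sin (?D \<omega>)) \<in> borel_measurable (path_algebra M {0..} (\<lambda>s \<omega>. B (r + s) \<omega> - B r \<omega>))"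
    by (intro borel_measurable_continuous_on[OF _ D] continuous_intros)+
  have "(\<lambda>\<omega>. cos (?D \<omega>)) \<in> borel_measurable M" "(\<lambda>\<omega>. sin (?D \<omega>)) \<in> borel_measurable M"
    by (intro borel_measurable_continuous_on[OF _ DM] continuous_intros)+
  then have hi: "integrable M (\<lambda>\<omega>. cos (?D \<omega>))" "integrable M (\<lambda>\<omega>. sin (?D \<omega>))"
    by (intro integrable_const_bound[where B=1] AE_I2; simp)+
  note 1 = expectation_past_future[OF r(1) gp(1) h(1) g(1) hi(1)]
    and 2 = expectation_past_future[OF r(1) gp(2) h(2) g(2) hi(2)]
  have "f \<omega> * cos (B s \<omega> - \<phi>) = f \<omega> * cos (B r \<omega> - \<phi>) * cos (?D \<omega>) - f \<omega> * sin (B r \<omega> - \<phi>) * sin (?D \<omega>)" for \<omega>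
  proof -
    have "cos (B s \<omega> - \<phi>) = cos (B r \<omega> - \<phi>) * cos (?D \<omega>) - sin (B r \<omega> - \<phi>) * sin (?D \<omega>)"
      using cos_add[of "B r \<omega> - \<phi>" "?D \<omega>"] by simp
    then show ?thesis by (simp only: right_diff_distrib mult.assoc)
  qed
  then have "expectation (\<lambda>\<omega>. f \<omega> * cos (B s \<omega> - \<phi>)) =
      expectation (\<lambda>\<omega>. f \<omega> * cos (B r \<omega> - \<phi>) * cos (?D \<omega>)) - expectation (\<lambda>\<omega>. f \<omega> * sin (B r \<omega> - \<phi>) * sin (?D \<omega>))"
    using 1(2) 2(2) by simp
  also have "\<dots> = expectation (\<lambda>\<omega>. f \<omega> * cos (B r \<omega> - \<phi>)) * exp (- (s - r) / 2)"
    using expectation_cis_increment[of r s 1] r 1(1) 2(1) by simp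
  finally show ?thesis by simp
qed

text \<open>Two integrations in a row. The first writes a power of the coordinate as a time
  integral. In the second the cosine at the final time \<open>a\<close> is later than every
  integration time \<open>r\<close>; \<open>expectation_past_cos\<close> turns it into the cosine at
  \<open>r\<close>, which completes a square, times an exponential factor.\<close>

lemma moment_step:
  assumes a: "0 \<le> a"
  shows "expectation (\<lambda>\<omega>. X \<phi> a \<omega> ^ Suc n) =
      real (Suc n) * (LBINT s:{0..a}. expectation (\<lambda>\<omega>. X \<phi> s \<omega> ^ n * cos (B s \<omega> - \<phi>)))"
    and "set_integrable lborel {0..a} (\<lambda>s. expectation (\<lambda>\<omega>. X \<phi> s \<omega> ^ n * cos (B s \<omega> - \<phi>)))"
    and "expectation (\<lambda>\<omega>. X \<phi> a \<omega> ^ Suc n * cos (B a \<omega> - \<phi>)) =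
      real (Suc n) * (LBINT r:{0..a}. exp (- (a - r) / 2) * expectation (\<lambda>\<omega>. X \<phi> r \<omega> ^ n * (cos (B r \<omega> - \<phi>))\<^sup>2))"
    and "set_integrable lborel {0..a} (\<lambda>r. exp (- (a - r) / 2) * expectation (\<lambda>\<omega>. X \<phi> r \<omega> ^ n * (cos (B r \<omega> - \<phi>))\<^sup>2))"
proof -
  let ?c = "\<lambda>s \<omega>. cos (B s \<omega> - \<phi>)"
  have contB: "continuous_on S (\<lambda>s. B s \<omega>)" if "\<omega> \<in> space M" "S \<subseteq> {0..}" for S \<omega>
    using continuous_on_subset[OF continuous_paths] that by blast
  have contF: "continuous_on {0..a} (\<lambda>s. X \<phi> s \<omega> ^ n * ?c s \<omega>)" if "\<omega> \<in> space M" for \<omega>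
    using that by (intro continuous_intros continuous_on_proj continuous_paths contB) auto
  have prim: "X \<phi> a \<omega> ^ Suc n = real (Suc n) * (LBINT s:{0..a}. X \<phi> s \<omega> ^ n * ?c s \<omega>)"
    if "\<omega> \<in> space M" for \<omega>
    by (rule power_primitive)
      (use that a in \<open>auto intro!: proj_has_vector_derivative continuous_paths continuous_intros contB\<close>)
  have bnd: "\<bar>X \<phi> s \<omega> ^ n * ?c s \<omega>\<bar> \<le> a ^ n" if "0 \<le> s" "s \<le> a" "\<omega> \<in> space M" for s \<omega>
  proof -
    have "\<bar>X \<phi> s \<omega>\<bar> ^ n * \<bar>?c s \<omega>\<bar> \<le> a ^ n * 1"
      using abs_proj_le[OF continuous_paths[OF that(3)] that(1), of \<phi>] that
      by (intro mult_mono power_mono) auto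
    then show ?thesis by (simp add: abs_mult power_abs)
  qed
  have mF: "(\<lambda>\<omega>. X \<phi> s \<omega> ^ n * ?c s \<omega>) \<in> borel_measurable M" if "0 \<le> s" for s
    by (intro borel_measurable_times borel_measurable_power X_measurable cos_measurable that)
  note E = expectation_LBINT[of a "\<lambda>s \<omega>. X \<phi> s \<omega> ^ n * ?c s \<omega>", OF mF contF a bnd]
  have "expectation (\<lambda>\<omega>. X \<phi> a \<omega> ^ Suc n) =
      expectation (\<lambda>\<omega>. real (Suc n) * (LBINT s:{0..a}. X \<phi> s \<omega> ^ n * ?c s \<omega>))"
    by (intro Bochner_Integration.integral_cong prim refl)
  also have "\<dots> = real (Suc n) * (LBINT s:{0..a}. expectation (\<lambda>\<omega>. X \<phi> s \<omega> ^ n * ?c s \<omega>))"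
    unfolding integral_mult_right_zero using E(1) by simp
  finally show "expectation (\<lambda>\<omega>. X \<phi> a \<omega> ^ Suc n) =
      real (Suc n) * (LBINT s:{0..a}. expectation (\<lambda>\<omega>. X \<phi> s \<omega> ^ n * ?c s \<omega>))" .
  show "set_integrable lborel {0..a} (\<lambda>s. expectation (\<lambda>\<omega>. X \<phi> s \<omega> ^ n * ?c s \<omega>))"
    using E(2) by simp
  have bnd2: "\<bar>X \<phi> s \<omega> ^ n * ?c s \<omega> * ?c a \<omega>\<bar> \<le> a ^ n" if "0 \<le> s" "s \<le> a" "\<omega> \<in> space M" for s \<omega>
  proof -
    have "\<bar>X \<phi> s \<omega> ^ n * ?c s \<omega>\<bar> * \<bar>?c a \<omega>\<bar> \<le> a ^ n * 1"
      using bnd[OF that] a by (intro mult_mono) auto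
    then show ?thesis by (simp add: abs_mult)
  qed
  note E2 = expectation_LBINT[of a "\<lambda>s \<omega>. X \<phi> s \<omega> ^ n * ?c s \<omega> * ?c a \<omega>",
      OF borel_measurable_times[OF mF cos_measurable[OF a]] continuous_on_mult_right[OF contF] a bnd2]
  have dec: "expectation (\<lambda>\<omega>. X \<phi> s \<omega> ^ n * ?c s \<omega> * ?c a \<omega>) =
      exp (- (a - s) / 2) * expectation (\<lambda>\<omega>. X \<phi> s \<omega> ^ n * (?c s \<omega>)\<^sup>2)" if "s \<in> {0..a}" for s
  proof -
    have "(\<lambda>\<omega>. X \<phi> s \<omega> ^ n * ?c s \<omega>) \<in> borel_measurable (path_algebra M {0..s} B)"
      unfolding proj_def
      by (intro borel_measurable_times borel_measurable_continuous_on[OF _ past_measurable(1)]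
        borel_measurable_continuous_on[OF _ past_measurable(2)] borel_measurable_power
        continuous_intros; use that in simp)
    moreover have "integrable M (\<lambda>\<omega>. X \<phi> s \<omega> ^ n * ?c s \<omega>)"
      by (rule integrable_const_bound[where B="a ^ n"]) (use that bnd mF in auto)
    ultimately show ?thesis
      using expectation_past_cos[of s a "\<lambda>\<omega>. X \<phi> s \<omega> ^ n * ?c s \<omega>" \<phi>] that
      by (simp add: power2_eq_square mult.assoc)
  qed
  have "expectation (\<lambda>\<omega>. X \<phi> a \<omega> ^ Suc n * ?c a \<omega>) =
      expectation (\<lambda>\<omega>. real (Suc n) * (LBINT s:{0..a}. X \<phi> s \<omega> ^ n * ?c s \<omega> * ?c a \<omega>))"
    by (intro Bochner_Integration.integral_cong refl) (simp add: prim del: power_Suc)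
  also have "\<dots> = real (Suc n) * (LBINT s:{0..a}. expectation (\<lambda>\<omega>. X \<phi> s \<omega> ^ n * ?c s \<omega> * ?c a \<omega>))"
    unfolding integral_mult_right_zero using E2(1) by simp
  also have "(LBINT s:{0..a}. expectation (\<lambda>\<omega>. X \<phi> s \<omega> ^ n * ?c s \<omega> * ?c a \<omega>)) =
     (LBINT s:{0..a}. exp (- (a - s) / 2) * expectation (\<lambda>\<omega>. X \<phi> s \<omega> ^ n * (?c s \<omega>)\<^sup>2))"
    by (rule set_lebesgue_integral_cong) (use dec in auto)
  finally show "expectation (\<lambda>\<omega>. X \<phi> a \<omega> ^ Suc n * ?c a \<omega>) =
      real (Suc n) * (LBINT r:{0..a}. exp (- (a - r) / 2) * expectation (\<lambda>\<omega>. X \<phi> r \<omega> ^ n * (?c r \<omega>)\<^sup>2))" .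
  show "set_integrable lborel {0..a} (\<lambda>r. exp (- (a - r) / 2) * expectation (\<lambda>\<omega>. X \<phi> r \<omega> ^ n * (?c r \<omega>)\<^sup>2))"
    using E2(2) by (rule set_integrable_cong[THEN iffD1, rotated 3]) (use dec in auto)
qed

end

section \<open>Moments of the integral\<close>

lemma LBINT_power:
  assumes "0 \<le> (a::real)"
  shows "(LBINT t:{0..a}. t ^ n) = a ^ Suc n / real (Suc n)"
  using power_primitive[of a "\<lambda>t. t" "\<lambda>_. 1" n] assms
  by (simp add: field_simps has_vector_derivative_id del: power_Suc of_nat_Suc)

lemma set_integral_mono_continuous:
  fixes f g :: "real \<Rightarrow> real"
  assumes "set_integrable lborel {a..b} f" "set_integrable lborel {a..b} g"
    "\<And>t. t \<in> {a..b} \<Longrightarrow> f t \<le> g t"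
  shows "(LBINT t:{a..b}. f t) \<le> (LBINT t:{a..b}. g t)"
  by (rule set_integral_mono) (use assms in auto)

lemma power_add_le:
  fixes x y :: real
  assumes "0 \<le> x" "0 \<le> y"
  shows "(x + y) ^ n \<le> 2 ^ n * (x ^ n + y ^ n)"
proof -
  have "(x + y) ^ n \<le> (2 * max x y) ^ n" using assms by (intro power_mono) auto
  also have "\<dots> = 2 ^ n * max x y ^ n" by (simp add: power_mult_distrib)
  also have "\<dots> \<le> 2 ^ n * (x ^ n + y ^ n)"
    using assms by (intro mult_left_mono) (auto simp: max_def)
  finally show ?thesis .
qed

lemma one_minus_exp_ge:
  assumes "0 \<le> (s::real)" shows "1 - exp (- s / 2) \<ge> s / (2 + s)"
proof -
  have "1 + s / 2 \<le> exp (s / 2)" by (rule exp_ge_add_one_self)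
  then have "inverse (exp (s / 2)) \<le> inverse (1 + s / 2)"
    using assms by (intro le_imp_inverse_le) auto
  then have "exp (- s / 2) \<le> inverse (1 + s / 2)" by (simp add: exp_minus)
  moreover have "1 - inverse (1 + s / 2) = s / (2 + s)" using assms by (simp add: field_simps)
  ultimately show ?thesis by linarith
qed

context standard_brownian_motion
begin

lemma X_bound: "0 \<le> a \<Longrightarrow> \<omega> \<in> space M \<Longrightarrow> \<bar>X \<phi> a \<omega>\<bar> \<le> a"
  by (intro abs_proj_le continuous_paths)

lemma integrable_X_power_cos:
  assumes "0 \<le> a"
  shows "integrable M (\<lambda>\<omega>. X \<phi> a \<omega> ^ n)" "integrable M (\<lambda>\<omega>. X \<phi> a \<omega> ^ n * cos (B a \<omega> - \<phi>) ^ k)"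
proof -
  have b: "\<bar>X \<phi> a \<omega> ^ n\<bar> \<le> a ^ n" if "\<omega> \<in> space M" for \<omega>
    using X_bound[OF assms that] by (simp add: power_abs power_mono)
  show "integrable M (\<lambda>\<omega>. X \<phi> a \<omega> ^ n)"
    by (rule integrable_const_bound[where B="a ^ n"])
      (use b assms in \<open>auto intro!: borel_measurable_power X_measurable\<close>)
  show "integrable M (\<lambda>\<omega>. X \<phi> a \<omega> ^ n * cos (B a \<omega> - \<phi>) ^ k)"
  proof (rule integrable_const_bound[where B="a ^ n"])
    have "\<bar>X \<phi> a \<omega> ^ n\<bar> * \<bar>cos (B a \<omega> - \<phi>) ^ k\<bar> \<le> a ^ n * 1" if "\<omega> \<in> space M" for \<omega>
      using assms by (intro mult_mono b that) (auto simp: power_abs power_le_one)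
    then show "AE \<omega> in M. norm (X \<phi> a \<omega> ^ n * cos (B a \<omega> - \<phi>) ^ k) \<le> a ^ n"
      by (simp add: abs_mult)
  qed (use assms in \<open>auto intro!: borel_measurable_times borel_measurable_power X_measurable cos_measurable\<close>)
qed

text \<open>Two more powers of the coordinate cost two time integrations, but one of them runs
  against a kernel of total mass at most 2. Hence each pair of powers gains a single power of time,
  which is the diffusive scaling.\<close>

lemma even_moment_X:
  assumes "0 \<le> a"
  shows "expectation (\<lambda>\<omega>. X \<phi> a \<omega> ^ (2 * m)) \<le> moment_const m * a ^ m"
  using assms
proof (induction m arbitrary: a)
  case 0
  then show ?case by (simp add: prob_space)
next
  case (Suc m)
  have D: "expectation (\<lambda>\<omega>. X \<phi> s \<omega> ^ Suc (2 * m) * cos (B s \<omega> - \<phi>)) \<le>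
      2 * (2 * real m + 1) * moment_const m * s ^ m" if s: "0 \<le> s" for s
  proof -
    have "(LBINT r:{0..s}. exp (- (s - r) / 2) * expectation (\<lambda>\<omega>. X \<phi> r \<omega> ^ (2 * m) * (cos (B r \<omega> - \<phi>))\<^sup>2))
      \<le> (LBINT r:{0..s}. exp (- (s - r) / 2) * (moment_const m * s ^ m))"
    proof (rule set_integral_mono_continuous)
      show "set_integrable lborel {0..s} (\<lambda>r. exp (- (s - r) / 2) * (moment_const m * s ^ m))"
        by (intro borel_integrable_atLeastAtMost' continuous_intros) auto
      fix r assume r: "r \<in> {0..s}"
      have "expectation (\<lambda>\<omega>. X \<phi> r \<omega> ^ (2 * m) * (cos (B r \<omega> - \<phi>))\<^sup>2) \<le> expectation (\<lambda>\<omega>. X \<phi> r \<omega> ^ (2 * m))"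
      proof (rule integral_mono)
        fix \<omega>
        have "X \<phi> r \<omega> ^ (2 * m) * (cos (B r \<omega> - \<phi>))\<^sup>2 \<le> X \<phi> r \<omega> ^ (2 * m) * 1"
          by (intro mult_left_mono) (auto simp: abs_square_le_1)
        then show "X \<phi> r \<omega> ^ (2 * m) * (cos (B r \<omega> - \<phi>))\<^sup>2 \<le> X \<phi> r \<omega> ^ (2 * m)" by simp
      qed (use r integrable_X_power_cos in auto)
      also have "\<dots> \<le> moment_const m * r ^ m" using Suc.IH r by simp
      also have "\<dots> \<le> moment_const m * s ^ m"
        using r moment_const_pos[of m] by (intro mult_left_mono power_mono) auto
      finally show "exp (- (s - r) / 2) * expectation (\<lambda>\<omega>. X \<phi> r \<omega> ^ (2 * m) * (cos (B r \<omega> - \<phi>))\<^sup>2)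
        \<le> exp (- (s - r) / 2) * (moment_const m * s ^ m)"
        by (intro mult_left_mono) auto
    qed (rule moment_step(4)[OF s])
    also have "\<dots> = (LBINT r:{0..s}. exp (- (s - r) / 2)) * (moment_const m * s ^ m)"
      by (rule set_integral_mult_left)
    also have "\<dots> \<le> 2 * (moment_const m * s ^ m)"
      unfolding LBINT_exp_decay[OF s] using s moment_const_pos[of m]
      by (intro mult_right_mono) auto
    finally have "real (Suc (2 * m)) * (LBINT r:{0..s}. exp (- (s - r) / 2) * expectation (\<lambda>\<omega>. X \<phi> r \<omega> ^ (2 * m) * (cos (B r \<omega> - \<phi>))\<^sup>2))
      \<le> real (Suc (2 * m)) * (2 * (moment_const m * s ^ m))" by (intro mult_left_mono) auto
    then show ?thesis unfolding moment_step(3)[OF s] by (simp add: algebra_simps)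
  qed
  have "expectation (\<lambda>\<omega>. X \<phi> a \<omega> ^ (2 * Suc m)) = real (Suc (Suc (2 * m))) *
      (LBINT s:{0..a}. expectation (\<lambda>\<omega>. X \<phi> s \<omega> ^ Suc (2 * m) * cos (B s \<omega> - \<phi>)))"
    using moment_step(1)[OF Suc.prems, of \<phi> "Suc (2 * m)"] by simp
  also have "\<dots> \<le> real (Suc (Suc (2 * m))) * (LBINT s:{0..a}. 2 * (2 * real m + 1) * moment_const m * s ^ m)"
  proof (intro mult_left_mono set_integral_mono_continuous)
    show "set_integrable lborel {0..a} (\<lambda>s. 2 * (2 * real m + 1) * moment_const m * s ^ m)"
      by (intro borel_integrable_atLeastAtMost' continuous_intros)
    show "set_integrable lborel {0..a} (\<lambda>s. expectation (\<lambda>\<omega>. X \<phi> s \<omega> ^ Suc (2 * m) * cos (B s \<omega> - \<phi>)))"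
      by (rule moment_step(2)[OF Suc.prems])
  qed (use D in auto)
  also have "\<dots> = moment_const (Suc m) * a ^ Suc m"
    unfolding set_integral_mult_right LBINT_power[OF Suc.prems]
    by (simp add: field_simps)
  finally show ?case .
qed

lemma expectation_cos_square:
  assumes "0 \<le> r"
  shows "expectation (\<lambda>\<omega>. (cos (B r \<omega> - \<phi>))\<^sup>2) = (1 + exp (- 2 * r) * cos (2 * \<phi>)) / 2"
proof -
  have Bm: "B r \<in> borel_measurable M" by (rule measurable_B[OF assms])
  have "(\<lambda>\<omega>. cos (2 * B r \<omega>)) \<in> borel_measurable M" "(\<lambda>\<omega>. sin (2 * B r \<omega>)) \<in> borel_measurable M"
    by (intro borel_measurable_continuous_on[OF _ Bm] continuous_intros)+
  then have i: "integrable M (\<lambda>\<omega>. cos (2 * B r \<omega>))" "integrable M (\<lambda>\<omega>. sin (2 * B r \<omega>))"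
    by (intro integrable_const_bound[where B=1] AE_I2; simp)+
  have "(cos (B r \<omega> - \<phi>))\<^sup>2 = 1/2 + (cos (2 * \<phi>) / 2) * cos (2 * B r \<omega>) + (sin (2 * \<phi>) / 2) * sin (2 * B r \<omega>)" for \<omega>
  proof -
    have "cos (2 * (B r \<omega> - \<phi>)) = cos (2 * \<phi>) * cos (2 * B r \<omega>) + sin (2 * \<phi>) * sin (2 * B r \<omega>)"
      by (simp add: right_diff_distrib cos_diff)
    then show ?thesis using cos_double_cos[of "B r \<omega> - \<phi>"] by linarith
  qed
  then have "expectation (\<lambda>\<omega>. (cos (B r \<omega> - \<phi>))\<^sup>2) =
     1/2 + (cos (2 * \<phi>) / 2) * expectation (\<lambda>\<omega>. cos (2 * B r \<omega>)) + (sin (2 * \<phi>) / 2) * expectation (\<lambda>\<omega>. sin (2 * B r \<omega>))"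
    using i by (simp add: prob_space)
  moreover have "expectation (\<lambda>\<omega>. cos (2 * B r \<omega>)) = exp (- 2 * r)" "expectation (\<lambda>\<omega>. sin (2 * B r \<omega>)) = 0"
    using expectation_cis_increment[of 0 r 2] assms start_zero
    by (simp_all cong: Bochner_Integration.integral_cong)
  ultimately show ?thesis by simp
qed

lemma second_moment_step:
  assumes "0 \<le> a"
  shows "expectation (\<lambda>\<omega>. (X \<phi> a \<omega>)\<^sup>2) =
      2 * (LBINT s:{0..a}. LBINT r:{0..s}. exp (- (s - r) / 2) * ((1 + exp (- 2 * r) * cos (2 * \<phi>)) / 2))"
    and "set_integrable lborel {0..a}
      (\<lambda>s. LBINT r:{0..s}. exp (- (s - r) / 2) * ((1 + exp (- 2 * r) * cos (2 * \<phi>)) / 2))"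
proof -
  have "expectation (\<lambda>\<omega>. X \<phi> s \<omega> ^ Suc 0 * cos (B s \<omega> - \<phi>)) =
      (LBINT r:{0..s}. exp (- (s - r) / 2) * ((1 + exp (- 2 * r) * cos (2 * \<phi>)) / 2))" if "s \<in> {0..a}" for s
  proof -
    have "(LBINT r:{0..s}. exp (- (s - r) / 2) * expectation (\<lambda>\<omega>. (cos (B r \<omega> - \<phi>))\<^sup>2)) =
      (LBINT r:{0..s}. exp (- (s - r) / 2) * ((1 + exp (- 2 * r) * cos (2 * \<phi>)) / 2))"
      by (rule set_lebesgue_integral_cong) (auto simp: expectation_cos_square)
    then show ?thesis using moment_step(3)[of s \<phi> 0] that by simp
  qed
  note D = this
  show "set_integrable lborel {0..a}
      (\<lambda>s. LBINT r:{0..s}. exp (- (s - r) / 2) * ((1 + exp (- 2 * r) * cos (2 * \<phi>)) / 2))"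
    using moment_step(2)[OF assms, of \<phi> "Suc 0"]
    by (rule set_integrable_cong[THEN iffD1, rotated 3]) (use D in auto)
  have "(LBINT s:{0..a}. expectation (\<lambda>\<omega>. X \<phi> s \<omega> ^ Suc 0 * cos (B s \<omega> - \<phi>))) =
    (LBINT s:{0..a}. LBINT r:{0..s}. exp (- (s - r) / 2) * ((1 + exp (- 2 * r) * cos (2 * \<phi>)) / 2))"
    by (rule set_lebesgue_integral_cong) (use D in auto)
  then show "expectation (\<lambda>\<omega>. (X \<phi> a \<omega>)\<^sup>2) =
      2 * (LBINT s:{0..a}. LBINT r:{0..s}. exp (- (s - r) / 2) * ((1 + exp (- 2 * r) * cos (2 * \<phi>)) / 2))"
    using moment_step(1)[OF assms, of \<phi> "Suc 0"] by (simp add: power2_eq_square)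
qed

text \<open>The bound has to hold in the worst direction. Orthogonally to the initial direction the
  coordinate is close to the time integral of \<open>B\<close> for small \<open>a\<close>, with
  variance of order \<open>a ^ 3\<close>; for large \<open>a\<close> every coordinate has variance
  of order \<open>a\<close>. The quotient covers both regimes.\<close>

lemma second_moment_lower:
  assumes a: "0 \<le> a"
  shows "2 / 27 * (a ^ 3 / (max 1 a)\<^sup>2) \<le> expectation (\<lambda>\<omega>. (X \<phi> a \<omega>)\<^sup>2)"
proof -
  define d where "d = max 1 a"
  have "(LBINT s:{0..a}. s ^ 2 * (1 / (9 * d\<^sup>2))) \<le>
     (LBINT s:{0..a}. LBINT r:{0..s}. exp (- (s - r) / 2) * ((1 + exp (- 2 * r) * cos (2 * \<phi>)) / 2))"
  proof (rule set_integral_mono_continuous)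
    fix s assume s: "s \<in> {0..a}"
    \<comment> \<open>Since \<open>s \<le> a\<close>, the sum \<open>2 + s\<close> is at most
      \<open>3 * d\<close> in both regimes of \<open>a\<close>.\<close>
    have "s / (3 * d) \<le> s / (2 + s)" using s by (intro divide_left_mono) (auto simp: d_def)
    also have "\<dots> \<le> 1 - exp (- s / 2)" using one_minus_exp_ge s by auto
    finally have "(s / (3 * d))\<^sup>2 \<le> (1 - exp (- s / 2))\<^sup>2"
      using s by (intro power_mono) (auto simp: d_def)
    also have "\<dots> \<le> (LBINT r:{0..s}. exp (- (s - r) / 2) * ((1 - exp (- 2 * r)) / 2))"
      using s LBINT_exp_decay(2) by auto
    also have "\<dots> \<le> (LBINT r:{0..s}. exp (- (s - r) / 2) * ((1 + exp (- 2 * r) * cos (2 * \<phi>)) / 2))"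
    proof (rule set_integral_mono_continuous)
      show "set_integrable lborel {0..s} (\<lambda>r. exp (- (s - r) / 2) * ((1 - exp (- 2 * r)) / 2))"
        by (intro borel_integrable_atLeastAtMost' continuous_intros) simp_all
      show "set_integrable lborel {0..s} (\<lambda>r. exp (- (s - r) / 2) * ((1 + exp (- 2 * r) * cos (2 * \<phi>)) / 2))"
        by (intro borel_integrable_atLeastAtMost' continuous_intros) simp_all
      fix r :: real
      have "(1 - E) / 2 \<le> (1 + E * c) / 2" if "0 \<le> E" "- 1 \<le> c" for E c :: real
        using mult_left_mono[OF that(2,1)] by simp
      from this[OF exp_ge_zero cos_ge_minus_one]
      have "(1 - exp (- 2 * r)) / 2 \<le> (1 + exp (- 2 * r) * cos (2 * \<phi>)) / 2" .
      then show "exp (- (s - r) / 2) * ((1 - exp (- 2 * r)) / 2) \<le> exp (- (s - r) / 2) * ((1 + exp (- 2 * r) * cos (2 * \<phi>)) / 2)"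
        by (rule mult_left_mono[OF _ exp_ge_zero])
    qed
    finally show "s ^ 2 * (1 / (9 * d\<^sup>2)) \<le> (LBINT r:{0..s}. exp (- (s - r) / 2) * ((1 + exp (- 2 * r) * cos (2 * \<phi>)) / 2))"
      by (simp add: power_divide power_mult_distrib)
  next
    show "set_integrable lborel {0..a} (\<lambda>s. s ^ 2 * (1 / (9 * d\<^sup>2)))"
      by (intro borel_integrable_atLeastAtMost' continuous_intros)
  qed (rule second_moment_step(2)[OF a])
  moreover have "(LBINT s:{0..a}. s ^ 2 * (1 / (9 * d\<^sup>2))) = a ^ 3 / 3 * (1 / (9 * d\<^sup>2))"
    unfolding set_integral_mult_left LBINT_power[OF a] by (simp add: eval_nat_numeral)
  ultimately show ?thesis unfolding second_moment_step(1)[OF a] d_def[symmetric] by (simp add: field_simps)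
qed

lemma cmod_Zint_square: "(cmod (Zint b a))\<^sup>2 = (proj b 0 a)\<^sup>2 + (proj b (pi / 2) a)\<^sup>2"
  by (simp add: cmod_power2 proj_def)

text \<open>Over two orthogonal directions the terms with \<open>cos (2 * \<phi>)\<close> cancel and
  the full kernel of \<open>LBINT_exp_decay(1)\<close> remains. For small \<open>a\<close> this
  gives order \<open>a\<^sup>2\<close>: the path is nearly straight, so its length counts and not
  its deviation.\<close>

lemma Zint_second_moment_lower:
  assumes a: "0 \<le> a"
  shows "2 / 3 * (a\<^sup>2 / max 1 a) \<le> expectation (\<lambda>\<omega>. (cmod (Zint (\<lambda>s. B s \<omega>) a))\<^sup>2)"
proof -
  define d where "d = max 1 a"
  let ?J = "\<lambda>\<phi> s. LBINT r:{0..s}. exp (- (s - r) / 2) * ((1 + exp (- 2 * r) * cos (2 * \<phi>)) / 2)"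
  have "(LBINT s:{0..a}. s ^ 1 * (2 / (3 * d))) \<le> (LBINT s:{0..a}. ?J 0 s + ?J (pi / 2) s)"
  proof (rule set_integral_mono_continuous)
    fix s assume s: "s \<in> {0..a}"
    have "s / (3 * d) \<le> s / (2 + s)" using s by (intro divide_left_mono) (auto simp: d_def)
    also have "\<dots> \<le> 1 - exp (- s / 2)" using one_minus_exp_ge s by auto
    finally have "2 * (s / (3 * d)) \<le> (LBINT r:{0..s}. exp (- (s - r) / 2))"
      using LBINT_exp_decay(1)[of s] s by auto
    also have "\<dots> = (LBINT r:{0..s}. exp (- (s - r) / 2) * ((1 + exp (- 2 * r) * cos (2 * 0)) / 2)
       + exp (- (s - r) / 2) * ((1 + exp (- 2 * r) * cos (2 * (pi / 2))) / 2))"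
      by (rule set_lebesgue_integral_cong) (auto simp: field_simps)
    also have "\<dots> = ?J 0 s + ?J (pi / 2) s"
      by (intro set_integral_add borel_integrable_atLeastAtMost' continuous_intros) auto
    finally show "s ^ 1 * (2 / (3 * d)) \<le> ?J 0 s + ?J (pi / 2) s" by (simp add: field_simps)
  next
    show "set_integrable lborel {0..a} (\<lambda>s. s ^ 1 * (2 / (3 * d)))"
      by (intro borel_integrable_atLeastAtMost' continuous_intros)
    show "set_integrable lborel {0..a} (\<lambda>s. ?J 0 s + ?J (pi / 2) s)"
      by (intro set_integral_add(1) second_moment_step(2) a)
  qed
  also have "\<dots> = (LBINT s:{0..a}. ?J 0 s) + (LBINT s:{0..a}. ?J (pi / 2) s)"
    using second_moment_step(2)[OF a] by (intro set_integral_add)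
  finally have "2 * (LBINT s:{0..a}. s ^ 1 * (2 / (3 * d))) \<le>
      expectation (\<lambda>\<omega>. (X 0 a \<omega>)\<^sup>2) + expectation (\<lambda>\<omega>. (X (pi / 2) a \<omega>)\<^sup>2)"
    unfolding second_moment_step(1)[OF a] by simp
  also have "\<dots> = expectation (\<lambda>\<omega>. (cmod (Zint (\<lambda>s. B s \<omega>) a))\<^sup>2)"
    unfolding cmod_Zint_square using integrable_X_power_cos(1)[OF a, of _ 2] by simp
  finally show ?thesis
    unfolding set_integral_mult_left LBINT_power[OF a] d_def[symmetric]
    by (simp add: power2_eq_square)
qed

lemma integrable_Zint_power:
  assumes "0 \<le> a"
  shows "integrable M (\<lambda>\<omega>. cmod (Zint (\<lambda>s. B s \<omega>) a) ^ n)"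
proof (rule integrable_const_bound[where B="a ^ n"])
  show "AE \<omega> in M. norm (cmod (Zint (\<lambda>s. B s \<omega>) a) ^ n) \<le> a ^ n"
    using norm_Zint_le[OF continuous_paths assms] by (intro AE_I2) (auto intro: power_mono)
qed (intro borel_measurable_power borel_measurable_continuous_on[OF _ Zint_measurable[OF assms]] continuous_intros)

lemma even_moment_Zint:
  assumes a: "0 \<le> a"
  shows "expectation (\<lambda>\<omega>. cmod (Zint (\<lambda>s. B s \<omega>) a) ^ (2 * m)) \<le> 2 ^ Suc m * moment_const m * a ^ m"
proof -
  have "cmod (Zint b a) ^ (2 * m) \<le> 2 ^ m * (proj b 0 a ^ (2 * m) + proj b (pi / 2) a ^ (2 * m))" for b
    unfolding power_mult cmod_Zint_square by (intro power_add_le) auto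
  then have "expectation (\<lambda>\<omega>. cmod (Zint (\<lambda>s. B s \<omega>) a) ^ (2 * m)) \<le>
     expectation (\<lambda>\<omega>. 2 ^ m * (X 0 a \<omega> ^ (2 * m) + X (pi / 2) a \<omega> ^ (2 * m)))"
    using integrable_Zint_power[OF a] integrable_X_power_cos(1)[OF a] by (intro integral_mono) auto
  also have "\<dots> = 2 ^ m * (expectation (\<lambda>\<omega>. X 0 a \<omega> ^ (2 * m)) + expectation (\<lambda>\<omega>. X (pi / 2) a \<omega> ^ (2 * m)))"
    using integrable_X_power_cos(1)[OF a] by simp
  also have "\<dots> \<le> 2 ^ m * (moment_const m * a ^ m + moment_const m * a ^ m)"
    by (intro mult_left_mono add_mono even_moment_X a) auto
  finally show ?thesis by (simp add: algebra_simps)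
qed

text \<open>The double factorial (2m-1)!!, the moment of order 2m of a standard Gaussian
  variable.\<close>

definition gauss_const :: "nat \<Rightarrow> real" where
  "gauss_const m = fact (2 * m) / (2 ^ m * fact m)"

lemma even_moment_increment:
  assumes "0 \<le> s" "s \<le> t"
  shows "integrable M (\<lambda>\<omega>. (B t \<omega> - B s \<omega>) ^ (2 * m))"
    and "expectation (\<lambda>\<omega>. (B t \<omega> - B s \<omega>) ^ (2 * m)) = gauss_const m * (t - s) ^ m"
proof -
  have "integrable M (\<lambda>\<omega>. (B t \<omega> - B s \<omega>) ^ (2 * m)) \<and>
    expectation (\<lambda>\<omega>. (B t \<omega> - B s \<omega>) ^ (2 * m)) = gauss_const m * (t - s) ^ m"
  proof (cases "s = t")
    case True
    then show ?thesis by (cases m) (auto simp: gauss_const_def prob_space)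
  next
    case False
    define \<sigma> where "\<sigma> = sqrt (t - s)"
    have \<sigma>: "\<sigma> > 0" "\<sigma>\<^sup>2 = t - s" using False assms by (auto simp: \<sigma>_def)
    have D: "distributed M lborel (\<lambda>\<omega>. B t \<omega> - B s \<omega>) (normal_density 0 \<sigma>)"
      unfolding \<sigma>_def using gaussian_increments[of s t] assms False by simp
    have n: "has_bochner_integral lborel (\<lambda>x. normal_density 0 \<sigma> x * x ^ (2 * m)) (fact (2 * m) / ((2 / \<sigma>\<^sup>2) ^ m * fact m))"
      using normal_moment_even[OF \<sigma>(1), of 0 m] by simp
    have "integrable M (\<lambda>\<omega>. (B t \<omega> - B s \<omega>) ^ (2 * m))"
      using distributed_integrable[OF D, of "\<lambda>x. x ^ (2 * m)"] n by (auto simp: has_bochner_integral_iff)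
    moreover have "expectation (\<lambda>\<omega>. (B t \<omega> - B s \<omega>) ^ (2 * m)) = fact (2 * m) / ((2 / \<sigma>\<^sup>2) ^ m * fact m)"
      using distributed_integral[OF D, of "\<lambda>x. x ^ (2 * m)"] n by (auto simp: has_bochner_integral_iff)
    ultimately show ?thesis using \<sigma> by (simp add: gauss_const_def power_divide)
  qed
  then show "integrable M (\<lambda>\<omega>. (B t \<omega> - B s \<omega>) ^ (2 * m))"
    "expectation (\<lambda>\<omega>. (B t \<omega> - B s \<omega>) ^ (2 * m)) = gauss_const m * (t - s) ^ m" by auto
qed

end

section \<open>One block\<close>

text \<open>Jensen's inequality with the tangent at the mean \<open>m\<close> supplied by the
  caller: integrated over the interval, the linear term vanishes. It serves for powers and for the
  decaying exponential.\<close>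

lemma jensen_LBINT:
  fixes f g :: "real \<Rightarrow> real"
  assumes a: "0 < a" and f: "continuous_on {0..a} f" and g: "continuous_on {0..a} (\<lambda>t. g (f t))"
    and m: "m = (LBINT t:{0..a}. f t) / a"
    and tangent: "\<And>t. t \<in> {0..a} \<Longrightarrow> g m + c * (f t - m) \<le> g (f t)"
  shows "a * g m \<le> (LBINT t:{0..a}. g (f t))"
proof -
  have fi: "set_integrable lborel {0..a} f" by (rule borel_integrable_atLeastAtMost'[OF f])
  have "(LBINT t:{0..a}. (g m - c * m) + c * f t) \<le> (LBINT t:{0..a}. g (f t))"
    by (rule set_integral_mono_continuous)
      (use f g tangent in \<open>auto intro!: borel_integrable_atLeastAtMost' continuous_intros simp: algebra_simps\<close>)
  moreover have "(LBINT t:{0..a}. (g m - c * m) + c * f t) = (LBINT t:{0..a}. (g m - c * m)) + (LBINT t:{0..a}. c * f t)"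
    by (intro set_integral_add(2) borel_integrable_atLeastAtMost' continuous_intros f)
  moreover have "(LBINT t:{0..a}. (g m - c * m)) = a * (g m - c * m)"
    using a by (subst LBINT_eq_integral) auto
  moreover have "(LBINT t:{0..a}. c * f t) = c * (a * m)"
    using a by (simp add: m)
  ultimately have "a * (g m - c * m) + c * (a * m) \<le> (LBINT t:{0..a}. g (f t))" by linarith
  moreover have "a * (g m - c * m) + c * (a * m) = a * g m" by (simp add: algebra_simps)
  ultimately show ?thesis by simp
qed

lemma power_tangent:
  fixes x m :: real
  assumes "0 \<le> x" "0 \<le> m"
  shows "m ^ n + (real n * m ^ (n - 1)) * (x - m) \<le> x ^ n"
proof (induction n)
  case 0 then show ?case by simp
next
  case (Suc n)
  \<comment> \<open>Multiplying the tangent inequality for \<open>n\<close> by \<open>x\<close>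
    yields the one for \<open>Suc n\<close> up to a nonnegative multiple of
    \<open>(x - m)\<^sup>2\<close>.\<close>
  have "m ^ Suc n + (real (Suc n) * m ^ n) * (x - m) =
      x * (m ^ n + (real n * m ^ (n - 1)) * (x - m)) - real n * m ^ (n - 1) * (x - m)\<^sup>2"
    by (cases n) (auto simp: algebra_simps power2_eq_square)
  also have "\<dots> \<le> x * (m ^ n + (real n * m ^ (n - 1)) * (x - m))"
    using assms by simp
  also have "\<dots> \<le> x * x ^ n" using Suc assms by (intro mult_left_mono) auto
  finally show ?case by simp
qed

text \<open>The factor \<open>a\<close> on the left stands in for an exponent \<open>n - 1\<close>
  on the right, so that \<open>n = 0\<close> is covered as well.\<close>

lemma power_LBINT_le:
  fixes f :: "real \<Rightarrow> real"
  assumes a: "0 < a" and f: "continuous_on {0..a} f" and pos: "\<And>t. t \<in> {0..a} \<Longrightarrow> 0 \<le> f t"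
  shows "a * (LBINT t:{0..a}. f t) ^ n \<le> a ^ n * (LBINT t:{0..a}. f t ^ n)"
proof -
  define m where "m = (LBINT t:{0..a}. f t) / a"
  have m0: "0 \<le> m" unfolding m_def set_lebesgue_integral_def
    using a pos by (intro divide_nonneg_pos Bochner_Integration.integral_nonneg) (auto simp: indicator_def)
  have "a * m ^ n \<le> (LBINT t:{0..a}. f t ^ n)"
    by (rule jensen_LBINT[OF a f _ m_def power_tangent[OF pos m0]]) (intro continuous_intros f)
  then have "a ^ n * (a * m ^ n) \<le> a ^ n * (LBINT t:{0..a}. f t ^ n)" using a by simp
  moreover have "a ^ n * m ^ n = (LBINT t:{0..a}. f t) ^ n"
    using a by (simp add: m_def power_mult_distrib[symmetric])
  ultimately show ?thesis by (simp add: mult.left_commute)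
qed

text \<open>Jensen in time, then interchange of the two integrations. Since \<open>F\<close> may be
  unbounded, the interchange is done for nonnegative integrals, and finiteness of the outcome
  provides the integrability claim.\<close>

lemma (in prob_space) moment_LBINT:
  fixes F :: "real \<Rightarrow> 'a \<Rightarrow> real"
  assumes m: "\<And>s. 0 \<le> s \<Longrightarrow> s \<le> a \<Longrightarrow> F s \<in> borel_measurable M"
    and c: "\<And>\<omega>. \<omega> \<in> space M \<Longrightarrow> continuous_on {0..a} (\<lambda>s. F s \<omega>)"
    and pos: "\<And>s \<omega>. 0 \<le> F s \<omega>" and a: "0 < a"
    and int: "\<And>s. 0 \<le> s \<Longrightarrow> s \<le> a \<Longrightarrow> integrable M (\<lambda>\<omega>. F s \<omega> ^ n)"
    and K: "\<And>s. 0 \<le> s \<Longrightarrow> s \<le> a \<Longrightarrow> expectation (\<lambda>\<omega>. F s \<omega> ^ n) \<le> K"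
  shows "integrable M (\<lambda>\<omega>. (LBINT s:{0..a}. F s \<omega>) ^ n) \<and>
    expectation (\<lambda>\<omega>. (LBINT s:{0..a}. F s \<omega>) ^ n) \<le> a ^ n * K"
proof
  interpret P: pair_sigma_finite lborel M by standard
  let ?I = "\<lambda>\<omega>. LBINT s:{0..a}. F s \<omega>"
  have I0: "0 \<le> ?I \<omega>" for \<omega>
    unfolding set_lebesgue_integral_def using pos by (intro Bochner_Integration.integral_nonneg) auto
  have Im: "?I \<in> borel_measurable M" by (rule borel_measurable_LBINT_paths(2)[OF m c]) (use a in auto)
  have K0: "0 \<le> K"
    using order_trans[OF Bochner_Integration.integral_nonneg K[of 0]] pos a by auto
  have jm: "(\<lambda>p. indicator {0..a} (fst p) *\<^sub>R F (fst p) (snd p) ^ n) \<in> borel_measurable (lborel \<Otimes>\<^sub>M M)"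
    by (rule borel_measurable_LBINT_paths(1)[of a "\<lambda>s \<omega>. F s \<omega> ^ n"])
      (use a m c in \<open>auto intro!: borel_measurable_power continuous_intros\<close>)
  have "ennreal (a * ?I \<omega> ^ n) \<le> (\<integral>\<^sup>+ s. ennreal (a ^ n) * ennreal (indicator {0..a} s *\<^sub>R F s \<omega> ^ n) \<partial>lborel)"
    if \<omega>: "\<omega> \<in> space M" for \<omega>
  proof -
    have "set_integrable lborel {0..a} (\<lambda>s. F s \<omega> ^ n)"
      by (intro borel_integrable_atLeastAtMost' continuous_intros c \<omega>)
    then have "(\<integral>\<^sup>+ s. ennreal (indicator {0..a} s *\<^sub>R F s \<omega> ^ n) \<partial>lborel) = ennreal (LBINT s:{0..a}. F s \<omega> ^ n)"
      unfolding set_lebesgue_integral_def set_integrable_def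
      by (rule nn_integral_eq_integral) (use pos in auto)
    moreover have "(\<lambda>s. ennreal (indicator {0..a} s *\<^sub>R F s \<omega> ^ n)) \<in> borel_measurable lborel"
      using \<open>set_integrable lborel {0..a} (\<lambda>s. F s \<omega> ^ n)\<close> unfolding set_integrable_def by auto
    ultimately have "(\<integral>\<^sup>+ s. ennreal (a ^ n) * ennreal (indicator {0..a} s *\<^sub>R F s \<omega> ^ n) \<partial>lborel)
        = ennreal (a ^ n) * ennreal (LBINT s:{0..a}. F s \<omega> ^ n)"
      by (simp only: nn_integral_cmult)
    also have "\<dots> = ennreal (a ^ n * (LBINT s:{0..a}. F s \<omega> ^ n))"
      using a by (simp add: ennreal_mult')
    finally show ?thesis
      using power_LBINT_le[OF a c[OF \<omega>], of n] pos by (simp add: ennreal_leI)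
  qed
  then have "(\<integral>\<^sup>+ \<omega>. ennreal (a * ?I \<omega> ^ n) \<partial>M) \<le>
      (\<integral>\<^sup>+ \<omega>. \<integral>\<^sup>+ s. ennreal (a ^ n) * ennreal (indicator {0..a} s *\<^sub>R F s \<omega> ^ n) \<partial>lborel \<partial>M)"
    by (intro nn_integral_mono) auto
  also have "\<dots> = (\<integral>\<^sup>+ s. \<integral>\<^sup>+ \<omega>. ennreal (a ^ n) * ennreal (indicator {0..a} s *\<^sub>R F s \<omega> ^ n) \<partial>M \<partial>lborel)"
    by (rule P.Fubini')
      (use jm in \<open>simp add: case_prod_beta'\<close>)
  also have "\<dots> \<le> (\<integral>\<^sup>+ s. ennreal (a ^ n * K) * indicator {0..a} s \<partial>lborel)"
  proof (rule nn_integral_mono)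
    fix s
    show "(\<integral>\<^sup>+ \<omega>. ennreal (a ^ n) * ennreal (indicator {0..a} s *\<^sub>R F s \<omega> ^ n) \<partial>M) \<le> ennreal (a ^ n * K) * indicator {0..a} s"
    proof (cases "s \<in> {0..a}")
      case True
      then have s: "0 \<le> s" "s \<le> a" by auto
      have "(\<integral>\<^sup>+ \<omega>. ennreal (F s \<omega> ^ n) \<partial>M) = ennreal (expectation (\<lambda>\<omega>. F s \<omega> ^ n))"
        by (rule nn_integral_eq_integral[OF int[OF s]]) (use pos in auto)
      also have "\<dots> \<le> ennreal K" by (intro ennreal_leI K s)
      finally have "ennreal (a ^ n) * (\<integral>\<^sup>+ \<omega>. ennreal (F s \<omega> ^ n) \<partial>M) \<le> ennreal (a ^ n) * ennreal K"
        by (rule mult_left_mono) auto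
      moreover have "(\<lambda>\<omega>. ennreal (F s \<omega> ^ n)) \<in> borel_measurable M" using int[OF s] by auto
      ultimately show ?thesis using True a by (simp add: nn_integral_cmult ennreal_mult')
    qed simp
  qed
  also have "\<dots> = ennreal (a * (a ^ n * K))"
  proof -
    have "(\<integral>\<^sup>+ s. ennreal (a ^ n * K) * indicator {0..a} s \<partial>lborel) = ennreal (a ^ n * K) * ennreal a"
      using a by (subst nn_integral_cmult_indicator) auto
    then show ?thesis using a K0 by (simp add: ennreal_mult'[symmetric] mult.commute)
  qed
  finally have bd: "(\<integral>\<^sup>+ \<omega>. ennreal (a * ?I \<omega> ^ n) \<partial>M) \<le> ennreal (a * (a ^ n * K))" .
  have i1: "integrable M (\<lambda>\<omega>. a * ?I \<omega> ^ n)"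
  proof (rule integrableI_bounded)
    show "(\<integral>\<^sup>+ \<omega>. ennreal (norm (a * ?I \<omega> ^ n)) \<partial>M) < \<infinity>"
      using bd I0 a by (simp add: abs_mult power_abs le_less_trans[OF _ ennreal_less_top])
  qed (intro borel_measurable_times borel_measurable_power Im borel_measurable_const)
  then show "integrable M (\<lambda>\<omega>. ?I \<omega> ^ n)" using a by simp
  have "ennreal (expectation (\<lambda>\<omega>. a * ?I \<omega> ^ n)) \<le> ennreal (a * (a ^ n * K))"
    using bd nn_integral_eq_integral[OF i1] I0 a by simp
  then have "a * expectation (\<lambda>\<omega>. ?I \<omega> ^ n) \<le> a * (a ^ n * K)"
    using a K0 by (simp add: ennreal_le_iff)
  then show "expectation (\<lambda>\<omega>. ?I \<omega> ^ n) \<le> a ^ n * K" using a by simp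
qed

section \<open>The triangle form and its deterministic properties\<close>

text \<open>If \<open>f\<^sub>0, f\<^sub>1, f\<^sub>2\<close> are the values at times \<open>0, a, 2a\<close> of a real affine function of \<open>Zint b\<close> with linear part
  \<open>\<eta>\<close>, then \<open>f\<^sub>0\<^sup>2 + f\<^sub>1\<^sup>2 + f\<^sub>2\<^sup>2\<close> is at least \<open>\<bar>\<eta>\<bar>\<^sup>2 / 4\<close> times this number, which no longer depends on the function.\<close>

definition triangle_form :: "real \<Rightarrow> (real \<Rightarrow> real) \<Rightarrow> real" where
  "triangle_form a b = (Im (cnj (Zint b a) * (Zint b (2 * a) - Zint b a)))\<^sup>2 /
    ((cmod (Zint b a))\<^sup>2 + (cmod (Zint b (2 * a) - Zint b a))\<^sup>2)"

text \<open>Subtracting a constant from the path rotates \<open>Zint\<close>, and a common rotation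
  of both arms preserves their lengths and their wedge. Hence the form of a path observed from a
  later time on is a function of the increments after that time.\<close>

lemma triangle_form_minus_const: "triangle_form a (\<lambda>s. b s - c) = triangle_form a b"
proof -
  have 1: "cnj (cis (- c) * u) * (cis (- c) * v - cis (- c) * u) = cnj u * (v - u)" for u v
  proof -
    have "cnj (cis (- c) * u) * (cis (- c) * v - cis (- c) * u) = (cnj (cis (- c)) * cis (- c)) * (cnj u * (v - u))"
      by (simp add: algebra_simps)
    also have "cnj (cis (- c)) * cis (- c) = 1" by (simp add: cis_cnj cis_mult)
    finally show ?thesis by simp
  qed
  have 2: "cmod (cis (- c) * v - cis (- c) * u) = cmod (v - u)" for u v
    by (simp add: right_diff_distrib[symmetric] norm_mult del: right_diff_distrib)
  show ?thesis unfolding triangle_form_def Zint_minus_const 1 2 norm_mult norm_cis mult_1_left ..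
qed

lemma Im_cnj_mult_le: "\<bar>Im (cnj u * v)\<bar> \<le> cmod u * cmod v"
  using abs_Im_le_cmod[of "cnj u * v"] by (simp add: norm_mult del: times_complex.simps)

lemma Im_cnj_mult_le_sum: "\<bar>Im (cnj u * v)\<bar> \<le> (cmod u)\<^sup>2 + (cmod v)\<^sup>2"
proof -
  have "2 * (cmod u * cmod v) \<le> (cmod u)\<^sup>2 + (cmod v)\<^sup>2"
    using sum_squares_bound[of "cmod u" "cmod v"] by (simp add: mult.assoc)
  moreover have "0 \<le> cmod u * cmod v" by simp
  ultimately show ?thesis using Im_cnj_mult_le[of u v] by linarith
qed

lemma triangle_form_nonneg: "0 \<le> triangle_form a b" by (simp add: triangle_form_def)

lemma square_div_le:
  fixes D S :: real
  assumes "\<bar>D\<bar> \<le> S" shows "D\<^sup>2 / S \<le> S"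
proof (cases "S = 0")
  case False
  then have "S > 0" using assms by linarith
  have "D\<^sup>2 \<le> S\<^sup>2" using assms by (metis abs_ge_zero power2_abs power_mono)
  then show ?thesis using \<open>S > 0\<close> by (simp add: divide_le_eq power2_eq_square)
qed simp

text \<open>The map from \<open>\<eta>\<close> to the pair
  \<open>(Re (\<eta> * u), Re (\<eta> * v))\<close> has determinant \<open>Im (cnj u * v)\<close> up
  to sign, and squared Hilbert-Schmidt norm \<open>(cmod u)\<^sup>2 + (cmod v)\<^sup>2\<close>. The
  quotient of the squared determinant by the latter bounds the least squared singular value from
  below.\<close>

lemma triangle_form_quadratic:
  assumes "f1 - f0 = Re (\<eta> * u)" "f2 - f1 = Re (\<eta> * v)"
  shows "(cmod \<eta>)\<^sup>2 / 4 * ((Im (cnj u * v))\<^sup>2 / ((cmod u)\<^sup>2 + (cmod v)\<^sup>2)) \<le> f0\<^sup>2 + f1\<^sup>2 + f2\<^sup>2"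
proof -
  let ?p = "Re (\<eta> * u)" and ?q = "Re (\<eta> * v)" and ?S = "(cmod u)\<^sup>2 + (cmod v)\<^sup>2"
  have "(?p\<^sup>2 + ?q\<^sup>2) * ?S - (cmod \<eta>)\<^sup>2 * (Im (cnj u * v))\<^sup>2 =
      (?p * Im u + ?q * Im v)\<^sup>2 + (?p * Re u + ?q * Re v)\<^sup>2"
    unfolding cmod_power2 by (simp add: algebra_simps power2_eq_square)
  then have "(cmod \<eta>)\<^sup>2 * (Im (cnj u * v))\<^sup>2 \<le> (?p\<^sup>2 + ?q\<^sup>2) * ?S"
    by (smt (verit) sum_power2_ge_zero)
  then have "(cmod \<eta>)\<^sup>2 * ((Im (cnj u * v))\<^sup>2 / ?S) \<le> ?p\<^sup>2 + ?q\<^sup>2"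
    by (cases "?S = 0") (auto simp: divide_le_eq less_le)
  also have "\<dots> \<le> 4 * (f0\<^sup>2 + f1\<^sup>2 + f2\<^sup>2)"
  proof -
    \<comment> \<open>The middle value occurs in both differences, which is why the constant is 4
      and not 2.\<close>
    have "(f1 - f0)\<^sup>2 \<le> 2 * f0\<^sup>2 + 2 * f1\<^sup>2" "(f2 - f1)\<^sup>2 \<le> 2 * f1\<^sup>2 + 2 * f2\<^sup>2"
      using zero_le_power2[of "f1 + f0"] zero_le_power2[of "f2 + f1"]
      by (simp_all add: power2_eq_square algebra_simps)
    moreover have "0 \<le> f0\<^sup>2" "0 \<le> f2\<^sup>2" by auto
    ultimately show ?thesis unfolding assms[symmetric] by argo
  qed
  finally have "(cmod \<eta>)\<^sup>2 * ((Im (cnj u * v))\<^sup>2 / ?S) \<le> 4 * (f0\<^sup>2 + f1\<^sup>2 + f2\<^sup>2)" .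
  moreover have "c * x \<le> 4 * y \<Longrightarrow> c / 4 * x \<le> y" for c x y :: real by simp
  ultimately show ?thesis by blast
qed

lemma exp_minus_le_quadratic:
  assumes "0 \<le> (y::real)" shows "exp (- y) \<le> 1 - y + y\<^sup>2 / 2"
proof -
  have p: "0 < 1 + y + y\<^sup>2 / 2" using assms by (simp add: add_pos_nonneg)
  have "exp (- y) \<le> 1 / (1 + y + y\<^sup>2 / 2)"
    using exp_lower_Taylor_quadratic[OF assms] p
    by (simp add: exp_minus inverse_eq_divide frac_le)
  also have "(1 - y + y\<^sup>2 / 2) * (1 + y + y\<^sup>2 / 2) = 1 + (y\<^sup>2)\<^sup>2 / 4"
    by (simp add: power2_eq_square algebra_simps)
  then have "1 / (1 + y + y\<^sup>2 / 2) \<le> 1 - y + y\<^sup>2 / 2"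
    using p by (simp add: divide_le_eq)
  finally show ?thesis .
qed

lemma (in prob_space) integrable_bounded:
  fixes f :: "'a \<Rightarrow> real"
  assumes "f \<in> borel_measurable M" "\<And>\<omega>. \<omega> \<in> space M \<Longrightarrow> \<bar>f \<omega>\<bar> \<le> K"
  shows "integrable M f"
  by (rule integrable_const_bound[where B=K]) (use assms in auto)

text \<open>The quadratic upper bound for the exponential is integrated. The parameter
  \<open>c / (C * \<kappa>)\<close> minimises the resulting polynomial, with value
  \<open>1 - c\<^sup>2 / (2 * C)\<close>; the typical size \<open>\<kappa>\<close> of
  \<open>Y\<close> has cancelled.\<close>

lemma (in prob_space) laplace_le:
  fixes Y :: "'a \<Rightarrow> real"
  assumes pos: "\<And>\<omega>. 0 \<le> Y \<omega>" and int: "integrable M Y" "integrable M (\<lambda>\<omega>. (Y \<omega>)\<^sup>2)"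
    and EY: "c * \<kappa> \<le> expectation Y" and EY2: "expectation (\<lambda>\<omega>. (Y \<omega>)\<^sup>2) \<le> C * \<kappa>\<^sup>2"
    and c: "0 < c" "0 < C" "0 < \<kappa>"
  shows "expectation (\<lambda>\<omega>. exp (- (c / (C * \<kappa>) * Y \<omega>))) \<le> 1 - c\<^sup>2 / (2 * C)"
proof -
  let ?s = "c / (C * \<kappa>)"
  have s: "0 < ?s" using c by simp
  have "expectation (\<lambda>\<omega>. exp (- (?s * Y \<omega>))) \<le> expectation (\<lambda>\<omega>. 1 - ?s * Y \<omega> + ?s\<^sup>2 / 2 * (Y \<omega>)\<^sup>2)"
  proof (rule integral_mono)
    show "integrable M (\<lambda>\<omega>. exp (- (?s * Y \<omega>)))"
    proof (rule integrable_bounded)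
      have Y: "Y \<in> borel_measurable M" using int(1) by auto
      show "(\<lambda>\<omega>. exp (- (?s * Y \<omega>))) \<in> borel_measurable M"
        by (intro borel_measurable_continuous_on[OF _ Y] continuous_intros)
      show "\<bar>exp (- (?s * Y \<omega>))\<bar> \<le> 1" for \<omega> using pos[of \<omega>] s by (simp del: times_divide_eq_left)
    qed
    show "integrable M (\<lambda>\<omega>. 1 - ?s * Y \<omega> + ?s\<^sup>2 / 2 * (Y \<omega>)\<^sup>2)"
      by (intro Bochner_Integration.integrable_add Bochner_Integration.integrable_diff
          integrable_mult_right int integrable_const)
    show "exp (- (?s * Y \<omega>)) \<le> 1 - ?s * Y \<omega> + ?s\<^sup>2 / 2 * (Y \<omega>)\<^sup>2" for \<omega>
      using exp_minus_le_quadratic[of "?s * Y \<omega>"] pos[of \<omega>] s by (simp add: power_mult_distrib del: times_divide_eq_left)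
  qed
  also have "\<dots> = 1 - ?s * expectation Y + ?s\<^sup>2 / 2 * expectation (\<lambda>\<omega>. (Y \<omega>)\<^sup>2)"
    using int by (simp add: prob_space del: times_divide_eq_left)
  also have "\<dots> \<le> 1 - ?s * (c * \<kappa>) + ?s\<^sup>2 / 2 * (C * \<kappa>\<^sup>2)"
    using EY EY2 s by (intro add_mono diff_mono mult_left_mono) auto
  also have "\<dots> = 1 - c\<^sup>2 / (2 * C)"
    using c by (simp add: field_simps power2_eq_square)
  finally show ?thesis .
qed

text \<open>For fixed \<open>z\<close> the expression is \<open>cmod z\<close> times a coordinate of
  \<open>w\<close>, in the direction \<open>pi / 2 - Arg z\<close>. Thus a bound valid in every
  direction can be used in the direction dictated by the past of the path.\<close>

lemma Im_mult_polar: "\<exists>\<phi>. \<forall>w. Im (z * w) = cmod z * Re (cis (- \<phi>) * w)"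
proof (intro exI allI)
  fix w
  have z: "z = cmod z * cis (Arg z)" by (simp add: rcis_cmod_Arg rcis_def[symmetric])
  show "Im (z * w) = cmod z * Re (cis (- (- Arg z + pi/2)) * w)"
    by (subst z) (simp add: algebra_simps cos_diff sin_diff)
qed

text \<open>From \<open>\<bar>sin x\<bar> \<le> \<bar>x\<bar>\<close>. For Brownian paths on a short
  block the right-hand side is of order a^(3/2) instead of the trivial a; the fourth moment of the
  wedge depends on this gain.\<close>

lemma abs_Im_Zint_le:
  assumes b: "continuous_on {0..} b" and a: "0 \<le> a"
  shows "\<bar>Im (Zint b a)\<bar> \<le> (LBINT s:{0..a}. \<bar>b s\<bar>)"
proof -
  have ba: "continuous_on {0..a} b" by (rule continuous_on_subset[OF b]) auto
  have "Im (Zint b a) = proj b (pi / 2) a" by (simp add: proj_def)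
  also have "\<dots> = (LBINT s:{0..a}. cos (b s - pi / 2))"
    using power_primitive[of a "proj b (pi / 2)" "\<lambda>s. cos (b s - pi / 2)" 0]
      proj_has_vector_derivative[OF b] a ba by (simp add: continuous_intros)
  finally have eq: "Im (Zint b a) = (LBINT s:{0..a}. cos (b s - pi / 2))" .
  have sin: "cos (b s - pi / 2) = sin (b s)" for s by (simp add: cos_diff)
  have i: "set_integrable lborel {0..a} (\<lambda>s. \<bar>b s\<bar>)" "set_integrable lborel {0..a} (\<lambda>s. - \<bar>b s\<bar>)"
    "set_integrable lborel {0..a} (\<lambda>s. sin (b s))"
    by (intro borel_integrable_atLeastAtMost' continuous_intros ba)+
  have "(LBINT s:{0..a}. sin (b s)) \<le> (LBINT s:{0..a}. \<bar>b s\<bar>)"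
    by (rule set_integral_mono_continuous[OF i(3,1)]) (use abs_sin_x_le_abs_x abs_ge_self order_trans in blast)
  moreover have "(LBINT s:{0..a}. - \<bar>b s\<bar>) \<le> (LBINT s:{0..a}. sin (b s))"
  proof (rule set_integral_mono_continuous[OF i(2,3)])
    show "- \<bar>b s\<bar> \<le> sin (b s)" for s using abs_sin_x_le_abs_x[of "b s"] by linarith
  qed
  moreover have "(LBINT s:{0..a}. - \<bar>b s\<bar>) = - (LBINT s:{0..a}. \<bar>b s\<bar>)"
    by (rule set_integral_uminus[OF i(1)])
  ultimately show ?thesis unfolding eq sin by linarith
qed

section \<open>Moments of the wedge of two consecutive arms\<close>

context standard_brownian_motion
begin

abbreviation sample :: "'a \<Rightarrow> real \<Rightarrow> real" where "sample \<omega> \<equiv> \<lambda>s. B s \<omega>"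
abbreviation Zint_shift :: "real \<Rightarrow> real \<Rightarrow> 'a \<Rightarrow> complex" where
  "Zint_shift t a \<omega> \<equiv> Zint (\<lambda>s. B (t + s) \<omega> - B t \<omega>) a"
abbreviation wedge :: "real \<Rightarrow> 'a \<Rightarrow> real" where
  "wedge a \<omega> \<equiv> Im (cnj (Zint (sample \<omega>) a) * (Zint (sample \<omega>) (2 * a) - Zint (sample \<omega>) a))"
abbreviation arms :: "real \<Rightarrow> 'a \<Rightarrow> real" where
  "arms a \<omega> \<equiv> (cmod (Zint (sample \<omega>) a))\<^sup>2 + (cmod (Zint (sample \<omega>) (2 * a) - Zint (sample \<omega>) a))\<^sup>2"
text \<open>The conjugate first arm in the frame that points along the direction of the path at time
  \<open>a\<close>. The rotation is borrowed from the second arm, whose remaining factor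
  \<open>Zint_shift a a\<close> depends only on increments after \<open>a\<close>; the wedge is then
  a past factor times an independent one.\<close>

abbreviation past_arm :: "real \<Rightarrow> 'a \<Rightarrow> complex" where
  "past_arm a \<omega> \<equiv> cnj (Zint (sample \<omega>) a) * cis (B a \<omega>)"

lemma Zint_second_half:
  assumes "\<omega> \<in> space M" "0 \<le> a"
  shows "Zint (sample \<omega>) (2 * a) - Zint (sample \<omega>) a = cis (B a \<omega>) * Zint_shift a a \<omega>"
  using Zint_diff[OF continuous_paths[OF assms(1)] assms(2,2)]
  by (simp add: Zint_minus_const mult.assoc[symmetric] cis_mult)

lemma wedge_eq:
  assumes "\<omega> \<in> space M" "0 \<le> a"
  shows "wedge a \<omega> = Im (past_arm a \<omega> * Zint_shift a a \<omega>)"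
  unfolding Zint_second_half[OF assms] by (simp only: mult.assoc)

lemma wedge_measurable:
  assumes "0 \<le> a"
  shows "wedge a \<in> borel_measurable M" "arms a \<in> borel_measurable M"
    "(\<lambda>\<omega>. triangle_form a (sample \<omega>)) \<in> borel_measurable M"
proof -
  have m: "(\<lambda>\<omega>. Zint (sample \<omega>) a) \<in> borel_measurable M"
    "(\<lambda>\<omega>. Zint (sample \<omega>) (2 * a)) \<in> borel_measurable M"
    using assms Zint_measurable by auto
  have c: "(\<lambda>\<omega>. cnj (Zint (sample \<omega>) a)) \<in> borel_measurable M"
    by (intro borel_measurable_continuous_on[OF _ m(1)] continuous_intros)
  have d: "(\<lambda>\<omega>. cnj (Zint (sample \<omega>) a) * (Zint (sample \<omega>) (2 * a) - Zint (sample \<omega>) a)) \<in> borel_measurable M"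
    by (intro borel_measurable_times borel_measurable_diff m c)
  show 1: "wedge a \<in> borel_measurable M"
    by (intro borel_measurable_continuous_on[OF _ d] continuous_intros)
  show 2: "arms a \<in> borel_measurable M"
    by (intro borel_measurable_add borel_measurable_power borel_measurable_norm[THEN measurable_compose[rotated]]
        borel_measurable_diff m)
  show "(\<lambda>\<omega>. triangle_form a (sample \<omega>)) \<in> borel_measurable M"
    unfolding triangle_form_def by (intro borel_measurable_divide borel_measurable_power 1 2)
qed

lemma arms_moment:
  assumes a: "0 \<le> a"
  shows "integrable M (\<lambda>\<omega>. arms a \<omega> ^ n)"
    and "expectation (\<lambda>\<omega>. arms a \<omega> ^ n) \<le> 4 ^ Suc n * moment_const n * a ^ n"
proof -
  interpret S: standard_brownian_motion M "\<lambda>s \<omega>. B (a + s) \<omega> - B a \<omega>"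
    by (rule shifted_brownian_motion[OF a])
  have v: "cmod (Zint (sample \<omega>) (2 * a) - Zint (sample \<omega>) a) = cmod (Zint_shift a a \<omega>)" if "\<omega> \<in> space M" for \<omega>
    unfolding Zint_second_half[OF that a] by (simp add: norm_mult)
  have b: "arms a \<omega> ^ n \<le> 2 ^ n * (cmod (Zint (sample \<omega>) a) ^ (2 * n) + cmod (Zint_shift a a \<omega>) ^ (2 * n))"
    if "\<omega> \<in> space M" for \<omega>
    unfolding v[OF that] power_mult by (intro power_add_le) auto
  have i: "integrable M (\<lambda>\<omega>. 2 ^ n * (cmod (Zint (sample \<omega>) a) ^ (2 * n) + cmod (Zint_shift a a \<omega>) ^ (2 * n)))"
    using integrable_Zint_power[OF a] S.integrable_Zint_power[OF a] by simp
  show li: "integrable M (\<lambda>\<omega>. arms a \<omega> ^ n)"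
    by (rule Bochner_Integration.integrable_bound[OF i])
      (use b in \<open>auto intro!: borel_measurable_power wedge_measurable a AE_I2 simp: abs_of_nonneg\<close>)
  have "expectation (\<lambda>\<omega>. arms a \<omega> ^ n) \<le>
     expectation (\<lambda>\<omega>. 2 ^ n * (cmod (Zint (sample \<omega>) a) ^ (2 * n) + cmod (Zint_shift a a \<omega>) ^ (2 * n)))"
    by (rule integral_mono[OF li i b])
  also have "\<dots> = 2 ^ n * (expectation (\<lambda>\<omega>. cmod (Zint (sample \<omega>) a) ^ (2 * n)) + expectation (\<lambda>\<omega>. cmod (Zint_shift a a \<omega>) ^ (2 * n)))"
    using integrable_Zint_power[OF a] S.integrable_Zint_power[OF a] by simp
  also have "\<dots> \<le> 2 ^ n * (2 ^ Suc n * moment_const n * a ^ n + 2 ^ Suc n * moment_const n * a ^ n)"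
    by (intro mult_left_mono add_mono even_moment_Zint S.even_moment_Zint a) auto
  also have "\<dots> = (2 ^ n * 2 ^ n) * 4 * moment_const n * a ^ n" by (simp add: algebra_simps)
  also have "(2 ^ n * 2 ^ n :: real) = 4 ^ n" by (simp add: power_mult_distrib[symmetric])
  finally show "expectation (\<lambda>\<omega>. arms a \<omega> ^ n) \<le> 4 ^ Suc n * moment_const n * a ^ n" by simp
qed

lemma cmod_zz: "cmod (past_arm a \<omega>) = cmod (Zint (sample \<omega>) a)"
  by (simp add: norm_mult)

text \<open>Seen from time \<open>a\<close>, the wedge is the length of the past arm times a
  coordinate of the independent second arm, in a direction fixed by the past.
  \<open>second_moment_lower\<close> holds in all directions, so the second moment is at least the
  product of the two lower bounds: 4/81 = (2/27) * (2/3).\<close>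

lemma wedge_second_moment:
  assumes a: "0 \<le> a"
  shows "4 / 81 * (a ^ 5 / max 1 a ^ 3) \<le> expectation (\<lambda>\<omega>. (wedge a \<omega>)\<^sup>2)"
proof -
  interpret S: standard_brownian_motion M "\<lambda>s \<omega>. B (a + s) \<omega> - B a \<omega>"
    by (rule shifted_brownian_motion[OF a])
  define d where "d = max 1 a"
  define L where "L = 2 / 27 * (a ^ 3 / d\<^sup>2)"
  have d: "0 < d" by (simp add: d_def)
  have L0: "0 \<le> L" using a by (simp add: L_def)
  let ?P = "path_algebra M {0..a} B"
  let ?F = "path_algebra M {0..} (\<lambda>s \<omega>. B (a + s) \<omega> - B a \<omega>)"
  have uP: "(\<lambda>\<omega>. Zint (sample \<omega>) a) \<in> borel_measurable ?P" "B a \<in> borel_measurable ?P"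
    using past_measurable[of a a] a by auto
  have uM: "(\<lambda>\<omega>. Zint (sample \<omega>) a) \<in> borel_measurable M" "B a \<in> borel_measurable M"
    using Zint_measurable measurable_B a by auto
  have zmeas: "past_arm a \<in> borel_measurable N"
    if "(\<lambda>\<omega>. Zint (sample \<omega>) a) \<in> borel_measurable N" "B a \<in> borel_measurable N" for N
    by (intro borel_measurable_times borel_measurable_continuous_on[OF _ that(1)]
        borel_measurable_continuous_on[OF _ that(2)] continuous_intros)
  have VM: "Zint_shift a a \<in> borel_measurable M" using S.Zint_measurable[OF a] .
  have VF: "Zint_shift a a \<in> borel_measurable ?F" using future_measurable(2)[OF a a] .
  have parts: "(\<lambda>\<omega>. Re (f \<omega>)) \<in> borel_measurable N" "(\<lambda>\<omega>. Im (f \<omega>)) \<in> borel_measurable N"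
    if "f \<in> borel_measurable N" for f :: "'a \<Rightarrow> complex" and N
    by (intro borel_measurable_continuous_on[OF _ that] continuous_intros)+
  have ub: "cmod (Zint (sample \<omega>) a) \<le> a" if "\<omega> \<in> space M" for \<omega>
    by (rule norm_Zint_le[OF continuous_paths[OF that] a])
  have Vb: "cmod (Zint_shift a a \<omega>) \<le> a" if "\<omega> \<in> space M" for \<omega>
    by (rule norm_Zint_le[OF S.continuous_paths[OF that] a])
  let ?p = "\<lambda>\<omega>. Re (past_arm a \<omega>)" and ?q = "\<lambda>\<omega>. Im (past_arm a \<omega>)"
  let ?x = "\<lambda>\<omega>. Re (Zint_shift a a \<omega>)" and ?y = "\<lambda>\<omega>. Im (Zint_shift a a \<omega>)"
  have prodb: "\<bar>f \<omega> * g \<omega>\<bar> \<le> a * a" if "\<bar>f \<omega>\<bar> \<le> cmod (h \<omega>)" "\<bar>g \<omega>\<bar> \<le> cmod (h \<omega>)" "cmod (h \<omega>) \<le> a"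
    for f g :: "'a \<Rightarrow> real" and h :: "'a \<Rightarrow> complex" and \<omega>
    unfolding abs_mult using that a by (intro mult_mono) auto
  have ip: "integrable M (\<lambda>\<omega>. ?p \<omega> * ?p \<omega>)" "integrable M (\<lambda>\<omega>. ?q \<omega> * ?q \<omega>)" "integrable M (\<lambda>\<omega>. ?p \<omega> * ?q \<omega>)"
    by (rule integrable_bounded[where K="a * a"];
      (intro borel_measurable_times[OF parts(1) parts(1)] borel_measurable_times[OF parts(2) parts(2)]
         borel_measurable_times[OF parts(1) parts(2)] zmeas uM)?;
      (rule prodb[of _ _ "past_arm a"]; (intro abs_Re_le_cmod abs_Im_le_cmod)?; (unfold cmod_zz, rule ub, assumption)?)?)+
  have iV: "integrable M (\<lambda>\<omega>. ?x \<omega> * ?x \<omega>)" "integrable M (\<lambda>\<omega>. ?y \<omega> * ?y \<omega>)" "integrable M (\<lambda>\<omega>. ?x \<omega> * ?y \<omega>)"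
    by (rule integrable_bounded[where K="a * a"];
      (intro borel_measurable_times[OF parts(1) parts(1)] borel_measurable_times[OF parts(2) parts(2)]
         borel_measurable_times[OF parts(1) parts(2)] VM)?;
      (rule prodb[of _ _ "Zint_shift a a"]; (intro abs_Re_le_cmod abs_Im_le_cmod)?; (rule Vb, assumption)?)?)+
  note pP = borel_measurable_times[OF parts(1)[OF zmeas[OF uP]] parts(1)[OF zmeas[OF uP]]]
    borel_measurable_times[OF parts(2)[OF zmeas[OF uP]] parts(2)[OF zmeas[OF uP]]]
    borel_measurable_times[OF parts(1)[OF zmeas[OF uP]] parts(2)[OF zmeas[OF uP]]]
  note vF = borel_measurable_times[OF parts(1)[OF VF] parts(1)[OF VF]]
    borel_measurable_times[OF parts(2)[OF VF] parts(2)[OF VF]]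
    borel_measurable_times[OF parts(1)[OF VF] parts(2)[OF VF]]
  note E1 = expectation_past_future[OF a pP(1) vF(2) ip(1) iV(2)]
  note E2 = expectation_past_future[OF a pP(2) vF(1) ip(2) iV(1)]
  note E3 = expectation_past_future[OF a pP(3) vF(3) ip(3) iV(3)]
  define Sxx where "Sxx = expectation (\<lambda>\<omega>. ?x \<omega> * ?x \<omega>)"
  define Syy where "Syy = expectation (\<lambda>\<omega>. ?y \<omega> * ?y \<omega>)"
  define Sxy where "Sxy = expectation (\<lambda>\<omega>. ?x \<omega> * ?y \<omega>)"
  have sq: "(Im (z * w))\<^sup>2 = Re z * Re z * (Im w * Im w) + Im z * Im z * (Re w * Re w) + 2 * (Re z * Im z * (Re w * Im w))" for z w
    by (simp add: power2_eq_square algebra_simps)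
  \<comment> \<open>Instead of conditioning, the square is expanded into past coefficients and the
    future moments \<open>Sxx\<close>, \<open>Syy\<close>, \<open>Sxy\<close>. The inequality is
    proved for deterministic \<open>z\<close> and thus holds pointwise when the random past arm is
    inserted; the product rule recombines the terms.\<close>
  have form: "L * (cmod z)\<^sup>2 \<le> Re z * Re z * Syy + Im z * Im z * Sxx + 2 * (Re z * Im z * Sxy)" for z
  proof -
    obtain \<phi> where \<phi>: "\<And>w. Im (z * w) = cmod z * Re (cis (- \<phi>) * w)" using Im_mult_polar by blast
    have "L * (cmod z)\<^sup>2 \<le> (cmod z)\<^sup>2 * expectation (\<lambda>\<omega>. (S.X \<phi> a \<omega>)\<^sup>2)"
      using S.second_moment_lower[OF a, of \<phi>] unfolding L_def d_def
      by (subst mult.commute) (intro mult_left_mono, auto)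
    also have "\<dots> = expectation (\<lambda>\<omega>. (Im (z * Zint_shift a a \<omega>))\<^sup>2)"
      unfolding \<phi> proj_def by (simp add: power_mult_distrib)
    also have "\<dots> = Re z * Re z * Syy + Im z * Im z * Sxx + 2 * (Re z * Im z * Sxy)"
      unfolding sq Sxx_def Syy_def Sxy_def using iV by simp
    finally show ?thesis .
  qed
  have "4 / 81 * (a ^ 5 / d ^ 3) = L * (2 / 3 * (a\<^sup>2 / d))"
    unfolding L_def by (simp add: power2_eq_square eval_nat_numeral)
  also have "\<dots> \<le> L * expectation (\<lambda>\<omega>. (cmod (Zint (sample \<omega>) a))\<^sup>2)"
    using Zint_second_moment_lower[OF a] L0 unfolding d_def by (rule mult_left_mono)
  also have "\<dots> = expectation (\<lambda>\<omega>. L * (cmod (past_arm a \<omega>))\<^sup>2)"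
    unfolding cmod_zz by simp
  also have "\<dots> \<le> expectation (\<lambda>\<omega>. ?p \<omega> * ?p \<omega> * Syy + ?q \<omega> * ?q \<omega> * Sxx + 2 * (?p \<omega> * ?q \<omega> * Sxy))"
  proof (rule integral_mono[OF _ _ form])
    show "integrable M (\<lambda>\<omega>. L * (cmod (past_arm a \<omega>))\<^sup>2)"
      unfolding cmod_zz using integrable_Zint_power[OF a] by simp
  qed (use ip in simp)
  also have "\<dots> = expectation (\<lambda>\<omega>. ?p \<omega> * ?p \<omega>) * Syy + expectation (\<lambda>\<omega>. ?q \<omega> * ?q \<omega>) * Sxx
      + 2 * (expectation (\<lambda>\<omega>. ?p \<omega> * ?q \<omega>) * Sxy)"
    using ip by simp
  also have "\<dots> = expectation (\<lambda>\<omega>. (Im (past_arm a \<omega> * Zint_shift a a \<omega>))\<^sup>2)"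
    unfolding sq Sxx_def Syy_def Sxy_def E1(1)[symmetric] E2(1)[symmetric] E3(1)[symmetric]
    using E1(2) E2(2) E3(2) by simp
  also have "\<dots> = expectation (\<lambda>\<omega>. (wedge a \<omega>)\<^sup>2)"
    by (intro Bochner_Integration.integral_cong refl) (simp only: wedge_eq a)
  finally show ?thesis unfolding d_def .
qed

text \<open>In the frame of the direction at time \<open>a\<close> both arms have real part at most
  \<open>a\<close>, while their imaginary parts are bounded by the integrals \<open>?D1\<close> and
  \<open>?D2\<close> of increments of \<open>B\<close>. So the wedge is at most
  \<open>a * (?D1 + ?D2)\<close>, of order a^(5/2); 96 = 2^4 * (3 + 3), where 3 is the fourth
  Gaussian moment.\<close>

lemma wedge_fourth_moment:
  assumes a: "0 < a"
  shows "integrable M (\<lambda>\<omega>. wedge a \<omega> ^ 4)" and "expectation (\<lambda>\<omega>. wedge a \<omega> ^ 4) \<le> 96 * a ^ 10"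
proof -
  interpret S: standard_brownian_motion M "\<lambda>s \<omega>. B (a + s) \<omega> - B a \<omega>"
    by (rule shifted_brownian_motion) (use a in auto)
  let ?D1 = "\<lambda>\<omega>. LBINT s:{0..a}. \<bar>B s \<omega> - B a \<omega>\<bar>"
  let ?D2 = "\<lambda>\<omega>. LBINT s:{0..a}. \<bar>B (a + s) \<omega> - B a \<omega>\<bar>"
  have g2: "gauss_const 2 = 3" by (simp add: gauss_const_def fact_numeral)
  have cont: "continuous_on {0..a} (\<lambda>s. B s \<omega>)" "continuous_on {0..a} (\<lambda>s. B (a + s) \<omega> - B a \<omega>)" if "\<omega> \<in> space M" for \<omega>
    by (rule continuous_on_subset[OF continuous_paths[OF that]] continuous_on_subset[OF S.continuous_paths[OF that]]; auto)+
  have "integrable M (\<lambda>\<omega>. ?D1 \<omega> ^ 4) \<and>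
      expectation (\<lambda>\<omega>. ?D1 \<omega> ^ 4) \<le> a ^ 4 * (3 * a\<^sup>2)"
  proof (rule moment_LBINT[of a "\<lambda>s \<omega>. \<bar>B s \<omega> - B a \<omega>\<bar>"])
    fix s assume s: "0 \<le> s" "s \<le> a"
    have e: "\<bar>B s \<omega> - B a \<omega>\<bar> ^ 4 = (B a \<omega> - B s \<omega>) ^ (2 * 2)" for \<omega>
      by (simp add: power_even_abs_numeral power4_eq_xxxx algebra_simps)
    show "(\<lambda>\<omega>. \<bar>B s \<omega> - B a \<omega>\<bar>) \<in> borel_measurable M"
      using s a by (intro borel_measurable_abs borel_measurable_diff measurable_B) auto
    show "integrable M (\<lambda>\<omega>. \<bar>B s \<omega> - B a \<omega>\<bar> ^ 4)"
      unfolding e by (rule even_moment_increment(1)[OF s])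
    show "expectation (\<lambda>\<omega>. \<bar>B s \<omega> - B a \<omega>\<bar> ^ 4) \<le> 3 * a\<^sup>2"
      unfolding e even_moment_increment(2)[OF s] g2 using s by (intro mult_left_mono power_mono) auto
  qed (use a cont in \<open>auto intro!: continuous_intros\<close>)
  then have D1: "integrable M (\<lambda>\<omega>. ?D1 \<omega> ^ 4)" "expectation (\<lambda>\<omega>. ?D1 \<omega> ^ 4) \<le> a ^ 4 * (3 * a\<^sup>2)"
    by auto
  have "integrable M (\<lambda>\<omega>. ?D2 \<omega> ^ 4) \<and>
      expectation (\<lambda>\<omega>. ?D2 \<omega> ^ 4) \<le> a ^ 4 * (3 * a\<^sup>2)"
  proof (rule moment_LBINT[of a "\<lambda>s \<omega>. \<bar>B (a + s) \<omega> - B a \<omega>\<bar>"])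
    fix s assume s: "0 \<le> s" "s \<le> a"
    have e: "\<bar>x\<bar> ^ 4 = x ^ (2 * 2)" for x :: real by (simp add: power_even_abs_numeral)
    show "(\<lambda>\<omega>. \<bar>B (a + s) \<omega> - B a \<omega>\<bar>) \<in> borel_measurable M"
      using s a by (intro borel_measurable_abs borel_measurable_diff measurable_B) auto
    have sa: "0 \<le> a" "a \<le> a + s" using s a by auto
    show "integrable M (\<lambda>\<omega>. \<bar>B (a + s) \<omega> - B a \<omega>\<bar> ^ 4)"
      unfolding e by (rule even_moment_increment(1)[OF sa])
    show "expectation (\<lambda>\<omega>. \<bar>B (a + s) \<omega> - B a \<omega>\<bar> ^ 4) \<le> 3 * a\<^sup>2"
      unfolding e even_moment_increment(2)[OF sa] g2 using s by (intro mult_left_mono power_mono) auto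
  qed (use a cont in \<open>auto intro!: continuous_on_rabs\<close>)
  then have D2: "integrable M (\<lambda>\<omega>. ?D2 \<omega> ^ 4)" "expectation (\<lambda>\<omega>. ?D2 \<omega> ^ 4) \<le> a ^ 4 * (3 * a\<^sup>2)"
    by auto
  have pos: "0 \<le> ?D1 \<omega>" "0 \<le> ?D2 \<omega>" for \<omega>
    unfolding set_lebesgue_integral_def by (intro Bochner_Integration.integral_nonneg; simp)+
  have b: "wedge a \<omega> ^ 4 \<le> a ^ 4 * (2 ^ 4 * (?D1 \<omega> ^ 4 + ?D2 \<omega> ^ 4))" if \<omega>: "\<omega> \<in> space M" for \<omega>
  proof -
    have past_arm: "past_arm a \<omega> = cnj (Zint (\<lambda>s. B s \<omega> - B a \<omega>) a)"
      unfolding Zint_minus_const by (simp add: cis_cnj mult.commute)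
    have iz: "\<bar>Im (past_arm a \<omega>)\<bar> \<le> ?D1 \<omega>"
      unfolding past_arm using abs_Im_Zint_le[of "\<lambda>s. B s \<omega> - B a \<omega>" a] continuous_paths[OF \<omega>] a
      by (simp add: continuous_intros)
    have iV: "\<bar>Im (Zint_shift a a \<omega>)\<bar> \<le> ?D2 \<omega>"
      using abs_Im_Zint_le[OF S.continuous_paths[OF \<omega>]] a by simp
    have rz: "\<bar>Re (past_arm a \<omega>)\<bar> \<le> a"
      using norm_Zint_le[OF continuous_paths[OF \<omega>]] a by (intro order_trans[OF abs_Re_le_cmod]) (simp add: cmod_zz)
    have rV: "\<bar>Re (Zint_shift a a \<omega>)\<bar> \<le> a"
      using norm_Zint_le[OF S.continuous_paths[OF \<omega>]] a by (intro order_trans[OF abs_Re_le_cmod]) simp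
    have "\<bar>wedge a \<omega>\<bar> = \<bar>Re (past_arm a \<omega>) * Im (Zint_shift a a \<omega>) + Im (past_arm a \<omega>) * Re (Zint_shift a a \<omega>)\<bar>"
      using wedge_eq[OF \<omega>] a by (simp only: times_complex.simps)
    also have "\<dots> \<le> \<bar>Re (past_arm a \<omega>)\<bar> * \<bar>Im (Zint_shift a a \<omega>)\<bar> + \<bar>Im (past_arm a \<omega>)\<bar> * \<bar>Re (Zint_shift a a \<omega>)\<bar>"
      by (rule order_trans[OF abs_triangle_ineq]) (simp only: abs_mult order_refl)
    also have "\<dots> \<le> a * ?D2 \<omega> + ?D1 \<omega> * a"
      using a pos by (intro add_mono mult_mono iz iV rz rV) auto
    finally have "\<bar>wedge a \<omega>\<bar> ^ 4 \<le> (a * (?D1 \<omega> + ?D2 \<omega>)) ^ 4" by (intro power_mono) (auto simp: algebra_simps)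
    also have "\<dots> \<le> a ^ 4 * (2 ^ 4 * (?D1 \<omega> ^ 4 + ?D2 \<omega> ^ 4))"
      unfolding power_mult_distrib[of a] using a pos by (intro mult_left_mono power_add_le) auto
    finally show ?thesis by (simp only: power_even_abs_numeral even_numeral)
  qed
  have i: "integrable M (\<lambda>\<omega>. a ^ 4 * (2 ^ 4 * (?D1 \<omega> ^ 4 + ?D2 \<omega> ^ 4)))"
    by (intro integrable_mult_right Bochner_Integration.integrable_add D1 D2)
  show bi: "integrable M (\<lambda>\<omega>. wedge a \<omega> ^ 4)"
  proof (rule Bochner_Integration.integrable_bound[OF i])
    show "(\<lambda>\<omega>. wedge a \<omega> ^ 4) \<in> borel_measurable M"
      using wedge_measurable(1) a by (intro borel_measurable_power) auto
    show "AE \<omega> in M. norm (wedge a \<omega> ^ 4) \<le> norm (a ^ 4 * (2 ^ 4 * (?D1 \<omega> ^ 4 + ?D2 \<omega> ^ 4)))"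
      using b by (intro AE_I2) (simp add: abs_of_nonneg order_trans[OF _ abs_ge_self] del: times_complex.simps)
  qed
  have "expectation (\<lambda>\<omega>. wedge a \<omega> ^ 4) \<le> expectation (\<lambda>\<omega>. a ^ 4 * (2 ^ 4 * (?D1 \<omega> ^ 4 + ?D2 \<omega> ^ 4)))"
    by (rule integral_mono[OF bi i b])
  also have "\<dots> = a ^ 4 * (2 ^ 4 * (expectation (\<lambda>\<omega>. ?D1 \<omega> ^ 4) + expectation (\<lambda>\<omega>. ?D2 \<omega> ^ 4)))"
    using D1(1) D2(1) by simp
  also have "\<dots> \<le> a ^ 4 * (2 ^ 4 * (a ^ 4 * (3 * a\<^sup>2) + a ^ 4 * (3 * a\<^sup>2)))"
    using D1(2) D2(2) by (intro mult_left_mono add_mono) auto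
  also have "\<dots> = 96 * a ^ 10" by (simp add: eval_nat_numeral)
  finally show "expectation (\<lambda>\<omega>. wedge a \<omega> ^ 4) \<le> 96 * a ^ 10" .
qed

end

text \<open>The typical size of \<open>triangle_form a\<close>: on a short block the path is nearly straight.\<close>

definition wedge_scale :: "real \<Rightarrow> real" where
  "wedge_scale a = (if 1 \<le> a then a else a ^ 3)"

lemma wedge_scale_pos: "0 < a \<Longrightarrow> 0 < wedge_scale a" by (simp add: wedge_scale_def)

lemma triangle_form_le_sum: "triangle_form a b \<le> (cmod (Zint b a))\<^sup>2 + (cmod (Zint b (2 * a) - Zint b a))\<^sup>2"
  unfolding triangle_form_def by (intro square_div_le Im_cnj_mult_le_sum)

text \<open>Replaces the quotient by a polynomial, through \<open>1 / S \<ge> 2 b - b\<^sup>2 S\<close>.\<close>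

lemma square_div_ge:
  fixes D S :: real
  assumes "\<bar>D\<bar> \<le> S" "0 \<le> b"
  shows "2 * b * D\<^sup>2 - b\<^sup>2 * (D\<^sup>2 * S) \<le> D\<^sup>2 / S"
proof (cases "S = 0")
  case False
  then have S: "S > 0" using assms by linarith
  have "0 \<le> D\<^sup>2 * (1 - b * S)\<^sup>2 / S" using S by simp
  also have "\<dots> = D\<^sup>2 / S - (2 * b * D\<^sup>2 - b\<^sup>2 * (D\<^sup>2 * S))"
    using S by (simp add: field_simps power2_eq_square)
  finally show ?thesis by simp
qed (use assms in simp)

section \<open>Moments of the triangle form on long and short blocks\<close>

context standard_brownian_motion
begin

text \<open>Upper bounds come from \<open>triangle_form_le_sum\<close> and the moments of the arms.
  For the lower bound the random denominator is removed by \<open>square_div_ge\<close>; this needs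
  only the second moment of the wedge and the third moment of \<open>arms\<close>, both of the
  diffusive order.\<close>

lemma triangle_form_moments_large:
  assumes a: "1 \<le> a"
  shows "(4 / 81)\<^sup>2 / (4 ^ 4 * moment_const 3) * a \<le> expectation (\<lambda>\<omega>. triangle_form a (sample \<omega>))"
    and "expectation (\<lambda>\<omega>. (triangle_form a (sample \<omega>))\<^sup>2) \<le> 4 ^ 3 * moment_const 2 * a\<^sup>2"
    and "integrable M (\<lambda>\<omega>. triangle_form a (sample \<omega>))" "integrable M (\<lambda>\<omega>. (triangle_form a (sample \<omega>))\<^sup>2)"
proof -
  have a0: "0 \<le> a" "0 < a" using a by auto
  note lm = arms_moment[OF a0(1)]
  note bm = wedge_measurable[OF a0(1)]
  show i1: "integrable M (\<lambda>\<omega>. triangle_form a (sample \<omega>))"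
    by (rule Bochner_Integration.integrable_bound[OF lm(1)[of 1]])
      (use bm triangle_form_le_sum triangle_form_nonneg in \<open>auto simp: abs_of_nonneg\<close>)
  show i2: "integrable M (\<lambda>\<omega>. (triangle_form a (sample \<omega>))\<^sup>2)"
    by (rule Bochner_Integration.integrable_bound[OF lm(1)[of 2]])
      (use bm triangle_form_le_sum triangle_form_nonneg in \<open>auto simp: abs_of_nonneg intro!: power_mono\<close>)
  have "expectation (\<lambda>\<omega>. (triangle_form a (sample \<omega>))\<^sup>2) \<le> expectation (\<lambda>\<omega>. (arms a \<omega>)\<^sup>2)"
    by (rule integral_mono[OF i2 lm(1)]) (intro power_mono triangle_form_le_sum triangle_form_nonneg)
  also have "\<dots> \<le> 4 ^ 3 * moment_const 2 * a\<^sup>2" using lm(2)[of 2] by (simp add: eval_nat_numeral)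
  finally show "expectation (\<lambda>\<omega>. (triangle_form a (sample \<omega>))\<^sup>2) \<le> 4 ^ 3 * moment_const 2 * a\<^sup>2" .
  define K where "K = 4 ^ 4 * moment_const 3"
  have K: "0 < K" unfolding K_def using moment_const_pos[of 3] by simp
  \<comment> \<open>The maximiser of
    \<open>2 * b * (4 / 81 * a\<^sup>2) - b\<^sup>2 * (K * a ^ 3)\<close>.\<close>
  define b where "b = (4 / 81) / (K * a)"
  have b: "0 \<le> b" unfolding b_def using K a by simp
  have blen: "\<bar>wedge a \<omega>\<bar> \<le> arms a \<omega>" for \<omega> by (rule Im_cnj_mult_le_sum)
  have bl2: "(wedge a \<omega>)\<^sup>2 \<le> (arms a \<omega>)\<^sup>2" for \<omega>
    using power_mono[OF blen[of \<omega>], of 2] by (simp only: power2_abs abs_ge_zero)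
  have bl3: "(wedge a \<omega>)\<^sup>2 * arms a \<omega> \<le> arms a \<omega> ^ 3" for \<omega>
    using mult_right_mono[OF bl2[of \<omega>], of "arms a \<omega>"] by (simp add: power2_eq_square eval_nat_numeral del: times_complex.simps)
  have j1: "integrable M (\<lambda>\<omega>. (wedge a \<omega>)\<^sup>2)"
    by (rule Bochner_Integration.integrable_bound[OF lm(1)[of 2]])
      (use bm(1) bl2 in \<open>auto simp: abs_of_nonneg simp del: times_complex.simps\<close>)
  have j2: "integrable M (\<lambda>\<omega>. (wedge a \<omega>)\<^sup>2 * arms a \<omega>)"
    by (rule Bochner_Integration.integrable_bound[OF lm(1)[of 3]])
      (use bm(1,2) bl3 in \<open>auto simp: abs_of_nonneg simp del: times_complex.simps\<close>)
  have E1: "4 / 81 * a\<^sup>2 \<le> expectation (\<lambda>\<omega>. (wedge a \<omega>)\<^sup>2)"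
    using wedge_second_moment[OF a0(1)] a by (simp add: max_def eval_nat_numeral del: times_complex.simps)
  have "expectation (\<lambda>\<omega>. (wedge a \<omega>)\<^sup>2 * arms a \<omega>) \<le> expectation (\<lambda>\<omega>. arms a \<omega> ^ 3)"
    by (rule integral_mono[OF j2 lm(1) bl3])
  also have "\<dots> \<le> K * a ^ 3" using lm(2)[of 3] by (simp add: K_def eval_nat_numeral)
  finally have E2: "expectation (\<lambda>\<omega>. (wedge a \<omega>)\<^sup>2 * arms a \<omega>) \<le> K * a ^ 3" .
  have "(4 / 81)\<^sup>2 / K * a = 2 * b * (4 / 81 * a\<^sup>2) - b\<^sup>2 * (K * a ^ 3)"
    unfolding b_def using K a by (simp add: field_simps power2_eq_square eval_nat_numeral)
  also have "\<dots> \<le> 2 * b * expectation (\<lambda>\<omega>. (wedge a \<omega>)\<^sup>2) - b\<^sup>2 * expectation (\<lambda>\<omega>. (wedge a \<omega>)\<^sup>2 * arms a \<omega>)"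
    using b E1 E2 by (intro diff_mono mult_left_mono) auto
  also have "\<dots> = expectation (\<lambda>\<omega>. 2 * b * (wedge a \<omega>)\<^sup>2 - b\<^sup>2 * ((wedge a \<omega>)\<^sup>2 * arms a \<omega>))"
    using j1 j2 by (simp del: times_complex.simps)
  also have "\<dots> \<le> expectation (\<lambda>\<omega>. triangle_form a (sample \<omega>))"
  proof (rule integral_mono[OF _ i1])
    show "integrable M (\<lambda>\<omega>. 2 * b * (wedge a \<omega>)\<^sup>2 - b\<^sup>2 * ((wedge a \<omega>)\<^sup>2 * arms a \<omega>))"
      by (intro Bochner_Integration.integrable_diff integrable_mult_right j1 j2)
    show "2 * b * (wedge a \<omega>)\<^sup>2 - b\<^sup>2 * ((wedge a \<omega>)\<^sup>2 * arms a \<omega>) \<le> triangle_form a (sample \<omega>)" for \<omega>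
      unfolding triangle_form_def by (rule square_div_ge[OF blen b])
  qed
  finally show "(4 / 81)\<^sup>2 / (4 ^ 4 * moment_const 3) * a \<le> expectation (\<lambda>\<omega>. triangle_form a (sample \<omega>))"
    unfolding K_def .
qed

lemma arms_bound:
  assumes "\<omega> \<in> space M" "0 \<le> a"
  shows "arms a \<omega> \<le> 2 * a\<^sup>2"
proof -
  interpret S: standard_brownian_motion M "\<lambda>s \<omega>. B (a + s) \<omega> - B a \<omega>"
    by (rule shifted_brownian_motion[OF assms(2)])
  have "(cmod (Zint (sample \<omega>) a))\<^sup>2 \<le> a\<^sup>2" "(cmod (Zint_shift a a \<omega>))\<^sup>2 \<le> a\<^sup>2"
    using norm_Zint_le[OF continuous_paths[OF assms(1)] assms(2)]
      norm_Zint_le[OF S.continuous_paths[OF assms(1)] assms(2)] by (auto intro: power_mono)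
  then show ?thesis unfolding Zint_second_half[OF assms] by (simp add: norm_mult)
qed

text \<open>On a short block the arms are almost as long as they can be, so replacing the
  denominator by its deterministic bound \<open>2 * a\<^sup>2\<close> loses no order of magnitude.
  Both moments of the simplified quotient then match the scale \<open>a ^ 3\<close>.\<close>

lemma wedge_moments_small:
  assumes a: "0 < a" "a \<le> 1"
  shows "2 / 81 * a ^ 3 \<le> expectation (\<lambda>\<omega>. (wedge a \<omega>)\<^sup>2 / (2 * a\<^sup>2))"
    and "expectation (\<lambda>\<omega>. ((wedge a \<omega>)\<^sup>2 / (2 * a\<^sup>2))\<^sup>2) \<le> 24 * (a ^ 3)\<^sup>2"
    and "integrable M (\<lambda>\<omega>. (wedge a \<omega>)\<^sup>2 / (2 * a\<^sup>2))" "integrable M (\<lambda>\<omega>. ((wedge a \<omega>)\<^sup>2 / (2 * a\<^sup>2))\<^sup>2)"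
    and "\<omega> \<in> space M \<Longrightarrow> (wedge a \<omega>)\<^sup>2 / (2 * a\<^sup>2) \<le> triangle_form a (sample \<omega>)"
proof -
  have a0: "0 \<le> a" using a by simp
  have bound: "\<bar>wedge a \<omega>\<bar> \<le> 2 * a\<^sup>2" if "\<omega> \<in> space M" for \<omega>
    using order_trans[OF Im_cnj_mult_le_sum arms_bound[OF that a0]] .
  have bi: "integrable M (\<lambda>\<omega>. (wedge a \<omega>)\<^sup>2)"
  proof (rule integrable_bounded)
    show "\<bar>(wedge a \<omega>)\<^sup>2\<bar> \<le> (2 * a\<^sup>2)\<^sup>2" if "\<omega> \<in> space M" for \<omega>
      using power_mono[OF bound[OF that], of 2] by (simp only: power2_abs abs_ge_zero abs_power2)
  qed (intro borel_measurable_power wedge_measurable a0)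
  show "integrable M (\<lambda>\<omega>. (wedge a \<omega>)\<^sup>2 / (2 * a\<^sup>2))" by (intro integrable_divide_zero bi) 
  have e: "((wedge a \<omega>)\<^sup>2 / (2 * a\<^sup>2))\<^sup>2 = wedge a \<omega> ^ 4 / (4 * a ^ 4)" for \<omega>
    by (simp add: power_divide power_mult_distrib del: times_complex.simps flip: power_mult)
  show "integrable M (\<lambda>\<omega>. ((wedge a \<omega>)\<^sup>2 / (2 * a\<^sup>2))\<^sup>2)"
    unfolding e by (intro integrable_divide_zero wedge_fourth_moment a)
  have "expectation (\<lambda>\<omega>. wedge a \<omega> ^ 4 / (4 * a ^ 4)) = expectation (\<lambda>\<omega>. wedge a \<omega> ^ 4) / (4 * a ^ 4)"
    by simp
  also have "\<dots> \<le> 96 * a ^ 10 / (4 * a ^ 4)"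
    using a by (intro divide_right_mono wedge_fourth_moment) auto
  also have "\<dots> = 24 * (a ^ 3)\<^sup>2"
    using a by (simp add: field_simps flip: power_mult power_add)
  finally show "expectation (\<lambda>\<omega>. ((wedge a \<omega>)\<^sup>2 / (2 * a\<^sup>2))\<^sup>2) \<le> 24 * (a ^ 3)\<^sup>2" unfolding e .
  have "2 / 81 * a ^ 3 = 4 / 81 * a ^ 5 / (2 * a\<^sup>2)" using a by (simp add: field_simps flip: power_add)
  also have "\<dots> \<le> expectation (\<lambda>\<omega>. (wedge a \<omega>)\<^sup>2) / (2 * a\<^sup>2)"
  proof (intro divide_right_mono)
    have mx: "max 1 a = 1" using a by simp
    show "4 / 81 * a ^ 5 \<le> expectation (\<lambda>\<omega>. (wedge a \<omega>)\<^sup>2)"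
      using wedge_second_moment[OF a0, unfolded mx] by simp
  qed simp
  finally show "2 / 81 * a ^ 3 \<le> expectation (\<lambda>\<omega>. (wedge a \<omega>)\<^sup>2 / (2 * a\<^sup>2))" by simp
  show "(wedge a \<omega>)\<^sup>2 / (2 * a\<^sup>2) \<le> triangle_form a (sample \<omega>)" if "\<omega> \<in> space M"
  proof (cases "arms a \<omega> = 0")
    case True
    then have "wedge a \<omega> = 0" using Im_cnj_mult_le_sum[of "Zint (sample \<omega>) a"] by (metis abs_le_zero_iff)
    then show ?thesis using triangle_form_nonneg by (simp del: times_complex.simps)
  next
    case False
    then have "0 < arms a \<omega>" by (simp add: less_le)
    then show ?thesis unfolding triangle_form_def using arms_bound[OF that a0] a by (intro divide_left_mono mult_pos_pos) auto
  qed
qed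

end

text \<open>\<open>\<sigma>\<close> and \<open>\<rho>\<close> are chosen before the process and the
  block length: \<open>inverse_moment\<close> uses all block lengths simultaneously. The constants
  \<open>c\<close> and \<open>C\<close> are the worse ones of the two regimes, and in the short one
  the form is replaced by its lower bound from \<open>wedge_moments_small\<close>.\<close>

lemma triangle_form_laplace:
  "\<exists>\<sigma>>0. \<exists>\<rho><1. \<forall>(M :: 'a measure) B a. standard_brownian_motion M B \<longrightarrow> 0 < a \<longrightarrow>
    (\<integral>\<omega>. exp (- (\<sigma> / wedge_scale a * triangle_form a (\<lambda>s. B s \<omega>))) \<partial>M) \<le> \<rho>"
proof -
  define c where "c = min ((4 / 81)\<^sup>2 / (4 ^ 4 * moment_const 3)) (2 / 81)"
  define C where "C = max (4 ^ 3 * moment_const 2) 24"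
  have c: "0 < c" unfolding c_def using moment_const_pos[of 3] by simp
  have C: "0 < C" unfolding C_def by simp
  have "(\<integral>\<omega>. exp (- (c / C / wedge_scale a * triangle_form a (\<lambda>s. B s \<omega>))) \<partial>M) \<le> 1 - c\<^sup>2 / (2 * C)"
    if "standard_brownian_motion M B" and a: "0 < a" for M :: "'a measure" and B a
  proof -
    interpret standard_brownian_motion M B by fact
    let ?s = "c / C / wedge_scale a"
    have s: "0 \<le> ?s" using c C wedge_scale_pos[OF a] by simp
    have seq: "?s = c / (C * wedge_scale a)" by simp
    show ?thesis
    proof (cases "1 \<le> a")
      case True
      note tm = triangle_form_moments_large[OF True]
      have "expectation (\<lambda>\<omega>. exp (- (c / (C * wedge_scale a) * triangle_form a (sample \<omega>)))) \<le> 1 - c\<^sup>2 / (2 * C)"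
      proof (rule laplace_le[OF triangle_form_nonneg tm(3,4) _ _ c C wedge_scale_pos[OF a]])
        have "c * a \<le> (4 / 81)\<^sup>2 / (4 ^ 4 * moment_const 3) * a" using a by (intro mult_right_mono) (auto simp: c_def)
        then show "c * wedge_scale a \<le> expectation (\<lambda>\<omega>. triangle_form a (sample \<omega>))"
          using tm(1) True by (simp add: wedge_scale_def)
        have "4 ^ 3 * moment_const 2 * a\<^sup>2 \<le> C * a\<^sup>2" by (intro mult_right_mono) (auto simp: C_def)
        from order_trans[OF tm(2) this]
        show "expectation (\<lambda>\<omega>. (triangle_form a (sample \<omega>))\<^sup>2) \<le> C * (wedge_scale a)\<^sup>2"
          using True by (simp add: wedge_scale_def)
      qed
      then show ?thesis unfolding seq .
    next
      case False
      then have a1: "a \<le> 1" by simp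
      note tm = wedge_moments_small[OF a a1]
      let ?Y = "\<lambda>\<omega>. (wedge a \<omega>)\<^sup>2 / (2 * a\<^sup>2)"
      have "expectation (\<lambda>\<omega>. exp (- (?s * triangle_form a (sample \<omega>)))) \<le> expectation (\<lambda>\<omega>. exp (- (?s * ?Y \<omega>)))"
      proof (rule integral_mono)
        have em: "integrable M (\<lambda>\<omega>. exp (- (?s * f \<omega>)))" if f: "f \<in> borel_measurable M" "\<And>\<omega>. 0 \<le> f \<omega>" for f
        proof (rule integrable_bounded)
          show "(\<lambda>\<omega>. exp (- (?s * f \<omega>))) \<in> borel_measurable M"
            by (intro borel_measurable_continuous_on[OF _ f(1)] continuous_intros)
          have "0 \<le> ?s * f \<omega>" for \<omega> using s f(2) by (rule mult_nonneg_nonneg)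
          then show "\<bar>exp (- (?s * f \<omega>))\<bar> \<le> 1" for \<omega> by simp
        qed
        show "integrable M (\<lambda>\<omega>. exp (- (?s * triangle_form a (sample \<omega>))))"
          using a by (intro em wedge_measurable triangle_form_nonneg) auto
        show "integrable M (\<lambda>\<omega>. exp (- (?s * ?Y \<omega>)))"
          by (rule em[OF borel_measurable_integrable[OF tm(3)]]) simp
        show "exp (- (?s * triangle_form a (sample \<omega>))) \<le> exp (- (?s * ?Y \<omega>))" if "\<omega> \<in> space M" for \<omega>
          using mult_left_mono[OF tm(5)[OF that] s] by simp
      qed
      also have "\<dots> \<le> 1 - c\<^sup>2 / (2 * C)"
        unfolding seq
      proof (rule laplace_le[OF _ tm(3,4) _ _ c C wedge_scale_pos[OF a]])
        have "c * a ^ 3 \<le> 2 / 81 * a ^ 3" using a by (intro mult_right_mono) (auto simp: c_def)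
        then show "c * wedge_scale a \<le> expectation ?Y"
          using tm(1) False unfolding wedge_scale_def by (simp del: times_complex.simps)
        have "24 * (a ^ 3)\<^sup>2 \<le> C * (a ^ 3)\<^sup>2" by (intro mult_right_mono) (auto simp: C_def)
        then show "expectation (\<lambda>\<omega>. (?Y \<omega>)\<^sup>2) \<le> C * (wedge_scale a)\<^sup>2"
          using tm(2) False unfolding wedge_scale_def by (simp del: times_complex.simps)
      qed simp
      finally show ?thesis .
    qed
  qed
  then show ?thesis
    using c C by (intro exI[of _ "c / C"] conjI exI[of _ "1 - c\<^sup>2 / (2 * C)"]) auto
qed

section \<open>Independent blocks\<close>

lemma triangle_form_measurable:
  assumes m: "\<And>s. 0 \<le> s \<Longrightarrow> s \<le> 2 * a \<Longrightarrow> X s \<in> borel_measurable N"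
    and c: "\<And>\<omega>. \<omega> \<in> space N \<Longrightarrow> continuous_on {0..} (\<lambda>s. X s \<omega>)"
    and a: "0 \<le> a"
  shows "(\<lambda>\<omega>. triangle_form a (\<lambda>s. X s \<omega>)) \<in> borel_measurable N"
proof -
  have z: "(\<lambda>\<omega>. Zint (\<lambda>s. X s \<omega>) a) \<in> borel_measurable N"
    "(\<lambda>\<omega>. Zint (\<lambda>s. X s \<omega>) (2 * a)) \<in> borel_measurable N"
    using a by (auto intro!: borel_measurable_Zint m c)
  have d: "(\<lambda>\<omega>. cnj (Zint (\<lambda>s. X s \<omega>) a) * (Zint (\<lambda>s. X s \<omega>) (2 * a) - Zint (\<lambda>s. X s \<omega>) a)) \<in> borel_measurable N"
    by (intro borel_measurable_times borel_measurable_diff z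
        borel_measurable_continuous_on[OF _ z(1)] continuous_intros)
  show ?thesis unfolding triangle_form_def
    by (intro borel_measurable_divide borel_measurable_power borel_measurable_continuous_on[OF _ d]
        borel_measurable_add borel_measurable_norm[THEN measurable_compose[rotated]]
        borel_measurable_diff z continuous_intros)
qed

text \<open>Where the denominator vanishes, the quotient is 0 by the convention for division by
  zero, and the squeeze between 0 and \<open>S\<close> gives continuity there. This makes
  \<open>triangle_form\<close> continuous in its starting time, including degenerate
  triangles.\<close>

lemma continuous_on_square_div:
  fixes D S :: "real \<Rightarrow> real"
  assumes D: "continuous_on A D" and S: "continuous_on A S" and le: "\<And>t. t \<in> A \<Longrightarrow> \<bar>D t\<bar> \<le> S t"
  shows "continuous_on A (\<lambda>t. (D t)\<^sup>2 / S t)"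
  unfolding continuous_on_eq_continuous_within
proof
  fix t assume t: "t \<in> A"
  show "continuous (at t within A) (\<lambda>t. (D t)\<^sup>2 / S t)"
  proof (cases "S t = 0")
    case False
    then show ?thesis using D S t by (intro continuous_intros) (auto simp: continuous_on_eq_continuous_within)
  next
    case True
    have "((\<lambda>t. (D t)\<^sup>2 / S t) \<longlongrightarrow> 0) (at t within A)"
    proof (rule tendsto_sandwich)
      have ev: "\<forall>\<^sub>F s in at t within A. s \<in> A" by (simp add: eventually_at_topological) blast
      show "\<forall>\<^sub>F s in at t within A. 0 \<le> (D s)\<^sup>2 / S s"
        using ev by eventually_elim (intro divide_nonneg_nonneg zero_le_power2 order_trans[OF abs_ge_zero le])
      show "\<forall>\<^sub>F s in at t within A. (D s)\<^sup>2 / S s \<le> S s"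
        using ev by eventually_elim (intro square_div_le le)
      show "(S \<longlongrightarrow> 0) (at t within A)"
        using S t True by (auto simp: continuous_on_def)
    qed simp
    then show ?thesis using True by (simp add: continuous_within)
  qed
qed

lemma Zint_shifted:
  assumes b: "continuous_on {0..} b" and "0 \<le> \<tau>" "0 \<le> a"
  shows "Zint (\<lambda>r. b (\<tau> + r)) a = Zint b (\<tau> + a) - Zint b \<tau>"
  using Zint_diff[OF b assms(2,3)] by simp

lemma continuous_on_tri:
  assumes b: "continuous_on {0..} b" and \<tau>: "0 \<le> \<tau>" and a: "0 \<le> a"
  shows "continuous_on {0..T} (\<lambda>t. triangle_form a (\<lambda>r. b (t + \<tau> + r)))"
proof -
  have Z: "continuous_on {0..T} (\<lambda>t. Zint b (t + c))" if "0 \<le> c" for c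
    by (rule continuous_on_compose2[OF continuous_on_Zint[OF b, of "T + c"]])
      (use that in \<open>auto intro!: continuous_intros\<close>)
  have C: "continuous_on {0..T} (\<lambda>t. Zint (\<lambda>r. b (t + \<tau> + r)) c)" if "0 \<le> c" for c
  proof (rule continuous_on_eq)
    show "continuous_on {0..T} (\<lambda>t. Zint b (t + (\<tau> + c)) - Zint b (t + \<tau>))"
      using that \<tau> by (intro continuous_intros Z) auto
    show "Zint b (t + (\<tau> + c)) - Zint b (t + \<tau>) = Zint (\<lambda>r. b (t + \<tau> + r)) c" if "t \<in> {0..T}" for t
      using Zint_shifted[OF b, of "t + \<tau>" c] that \<tau> \<open>0 \<le> c\<close> by (simp add: add.assoc)
  qed
  show ?thesis unfolding triangle_form_def
    using a by (intro continuous_on_square_div Im_cnj_mult_le_sum continuous_intros C) auto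
qed

lemma exp_tangent: "exp (- m) + (- exp (- m)) * (x - m) \<le> exp (- x)" for x m :: real
proof -
  have "exp (- m) * (1 + (m - x)) \<le> exp (- m) * exp (m - x)"
    by (intro mult_left_mono exp_ge_add_one_self) auto
  also have "\<dots> = exp (- x)" by (simp flip: exp_add)
  finally show ?thesis by (simp add: algebra_simps)
qed

context standard_brownian_motion
begin

lemma continuous_on_shift:
  assumes "\<omega> \<in> space M" "0 \<le> \<tau>"
  shows "continuous_on {0..} (\<lambda>r. B (\<tau> + r) \<omega>)"
  using assms by (intro continuous_on_compose2[OF continuous_paths] continuous_intros) auto

lemma triangle_form_shift_measurable:
  assumes "0 \<le> \<tau>" "0 \<le> a"
  shows "(\<lambda>\<omega>. triangle_form a (\<lambda>r. B (\<tau> + r) \<omega>)) \<in> borel_measurable M"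
  using assms by (intro triangle_form_measurable measurable_B continuous_on_shift) auto

text \<open>Induction on the number of blocks: at time \<open>\<tau>\<close> all earlier triangles
  belong to the past, and the last one depends only on later increments by
  \<open>triangle_form_minus_const\<close>. The product rule therefore splits off one factor
  \<open>\<rho>\<close>.\<close>

lemma laplace_sum_tri:
  assumes H: "\<And>\<tau>. 0 \<le> \<tau> \<Longrightarrow> expectation (\<lambda>\<omega>. exp (- (s * triangle_form a (\<lambda>r. B (\<tau> + r) \<omega>)))) \<le> \<rho>"
    and s: "0 \<le> s" and a: "0 \<le> a" and t: "0 \<le> t"
  shows "expectation (\<lambda>\<omega>. exp (- (s * (\<Sum>k<N. triangle_form a (\<lambda>r. B (t + real k * (3 * a) + r) \<omega>))))) \<le> \<rho> ^ N"
proof (induction N)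
  case 0
  then show ?case by (simp add: prob_space)
next
  case (Suc N)
  define \<tau> where "\<tau> = t + real N * (3 * a)"
  have \<tau>: "0 \<le> \<tau>" using a t by (simp add: \<tau>_def)
  let ?f = "\<lambda>\<omega>. exp (- (s * (\<Sum>k<N. triangle_form a (\<lambda>r. B (t + real k * (3 * a) + r) \<omega>))))"
  let ?g = "\<lambda>\<omega>. exp (- (s * triangle_form a (\<lambda>r. B (\<tau> + r) \<omega> - B \<tau> \<omega>)))"
  have em: "(\<lambda>\<omega>. exp (- (s * f \<omega>))) \<in> borel_measurable L" if "f \<in> borel_measurable L" for f L
    by (intro borel_measurable_continuous_on[OF _ that] continuous_intros)
  have fP: "?f \<in> borel_measurable (path_algebra M {0..\<tau>} B)"
  proof (intro em borel_measurable_sum triangle_form_measurable[where X="\<lambda>r. B (t + real _ * (3 * a) + r)"])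
    fix k r assume k: "k \<in> {..<N}" and r: "0 \<le> r" "r \<le> 2 * a"
    \<comment> \<open>A triangle occupies a length \<open>2 * a\<close> of its slot of length
      \<open>3 * a\<close>, so every earlier one is finished by time \<open>\<tau>\<close>.\<close>
    have "real k + 1 \<le> real N" using k by auto
    then have "(real k + 1) * (3 * a) \<le> real N * (3 * a)" using a by (intro mult_right_mono) auto
    then have "t + real k * (3 * a) + r \<le> \<tau>" using r a by (simp add: \<tau>_def algebra_simps)
    moreover have "0 \<le> t + real k * (3 * a) + r" using t a r by simp
    ultimately show "B (t + real k * (3 * a) + r) \<in> borel_measurable (path_algebra M {0..\<tau>} B)"
      by (intro measurable_path_algebra) auto
  next
    fix k \<omega> assume "\<omega> \<in> space (path_algebra M {0..\<tau>} B)"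
    then show "continuous_on {0..} (\<lambda>r. B (t + real k * (3 * a) + r) \<omega>)"
      using t a by (intro continuous_on_shift) auto
  qed (rule a)
  have gF: "?g \<in> borel_measurable (path_algebra M {0..} (\<lambda>r \<omega>. B (\<tau> + r) \<omega> - B \<tau> \<omega>))"
    by (intro em triangle_form_measurable[where X="\<lambda>r \<omega>. B (\<tau> + r) \<omega> - B \<tau> \<omega>"] a)
      (auto intro!: measurable_path_algebra continuous_intros continuous_on_shift \<tau>)
  have fM: "?f \<in> borel_measurable M" and gM: "?g \<in> borel_measurable M"
    using a t \<tau> by (auto intro!: em borel_measurable_sum triangle_form_shift_measurable simp: triangle_form_minus_const)
  have fi: "integrable M ?f"
    by (rule integrable_bounded[OF fM, of 1]) (use s in \<open>auto intro!: mult_nonneg_nonneg sum_nonneg triangle_form_nonneg\<close>)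
  have gi: "integrable M ?g"
    by (rule integrable_bounded[OF gM, of 1]) (use s in \<open>auto intro!: mult_nonneg_nonneg triangle_form_nonneg\<close>)
  have "expectation (\<lambda>\<omega>. exp (- (s * (\<Sum>k<Suc N. triangle_form a (\<lambda>r. B (t + real k * (3 * a) + r) \<omega>)))))
      = expectation (\<lambda>\<omega>. ?f \<omega> * ?g \<omega>)"
    by (simp add: triangle_form_minus_const \<tau>_def algebra_simps flip: exp_add)
  also have "\<dots> = expectation ?f * expectation ?g"
    by (rule expectation_past_future(1)[OF \<tau> fP gF fi gi])
  also have "\<dots> \<le> \<rho> ^ N * \<rho>"
  proof (intro mult_mono Suc.IH)
    show "expectation ?g \<le> \<rho>" using H[OF \<tau>] by (simp add: triangle_form_minus_const)
    show "0 \<le> \<rho> ^ N" using order_trans[OF Bochner_Integration.integral_nonneg Suc.IH] by simp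
  qed simp
  finally show ?case by (simp add: mult.commute)
qed

text \<open>The average over starting times \<open>t\<close> is no longer a sum of independent
  terms. Jensen's inequality for the exponential bounds its Laplace transform by the average of the
  Laplace transforms at fixed \<open>t\<close>, where independence is available.\<close>

lemma laplace_integral_tri:
  assumes H: "\<And>\<tau>. 0 \<le> \<tau> \<Longrightarrow> expectation (\<lambda>\<omega>. exp (- (s * triangle_form a (\<lambda>r. B (\<tau> + r) \<omega>)))) \<le> \<rho>"
    and s: "0 \<le> s" and a: "0 < a"
  shows "(\<lambda>\<omega>. LBINT t:{0..a}. \<Sum>k<N. triangle_form a (\<lambda>r. B (t + real k * (3 * a) + r) \<omega>)) \<in> borel_measurable M"
    and "expectation (\<lambda>\<omega>. exp (- (s / a * (LBINT t:{0..a}. \<Sum>k<N. triangle_form a (\<lambda>r. B (t + real k * (3 * a) + r) \<omega>))))) \<le> \<rho> ^ N"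
proof -
  let ?S = "\<lambda>t \<omega>. \<Sum>k<N. triangle_form a (\<lambda>r. B (t + real k * (3 * a) + r) \<omega>)"
  let ?I = "\<lambda>\<omega>. LBINT t:{0..a}. ?S t \<omega>"
  have Sc: "continuous_on {0..a} (\<lambda>t. ?S t \<omega>)" if "\<omega> \<in> space M" for \<omega>
    using a by (intro continuous_intros continuous_on_tri continuous_paths that) auto
  have Sm: "?S t \<in> borel_measurable M" if "0 \<le> t" for t
    using a that by (intro borel_measurable_sum triangle_form_shift_measurable) auto
  have S0: "0 \<le> ?S t \<omega>" for t \<omega> by (intro sum_nonneg triangle_form_nonneg)
  show Im: "?I \<in> borel_measurable M"
    by (rule borel_measurable_LBINT_paths(2)[OF Sm Sc]) (use a in auto)
  let ?E = "\<lambda>t \<omega>. exp (- (s * ?S t \<omega>))"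
  have em: "(\<lambda>\<omega>. exp (- (c * f \<omega>))) \<in> borel_measurable M" if "f \<in> borel_measurable M"
    for f :: "'a \<Rightarrow> real" and c :: real
    by (intro borel_measurable_continuous_on[OF _ that] continuous_intros)
  have E1: "\<bar>?E t \<omega>\<bar> \<le> 1" for t \<omega> using s S0 by simp
  note EL = expectation_LBINT[of a ?E, OF em[OF Sm] _ _ E1]
  have Ec: "continuous_on {0..a} (\<lambda>t. ?E t \<omega>)" if "\<omega> \<in> space M" for \<omega>
    by (intro continuous_on_exp continuous_on_minus continuous_on_mult_left Sc that)
  have LE: "expectation (\<lambda>\<omega>. LBINT t:{0..a}. ?E t \<omega>) = (LBINT t:{0..a}. expectation (?E t))"
    "set_integrable lborel {0..a} (\<lambda>t. expectation (?E t))"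
    using EL Ec a by auto
  have J: "a * exp (- (s / a * ?I \<omega>)) \<le> (LBINT t:{0..a}. ?E t \<omega>)" if \<omega>: "\<omega> \<in> space M" for \<omega>
  proof -
    have "a * exp (- ((LBINT t:{0..a}. s * ?S t \<omega>) / a)) \<le> (LBINT t:{0..a}. ?E t \<omega>)"
      by (rule jensen_LBINT[where g="\<lambda>x. exp (- x)", OF a _ _ refl exp_tangent])
        (intro continuous_on_mult_left Sc[OF \<omega>] Ec[OF \<omega>])+
    then show ?thesis by simp
  qed
  have LEb: "integrable M (\<lambda>\<omega>. LBINT t:{0..a}. ?E t \<omega>)"
  proof (rule integrable_bounded)
    show "(\<lambda>\<omega>. LBINT t:{0..a}. ?E t \<omega>) \<in> borel_measurable M"
      by (rule borel_measurable_LBINT_paths(2)[OF em[OF Sm] Ec]) (use a in auto)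
    show "\<bar>LBINT t:{0..a}. ?E t \<omega>\<bar> \<le> a" if \<omega>: "\<omega> \<in> space M" for \<omega>
    proof -
      have "(LBINT t:{0..a}. ?E t \<omega>) \<le> (LBINT t:{0..a}. t ^ 0)"
        by (rule set_integral_mono_continuous)
          (use E1 in \<open>auto intro!: borel_integrable_atLeastAtMost' Ec[OF \<omega>]\<close>)
      moreover have "0 \<le> (LBINT t:{0..a}. ?E t \<omega>)"
        unfolding set_lebesgue_integral_def by (intro Bochner_Integration.integral_nonneg) auto
      ultimately show ?thesis using LBINT_power[of a 0] a by simp
    qed
  qed
  have "expectation (\<lambda>\<omega>. a * exp (- (s / a * ?I \<omega>))) \<le> expectation (\<lambda>\<omega>. LBINT t:{0..a}. ?E t \<omega>)"
  proof (rule integral_mono[OF _ LEb J])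
    have "0 \<le> ?I \<omega>" for \<omega>
      unfolding set_lebesgue_integral_def using S0 by (intro Bochner_Integration.integral_nonneg) auto
    then have "0 \<le> s / a * ?I \<omega>" for \<omega> using s a by (intro mult_nonneg_nonneg) auto
    then have "integrable M (\<lambda>\<omega>. exp (- (s / a * ?I \<omega>)))"
      by (intro integrable_bounded[of _ 1] em Im) auto
    then show "integrable M (\<lambda>\<omega>. a * exp (- (s / a * ?I \<omega>)))" by (rule integrable_mult_right)
  qed
  also have "\<dots> \<le> (LBINT t:{0..a}. t ^ 0 * \<rho> ^ N)"
    unfolding LE(1)
  proof (rule set_integral_mono_continuous[OF LE(2)])
    show "set_integrable lborel {0..a} (\<lambda>t. t ^ 0 * \<rho> ^ N)"
      by (intro borel_integrable_atLeastAtMost' continuous_intros)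
    show "expectation (?E t) \<le> t ^ 0 * \<rho> ^ N" if "t \<in> {0..a}" for t
      using laplace_sum_tri[OF H s, of t N] that a by simp
  qed
  also have "\<dots> = a * \<rho> ^ N"
    unfolding set_integral_mult_left using LBINT_power[of a 0] a by simp
  finally show "expectation (\<lambda>\<omega>. exp (- (s / a * ?I \<omega>))) \<le> \<rho> ^ N" using a by simp
qed

end

section \<open>Tiling the time interval by blocks of three pieces\<close>

lemma integral_blocks:
  fixes g :: "real \<Rightarrow> real"
  assumes g: "continuous_on {0..} g" and a: "0 \<le> a"
  shows "integral {0..real n * a} g = (\<Sum>j<n. integral {0..a} (\<lambda>t. g (t + real j * a)))"
proof (induction n)
  case (Suc n)
  have "integral {0..real n * a} g + integral {real n * a..real (Suc n) * a} g = integral {0..real (Suc n) * a} g"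
    using a by (intro Henstock_Kurzweil_Integration.integral_combine integrable_continuous_real
        continuous_on_subset[OF g]) (auto simp: mult_right_mono)
  moreover have "integral {real n * a..real (Suc n) * a} g = integral {0..a} (\<lambda>t. g (t + real n * a))"
    using integral_shift_Icc_real[of 0 a g "real n * a"] by (simp add: o_def algebra_simps)
  ultimately show ?case using Suc by simp
qed simp

text \<open>Each block of length \<open>3 * a\<close> is folded onto \<open>{0..a}\<close>: the
  integrand at \<open>t\<close>, \<open>t + a\<close> and \<open>t + 2 * a\<close> supplies the
  three values to which \<open>triangle_form_quadratic\<close> applies. The right-hand constant
  \<open>c\<close> cancels in the differences, so the left-hand side is free of it.\<close>

lemma energy_lower_bound:
  assumes b: "continuous_on {0..} b" and a: "0 \<le> a" and T: "T = real N * (3 * a)"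
  shows "(cmod \<eta>)\<^sup>2 / 4 * (LBINT t:{0..a}. \<Sum>k<N. triangle_form a (\<lambda>r. b (t + real k * (3 * a) + r)))
    \<le> (LBINT t:{0..T}. (c + Re (\<eta> * Zint b t))\<^sup>2)"
proof -
  define g where "g t = (c + Re (\<eta> * Zint b t))\<^sup>2" for t
  have gT: "continuous_on {0..T} g" for T
    unfolding g_def by (intro continuous_intros continuous_on_Zint b)
  have g: "continuous_on {0..} g"
    unfolding continuous_on_eq_continuous_within
  proof
    fix t :: real assume t: "t \<in> {0..}"
    \<comment> \<open>Continuity on the half-line is local: near \<open>t\<close> it is continuity
      on a compact interval that reaches beyond \<open>t\<close>.\<close>
    have eq: "at t within {0..t+1} = at t within {0..}"
      by (rule at_within_nhd[of t "{..<t+1}"]) auto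
    have "continuous (at t within {0..t+1}) g"
      using gT[of "t + 1"] t by (auto simp: continuous_on_eq_continuous_within)
    then show "continuous (at t within {0..}) g" unfolding eq .
  qed
  have gs: "continuous_on {0..} (\<lambda>t. g (t + d))" if "0 \<le> d" for d
    using that by (intro continuous_on_compose2[OF g] continuous_intros) auto
  have gsa: "continuous_on {0..a} (\<lambda>t. g (t + d))" if "0 \<le> d" for d
    by (rule continuous_on_subset[OF gs[OF that]]) auto
  have "(LBINT t:{0..T}. g t) = integral {0..T} g" by (rule LBINT_eq_integral[OF gT])
  also have "\<dots> = (\<Sum>k<N. integral {0..3 * a} (\<lambda>t. g (t + real k * (3 * a))))"
    unfolding T using integral_blocks[OF g, of "3 * a" N] a by simp
  also have "\<dots> = (\<Sum>k<N. \<Sum>j<3. integral {0..a} (\<lambda>t. g (t + real j * a + real k * (3 * a))))"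
    using integral_blocks[OF gs a, of "real _ * (3 * a)" 3] a by simp
  also have "\<dots> = (\<Sum>k<N. integral {0..a} (\<lambda>t. g (t + real k * (3 * a)) + g (t + (a + real k * (3 * a))) + g (t + (2 * a + real k * (3 * a)))))"
  proof (rule sum.cong[OF refl])
    fix k
    have "integral {0..a} (\<lambda>t. g (t + real k * (3 * a)) + g (t + (a + real k * (3 * a))) + g (t + (2 * a + real k * (3 * a)))) =
      integral {0..a} (\<lambda>t. g (t + real k * (3 * a))) + integral {0..a} (\<lambda>t. g (t + (a + real k * (3 * a)))) + integral {0..a} (\<lambda>t. g (t + (2 * a + real k * (3 * a))))"
      using a by (subst Henstock_Kurzweil_Integration.integral_add;
        (intro integrable_continuous_real continuous_intros gsa; simp)?)+ simp
    then show "(\<Sum>j<3. integral {0..a} (\<lambda>t. g (t + real j * a + real k * (3 * a)))) = integral {0..a} (\<lambda>t. g (t + real k * (3 * a)) + g (t + (a + real k * (3 * a))) + g (t + (2 * a + real k * (3 * a))))"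
      by (simp add: eval_nat_numeral add.assoc algebra_simps)
  qed
  also have "\<dots> \<ge> (\<Sum>k<N. integral {0..a} (\<lambda>t. (cmod \<eta>)\<^sup>2 / 4 * triangle_form a (\<lambda>r. b (t + real k * (3 * a) + r))))"
  proof (intro sum_mono integral_le integrable_continuous_real continuous_intros gsa continuous_on_tri b)
    fix k t assume t: "t \<in> {0..a}"
    let ?\<tau> = "t + real k * (3 * a)"
    have \<tau>: "0 \<le> ?\<tau>" using t a by simp
    let ?u = "Zint (\<lambda>r. b (?\<tau> + r)) a" and ?v = "Zint (\<lambda>r. b (?\<tau> + r)) (2 * a) - Zint (\<lambda>r. b (?\<tau> + r)) a"
    have u: "?u = Zint b (?\<tau> + a) - Zint b ?\<tau>" and v: "?v = Zint b (?\<tau> + 2 * a) - Zint b (?\<tau> + a)"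
      using Zint_shifted[OF b \<tau>] a by auto
    have 1: "(c + Re (\<eta> * Zint b (?\<tau> + a))) - (c + Re (\<eta> * Zint b ?\<tau>)) = Re (\<eta> * ?u)"
      unfolding u by (simp add: algebra_simps)
    have 2: "(c + Re (\<eta> * Zint b (?\<tau> + 2 * a))) - (c + Re (\<eta> * Zint b (?\<tau> + a))) = Re (\<eta> * ?v)"
      unfolding v by (simp add: algebra_simps)
    have "(cmod \<eta>)\<^sup>2 / 4 * triangle_form a (\<lambda>r. b (?\<tau> + r)) \<le> g ?\<tau> + g (?\<tau> + a) + g (?\<tau> + 2 * a)"
      unfolding triangle_form_def g_def by (rule triangle_form_quadratic[OF 1 2])
    then show "(cmod \<eta>)\<^sup>2 / 4 * triangle_form a (\<lambda>r. b (?\<tau> + r)) \<le> g (t + real k * (3 * a)) + g (t + (a + real k * (3 * a))) + g (t + (2 * a + real k * (3 * a)))"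
      by (simp add: algebra_simps)
  qed (use a in auto)
  also have "(\<Sum>k<N. integral {0..a} (\<lambda>t. (cmod \<eta>)\<^sup>2 / 4 * triangle_form a (\<lambda>r. b (t + real k * (3 * a) + r)))) =
      (cmod \<eta>)\<^sup>2 / 4 * (\<Sum>k<N. integral {0..a} (\<lambda>t. triangle_form a (\<lambda>r. b (t + real k * (3 * a) + r))))"
    by (simp add: sum_distrib_left)
  also have "(\<Sum>k<N. integral {0..a} (\<lambda>t. triangle_form a (\<lambda>r. b (t + real k * (3 * a) + r)))) =
      integral {0..a} (\<lambda>t. \<Sum>k<N. triangle_form a (\<lambda>r. b (t + real k * (3 * a) + r)))"
    using a by (intro Henstock_Kurzweil_Integration.integral_sum[symmetric] integrable_continuous_real continuous_on_tri b) auto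
  also have "\<dots> = (LBINT t:{0..a}. \<Sum>k<N. triangle_form a (\<lambda>r. b (t + real k * (3 * a) + r)))"
    using a by (intro LBINT_eq_integral[symmetric] continuous_intros continuous_on_tri b) auto
  finally show ?thesis unfolding g_def .
qed

section \<open>The Gram matrix as a quadratic form\<close>

text \<open>The quadratic form of \<open>Cmat\<close> in complex notation: a vector \<open>y\<close>
  corresponds to \<open>c = y $ 1\<close> and \<open>\<eta> = Complex (- y $ 3) (- y $ 2)\<close>,
  as \<open>inner_Cmat\<close> states. One complex parameter matches the rotation symmetry of
  \<open>Zint\<close>.\<close>

definition energy :: "(real \<Rightarrow> real) \<Rightarrow> real \<Rightarrow> real \<Rightarrow> complex \<Rightarrow> real" where
  "energy b T c \<eta> = (LBINT t:{0..T}. (c + Re (\<eta> * Zint b t))\<^sup>2)"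

lemma energy_nonneg: "0 \<le> energy b T c \<eta>"
  unfolding energy_def set_lebesgue_integral_def
  by (intro Bochner_Integration.integral_nonneg) auto

lemma Re_Im_Zint:
  assumes b: "continuous_on {0..} b"
  shows "Re (Zint b t) = (LBINT s:{0..t}. cos (b s))" "Im (Zint b t) = (LBINT s:{0..t}. sin (b s))"
proof -
  have "set_integrable lborel {0..t} (\<lambda>s. cis (b s))"
    by (intro borel_integrable_atLeastAtMost' continuous_on_cis_path continuous_on_subset[OF b]) auto
  then have i: "integrable lborel (\<lambda>s. indicator {0..t} s *\<^sub>R cis (b s))"
    unfolding set_integrable_def .
  show "Re (Zint b t) = (LBINT s:{0..t}. cos (b s))" "Im (Zint b t) = (LBINT s:{0..t}. sin (b s))"
    unfolding Zint_def set_lebesgue_integral_def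
    using integral_Re[OF i] integral_Im[OF i] by simp_all
qed

lemma hvec_Zint:
  assumes b: "continuous_on {0..} b"
  shows "hvec b t $ 1 = 1" "hvec b t $ 2 = Im (Zint b t)" "hvec b t $ 3 = - Re (Zint b t)"
  unfolding Re_Im_Zint[OF b] by (simp_all add: hvec_def)

lemma inner_Cmat:
  assumes b: "continuous_on {0..} b"
  shows "y \<bullet> (Cmat b T *v y) = energy b T (y $ 1) (Complex (- y $ 3) (- y $ 2))"
proof -
  have h: "continuous_on {0..T} (\<lambda>t. hvec b t $ i)" for i by (rule continuous_on_hvec[OF b])
  have ha: "continuous_on {0..T} (a_adj b y)" unfolding a_adj_def by (intro continuous_intros h)
  have a: "a_adj b y t = y $ 1 + Re (Complex (- y $ 3) (- y $ 2) * Zint b t)" for t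
    by (simp add: a_adj_def sum_3 hvec_Zint[OF b])
  have "y \<bullet> (Cmat b T *v y) = (\<Sum>i\<in>UNIV. y $ i * (LBINT t:{0..T}. hvec b t $ i * a_adj b y t))"
    unfolding a_op_a_adj[OF b, symmetric] a_op_def ip_def inner_vec_def by simp
  also have "\<dots> = (\<Sum>i\<in>UNIV. LBINT t:{0..T}. y $ i * (hvec b t $ i * a_adj b y t))"
    by simp
  also have "\<dots> = (LBINT t:{0..T}. \<Sum>i\<in>UNIV. y $ i * (hvec b t $ i * a_adj b y t))"
    unfolding set_lebesgue_integral_def scaleR_sum_right
    by (intro Bochner_Integration.integral_sum[symmetric])
      (use borel_integrable_atLeastAtMost'[OF continuous_on_mult_left[OF continuous_on_mult[OF h ha]]] in
        \<open>auto simp: set_integrable_def\<close>)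
  also have "\<dots> = (LBINT t:{0..T}. (a_adj b y t)\<^sup>2)"
  proof -
    have "(\<Sum>i\<in>UNIV. y $ i * (hvec b t $ i * a_adj b y t)) = (a_adj b y t)\<^sup>2" for t
    proof -
      have "(\<Sum>i\<in>UNIV. y $ i * (hvec b t $ i * A)) = (\<Sum>i\<in>UNIV. y $ i * hvec b t $ i) * A" for A
        by (simp add: sum_distrib_right mult.assoc)
      then show ?thesis by (simp add: a_adj_def power2_eq_square)
    qed
    then show ?thesis by simp
  qed
  finally show ?thesis unfolding energy_def a .
qed

section \<open>Solving the Gram system in rescaled units\<close>

definition Zint_mass :: "(real \<Rightarrow> real) \<Rightarrow> real \<Rightarrow> real" where
  "Zint_mass b T = (LBINT t:{0..T}. (cmod (Zint b t))\<^sup>2)"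

lemma LBINT_nonneg: "(\<And>t. 0 \<le> f t) \<Longrightarrow> 0 \<le> (LBINT t:{a..b}. (f t :: real))"
  unfolding set_lebesgue_integral_def by (intro Bochner_Integration.integral_nonneg) auto

lemma LBINT_const: "0 \<le> T \<Longrightarrow> (LBINT t:{0..T}. c) = T * (c::real)"
  by (subst LBINT_eq_integral) auto

text \<open>The triangles control only \<open>\<eta>\<close>. The constant \<open>c\<close> is
  recovered from \<open>c\<^sup>2 \<le> 2 * (c + x)\<^sup>2 + 2 * x\<^sup>2\<close> with
  \<open>x = Re (\<eta> * Zint b t)\<close>, at the price of the mass of Z.\<close>

lemma energy_first_coordinate:
  assumes b: "continuous_on {0..} b" and T: "0 \<le> T"
  shows "c\<^sup>2 * T \<le> 2 * energy b T c \<eta> + 2 * (cmod \<eta>)\<^sup>2 * Zint_mass b T"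
proof -
  have Z: "continuous_on {0..T} (Zint b)" by (rule continuous_on_Zint[OF b])
  have "(LBINT t:{0..T}. c\<^sup>2) \<le> (LBINT t:{0..T}. 2 * (c + Re (\<eta> * Zint b t))\<^sup>2 + 2 * (cmod \<eta>)\<^sup>2 * (cmod (Zint b t))\<^sup>2)"
  proof (rule set_integral_mono_continuous; (intro borel_integrable_atLeastAtMost' continuous_intros Z)?)
    fix t
    let ?x = "Re (\<eta> * Zint b t)"
    have "\<bar>?x\<bar>\<^sup>2 \<le> (cmod \<eta> * cmod (Zint b t))\<^sup>2"
      using abs_Re_le_cmod[of "\<eta> * Zint b t"] unfolding norm_mult by (rule power_mono) simp
    then have "?x\<^sup>2 \<le> (cmod \<eta>)\<^sup>2 * (cmod (Zint b t))\<^sup>2" by (simp only: power2_abs power_mult_distrib)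
    moreover have sq: "c\<^sup>2 \<le> 2 * (c + x)\<^sup>2 + 2 * x\<^sup>2" for x :: real
      using zero_le_power2[of "c + 2 * x"] by (simp add: power2_eq_square algebra_simps)
    moreover have "2 * (cmod \<eta>)\<^sup>2 * (cmod (Zint b t))\<^sup>2 = 2 * ((cmod \<eta>)\<^sup>2 * (cmod (Zint b t))\<^sup>2)"
      by (rule mult.assoc)
    ultimately show "c\<^sup>2 \<le> 2 * (c + ?x)\<^sup>2 + 2 * (cmod \<eta>)\<^sup>2 * (cmod (Zint b t))\<^sup>2"
      using sq[of ?x] by linarith
  qed
  also have "\<dots> = (LBINT t:{0..T}. 2 * (c + Re (\<eta> * Zint b t))\<^sup>2) + (LBINT t:{0..T}. 2 * (cmod \<eta>)\<^sup>2 * (cmod (Zint b t))\<^sup>2)"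
    by (intro set_integral_add(2) borel_integrable_atLeastAtMost' continuous_intros Z)
  finally show ?thesis using T by (simp add: LBINT_const energy_def Zint_mass_def mult_ac)
qed

text \<open>In units in which the Gram matrix is diffusively rescaled, \<open>r\<close> bounds its inverse and \<open>p\<close> is the size
  of the path.\<close>

lemma solution_bound:
  fixes y w :: "real^3"
  assumes b: "continuous_on {0..} b" and T: "0 < T" and \<tau>: "\<tau> = sqrt T"
    and r: "0 \<le> r" "\<And>c \<eta>. (cmod \<eta>)\<^sup>2 * T\<^sup>2 \<le> r\<^sup>2 * energy b T c \<eta>"
    and p: "p = sqrt (Zint_mass b T) / T" and S: "S = 2 * (1 + r + r * p)"
    and y: "Cmat b T *v y = w"
    and v: "\<bar>w $ 1\<bar> \<le> v1" "\<bar>w $ 2\<bar> \<le> v2" "\<bar>w $ 3\<bar> \<le> v2"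
  shows "\<bar>y $ 1\<bar> \<le> 2 * S\<^sup>2 * (v1 + v2 / \<tau>) / \<tau>\<^sup>2" "\<bar>y $ 2\<bar> \<le> 2 * S\<^sup>2 * (v1 + v2 / \<tau>) / \<tau> ^ 3"
    "\<bar>y $ 3\<bar> \<le> 2 * S\<^sup>2 * (v1 + v2 / \<tau>) / \<tau> ^ 3"
proof -
  define \<eta> where "\<eta> = Complex (- y $ 3) (- y $ 2)"
  define E where "E = energy b T (y $ 1) \<eta>"
  define e where "e = sqrt E"
  have E0: "0 \<le> E" unfolding E_def by (rule energy_nonneg)
  have e: "0 \<le> e" "e\<^sup>2 = E" using E0 by (auto simp: e_def)
  have \<tau>0: "0 < \<tau>" "\<tau>\<^sup>2 = T" using T \<tau> by auto
  have m0: "0 \<le> Zint_mass b T" unfolding Zint_mass_def by (intro LBINT_nonneg) auto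
  have p0: "0 \<le> p" unfolding p using m0 T by simp
  have pT: "Zint_mass b T = (p * T)\<^sup>2" using m0 T by (simp add: p)
  \<comment> \<open>\<open>S\<close> is made to serve all coordinates: it dominates
    \<open>r\<close>, needed for \<open>\<eta>\<close>, and \<open>2 * (1 + r * p)\<close>, needed
    for the first coordinate.\<close>
  have S1: "1 \<le> S" "r \<le> S" unfolding S using r(1) p0 by (auto simp: add_increasing2)
  have v0: "0 \<le> v1" "0 \<le> v2" using v by linarith+
  have eta: "cmod \<eta> \<le> r * e / T"
  proof -
    have "(cmod \<eta> * T)\<^sup>2 \<le> (r * e)\<^sup>2"
      using r(2)[of \<eta> "y $ 1"] by (simp add: power_mult_distrib e E_def)
    then have "cmod \<eta> * T \<le> r * e" by (rule power2_le_imp_le) (use r(1) e(1) in simp)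
    then show ?thesis using T by (simp add: field_simps)
  qed
  have y23: "\<bar>y $ 2\<bar> \<le> cmod \<eta>" "\<bar>y $ 3\<bar> \<le> cmod \<eta>"
    using abs_Im_le_cmod[of \<eta>] abs_Re_le_cmod[of \<eta>] by (auto simp: \<eta>_def)
  have y1: "\<bar>y $ 1\<bar> \<le> S * e / \<tau>"
  proof -
    have "(y $ 1 * \<tau>)\<^sup>2 \<le> 2 * e\<^sup>2 + 2 * (cmod \<eta> * (p * T))\<^sup>2"
      using energy_first_coordinate[OF b, of T "y $ 1" \<eta>] T
      unfolding E_def[symmetric] pT by (simp add: power_mult_distrib e \<tau>0 mult_ac)
    also have "cmod \<eta> * (p * T) \<le> r * e / T * (p * T)"
      using eta p0 T by (intro mult_right_mono) auto
    then have "cmod \<eta> * (p * T) \<le> r * p * e" using T by (simp add: mult_ac)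
    then have "2 * e\<^sup>2 + 2 * (cmod \<eta> * (p * T))\<^sup>2 \<le> 2 * e\<^sup>2 + 2 * (r * p * e)\<^sup>2"
      using p0 T by (intro add_left_mono mult_left_mono power_mono) auto
    also have "\<dots> \<le> (2 * (1 + r * p) * e)\<^sup>2"
    proof -
      have "2 + 2 * x\<^sup>2 \<le> (2 * (1 + x))\<^sup>2" if "0 \<le> x" for x :: real
        using that by (simp add: power2_eq_square algebra_simps)
      from mult_right_mono[OF this[of "r * p"], of "e\<^sup>2"] r(1) p0
      have "(2 + 2 * (r * p)\<^sup>2) * e\<^sup>2 \<le> (2 * (1 + r * p))\<^sup>2 * e\<^sup>2" by simp
      moreover have "(2 + 2 * (r * p)\<^sup>2) * e\<^sup>2 = 2 * e\<^sup>2 + 2 * (r * p * e)\<^sup>2"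
        by (simp add: power_mult_distrib distrib_right)
      ultimately show ?thesis by (simp only: power_mult_distrib[of "2 * (1 + r * p)" e])
    qed
    also have "\<dots> \<le> (S * e)\<^sup>2"
      using r(1) p0 e(1) unfolding S by (intro power_mono mult_right_mono) auto
    finally have "\<bar>y $ 1 * \<tau>\<bar> \<le> S * e"
      using S1 e by (simp add: abs_le_square_iff[symmetric])
    then show ?thesis using \<tau>0 by (simp add: abs_mult field_simps)
  qed
  have eta': "cmod \<eta> \<le> S * e / \<tau>\<^sup>2"
    using eta S1 e T unfolding \<tau>0(2) by (meson divide_right_mono less_imp_le mult_right_mono order_trans)
  \<comment> \<open>The equation is tested with its own solution. Since the coordinates of
    \<open>y\<close> are bounded by multiples of \<open>e\<close>, one factor \<open>e\<close>
    cancels. \<open>S\<close> ends up squared: one factor bounds \<open>e\<close>, the other leads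
    back from \<open>e\<close> to \<open>y\<close>.\<close>
  have "e * e = y \<bullet> w"
    using inner_Cmat[OF b, of y T] unfolding y \<eta>_def[symmetric] E_def[symmetric] by (simp add: e power2_eq_square[symmetric])
  also have "\<dots> \<le> \<bar>y $ 1\<bar> * \<bar>w $ 1\<bar> + \<bar>y $ 2\<bar> * \<bar>w $ 2\<bar> + \<bar>y $ 3\<bar> * \<bar>w $ 3\<bar>"
    unfolding inner_vec_def sum_3 abs_mult[symmetric] by (simp add: add_mono)
  also have "\<dots> \<le> (S * e / \<tau>) * v1 + (S * e / \<tau>\<^sup>2) * v2 + (S * e / \<tau>\<^sup>2) * v2"
    using y1 y23 eta' v S1 e by (intro add_mono mult_mono) auto
  also have "\<dots> \<le> e * (2 * S * (v1 + v2 / \<tau>) / \<tau>)"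
    using S1 e v0 \<tau>0(1) by (simp add: field_simps power2_eq_square)
  finally have ee: "e * e \<le> e * (2 * S * (v1 + v2 / \<tau>) / \<tau>)" .
  have e_le: "e \<le> 2 * S * (v1 + v2 / \<tau>) / \<tau>"
  proof (cases "e = 0")
    case True
    then show ?thesis using v0 S1(1) \<tau>0(1)
      by (auto intro!: divide_nonneg_pos mult_nonneg_nonneg add_nonneg_nonneg)
  next
    case False
    then show ?thesis using ee e(1) mult_left_le_imp_le[OF ee] by simp
  qed
  have "S * e \<le> S * (2 * S * (v1 + v2 / \<tau>) / \<tau>)" using S1 e_le by (intro mult_left_mono) auto
  then have Se: "S * e \<le> 2 * S\<^sup>2 * (v1 + v2 / \<tau>) / \<tau>" by (simp add: power2_eq_square mult_ac)
  have "S * e / \<tau> \<le> 2 * S\<^sup>2 * (v1 + v2 / \<tau>) / \<tau> / \<tau>" using Se \<tau>0 by (intro divide_right_mono) auto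
  then show "\<bar>y $ 1\<bar> \<le> 2 * S\<^sup>2 * (v1 + v2 / \<tau>) / \<tau>\<^sup>2" using y1 by (simp add: power2_eq_square)
  have "S * e / \<tau>\<^sup>2 \<le> 2 * S\<^sup>2 * (v1 + v2 / \<tau>) / \<tau> / \<tau>\<^sup>2" using Se \<tau>0 by (intro divide_right_mono) auto
  then have "cmod \<eta> \<le> 2 * S\<^sup>2 * (v1 + v2 / \<tau>) / \<tau> ^ 3"
    using eta' by (simp add: power2_eq_square power3_eq_cube mult.assoc)
  then show "\<bar>y $ 2\<bar> \<le> 2 * S\<^sup>2 * (v1 + v2 / \<tau>) / \<tau> ^ 3" "\<bar>y $ 3\<bar> \<le> 2 * S\<^sup>2 * (v1 + v2 / \<tau>) / \<tau> ^ 3"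
    using y23 by auto
qed

text \<open>A kernel vector has zero energy; the hypothesis then gives \<open>\<eta> = 0\<close>,
  and \<open>energy_first_coordinate\<close> with \<open>\<eta> = 0\<close> removes the first
  coordinate.\<close>

lemma invertible_Cmat:
  assumes b: "continuous_on {0..} b" and T: "0 < T"
    and r: "\<And>c \<eta>. (cmod \<eta>)\<^sup>2 * T\<^sup>2 \<le> r\<^sup>2 * energy b T c \<eta>"
  shows "invertible (Cmat b T)"
proof -
  have "y = 0" if y: "Cmat b T *v y = 0" for y
  proof -
    let ?\<eta> = "Complex (- y $ 3) (- y $ 2)"
    have E: "energy b T (y $ 1) ?\<eta> = 0" using inner_Cmat[OF b, of y T] y by simp
    then have "(cmod ?\<eta>)\<^sup>2 * T\<^sup>2 \<le> 0" using r[of ?\<eta> "y $ 1"] by simp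
    then have "?\<eta> = 0" using T by (simp add: mult_le_0_iff power2_eq_square[symmetric])
    moreover have "(y $ 1)\<^sup>2 * T \<le> 0"
      using energy_first_coordinate[OF b, of T "y $ 1" ?\<eta>] T E \<open>?\<eta> = 0\<close> by simp
    then have "y $ 1 = 0" using T by (simp add: mult_le_0_iff)
    ultimately show ?thesis by (simp add: vec_eq_iff forall_3 complex_eq_iff)
  qed
  then show ?thesis unfolding invertible_left_inverse matrix_left_invertible_ker by blast
qed

section \<open>Inverse moments\<close>

lemma summable_power_geometric:
  fixes \<rho> :: real
  assumes "0 \<le> \<rho>" "\<rho> < 1"
  shows "summable (\<lambda>n. real (Suc n) ^ k * \<rho> ^ Suc n)"
proof -
  define c where "c = (1 + \<rho>) / 2"
  have c: "\<rho> < c" "c < 1" using assms by (auto simp: c_def)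
  have "(\<lambda>n. (1 + inverse (real (Suc n))) ^ k * \<rho>) \<longlonglongrightarrow> (1 + 0) ^ k * \<rho>"
    by (intro tendsto_intros LIMSEQ_inverse_real_of_nat)
  then have "\<forall>\<^sub>F n in sequentially. (1 + inverse (real (Suc n))) ^ k * \<rho> < c"
    using c by (intro order_tendstoD) auto
  then obtain N where N: "\<And>n. n \<ge> N \<Longrightarrow> (1 + inverse (real (Suc n))) ^ k * \<rho> < c"
    by (auto simp: eventually_sequentially)
  show ?thesis
  proof (rule summable_ratio_test[OF c(2)])
    fix n assume n: "n \<ge> N"
    have "real (Suc (Suc n)) = real (Suc n) * (1 + inverse (real (Suc n)))"
      by (simp add: field_simps)
    then have "real (Suc (Suc n)) ^ k * \<rho> ^ Suc (Suc n) =
        ((1 + inverse (real (Suc n))) ^ k * \<rho>) * (real (Suc n) ^ k * \<rho> ^ Suc n)"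
      by (simp only: power_mult_distrib) (simp add: mult_ac)
    also have "\<dots> \<le> c * (real (Suc n) ^ k * \<rho> ^ Suc n)"
      using N[OF n] assms by (intro mult_right_mono) auto
    finally show "norm (real (Suc (Suc n)) ^ k * \<rho> ^ Suc (Suc n)) \<le> c * norm (real (Suc n) ^ k * \<rho> ^ Suc n)"
      using assms by (simp add: abs_mult power_abs)
  qed
qed

text \<open>\<open>Suc n\<close> is the fourth root of \<open>1 / x\<close> rounded up. The root is
  at least 1, so rounding at most doubles it, and 16 = 2^4.\<close>

lemma ex_fourth_power_between:
  assumes "0 < x" "x \<le> (1::real)"
  shows "\<exists>n. 1 \<le> real (Suc n) ^ 4 * x \<and> real (Suc n) ^ 4 * x \<le> 16"
proof -
  define y where "y = root 4 (1 / x)"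
  have y: "1 \<le> y" using assms by (simp add: y_def)
  have y4: "y ^ 4 * x = 1" using assms by (simp add: y_def real_root_pow_pos)
  define n where "n = nat \<lceil>y\<rceil> - 1"
  have n: "y \<le> real (Suc n)" "real (Suc n) \<le> y + 1" using y unfolding n_def by linarith+
  have "y ^ 4 * x \<le> real (Suc n) ^ 4 * x" using n y assms by (intro mult_right_mono power_mono) auto
  moreover have "real (Suc n) ^ 4 * x \<le> (2 * y) ^ 4 * x" using n y assms by (intro mult_right_mono power_mono) auto
  moreover have "(2 * y) ^ 4 * x = 16 * (y ^ 4 * x)" by (simp add: power_mult_distrib)
  ultimately show ?thesis using y4 by (intro exI[of _ n]) auto
qed

text \<open>The proof uses \<open>x\<^sup>-\<^sup>m \<le> 1 + e\<^sup>1\<^sup>6\<^sup>K \<Sum>\<^sub>N N\<^sup>4\<^sup>m exp (- K N\<^sup>4 x)\<close>, where the term with \<open>1 \<le> N\<^sup>4 x \<le> 16\<close> suffices when \<open>x < 1\<close>.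
  The right-hand side, taken at lower bounds of the eigenvalue \<open>x\<close>, is \<open>W\<close>; it stands in for the inverse eigenvalue, whose measurability is then not needed.\<close>

lemma inverse_moment:
  assumes m: "1 \<le> m"
  shows "\<exists>C. \<forall>(M :: 'a measure) B T. standard_brownian_motion M B \<longrightarrow> 1 \<le> T \<longrightarrow>
    (\<exists>W. integrable M W \<and> (\<integral>\<omega>. W \<omega> \<partial>M) \<le> C \<and> (\<forall>\<omega>. 0 \<le> W \<omega>) \<and>
      (AE \<omega> in M. \<forall>c \<eta>. \<eta> \<noteq> 0 \<longrightarrow>
        1 \<le> W \<omega> * (energy (\<lambda>s. B s \<omega>) T c \<eta> / ((cmod \<eta>)\<^sup>2 * T\<^sup>2)) ^ m))"
proof -
  obtain \<sigma> \<rho>0 where \<sigma>: "0 < \<sigma>" and "\<rho>0 < 1" and H0: "\<And>(M :: 'a measure) B a.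
      standard_brownian_motion M B \<Longrightarrow> 0 < a \<Longrightarrow>
      (\<integral>\<omega>. exp (- (\<sigma> / wedge_scale a * triangle_form a (\<lambda>s. B s \<omega>))) \<partial>M) \<le> \<rho>0"
    using triangle_form_laplace by blast
  define \<rho> where "\<rho> = max \<rho>0 0"
  have \<rho>: "0 \<le> \<rho>" "\<rho> < 1" "\<rho>0 \<le> \<rho>" using \<open>\<rho>0 < 1\<close> by (auto simp: \<rho>_def)
  \<comment> \<open>324 = 4 * 81: the factor 81 comes from \<open>(3 * real (Suc n)) ^ 4\<close> in
    \<open>a n ^ 4\<close>, the factor 4 from the quarter in
    \<open>energy_lower_bound\<close>.\<close>
  define K where "K = 324 * \<sigma>"
  have K: "0 < K" using \<sigma> by (simp add: K_def)
  define C1 where "C1 = (\<Sum>n. real (Suc n) ^ (4 * m) * \<rho> ^ Suc n)"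
  have sumC1: "summable (\<lambda>n. real (Suc n) ^ (4 * m) * \<rho> ^ Suc n)"
    by (rule summable_power_geometric[OF \<rho>(1,2)])
  define C where "C = 1 + exp (16 * K) * C1"
  have "\<exists>W. integrable M W \<and> (\<integral>\<omega>. W \<omega> \<partial>M) \<le> C \<and> (\<forall>\<omega>. 0 \<le> W \<omega>) \<and>
      (AE \<omega> in M. \<forall>c \<eta>. \<eta> \<noteq> 0 \<longrightarrow>
        1 \<le> W \<omega> * (energy (\<lambda>s. B s \<omega>) T c \<eta> / ((cmod \<eta>)\<^sup>2 * T\<^sup>2)) ^ m)"
    if "standard_brownian_motion M B" and T: "1 \<le> T" for M :: "'a measure" and B T
  proof -
    interpret standard_brownian_motion M B by fact
    define a where "a n = T / (3 * real (Suc n))" for n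
    have a: "0 < a n" for n using T by (simp add: a_def)
    have aT: "T = real (Suc n) * (3 * a n)" for n by (simp add: a_def del: of_nat_Suc)
    define I where "I n \<omega> = (LBINT t:{0..a n}. \<Sum>k<Suc n. triangle_form (a n) (\<lambda>r. B (t + real k * (3 * a n) + r) \<omega>))" for n \<omega>
    have I0: "0 \<le> I n \<omega>" for n \<omega>
      unfolding I_def set_lebesgue_integral_def
      by (intro Bochner_Integration.integral_nonneg scaleR_nonneg_nonneg sum_nonneg triangle_form_nonneg) auto
    \<comment> \<open>A lower bound for the normalised energy that contains neither \<open>c\<close>
      nor \<open>\<eta>\<close>, so that one \<open>W\<close> and one null set serve all of
      them.\<close>
    define q where "q n \<omega> = I n \<omega> / (4 * T\<^sup>2)" for n \<omega>
    define g where "g n \<omega> = real (Suc n) ^ (4 * m) * exp (- (K * real (Suc n) ^ 4 * q n \<omega>))" for n \<omega>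
    have H: "expectation (\<lambda>\<omega>. exp (- (\<sigma> / wedge_scale (a n) * triangle_form (a n) (\<lambda>r. B (\<tau> + r) \<omega>)))) \<le> \<rho>" if "0 \<le> \<tau>" for \<tau> n
      using H0[OF shifted_brownian_motion[OF that] a[of n]] \<rho>(3) by (simp add: triangle_form_minus_const)
    have s0: "0 \<le> \<sigma> / wedge_scale (a n)" for n using \<sigma> wedge_scale_pos[OF a[of n]] by simp
    note LI = laplace_integral_tri[OF H s0 a, folded I_def]
    have Im: "I n \<in> borel_measurable M" for n using LI(1)[of n "Suc n"] by (simp add: I_def[abs_def])
    have scale: "\<sigma> / wedge_scale (a n) / a n \<le> K * real (Suc n) ^ 4 / (4 * T\<^sup>2)" for n
    proof -
      have N1: "1 \<le> real (Suc n)" by simp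
      have "T\<^sup>2 / (81 * real (Suc n) ^ 4) \<le> wedge_scale (a n) * a n"
      proof (cases "1 \<le> a n")
        case True
        have "T\<^sup>2 / (81 * real (Suc n) ^ 4) \<le> T\<^sup>2 / (9 * real (Suc n) ^ 2)"
        proof (intro divide_left_mono)
          have "real (Suc n) ^ 2 \<le> real (Suc n) ^ 4" using N1 by (intro power_increasing) auto
          moreover have "0 \<le> real (Suc n) ^ 4" by simp
          ultimately show "9 * real (Suc n) ^ 2 \<le> 81 * real (Suc n) ^ 4" by linarith
        qed auto
        also have "\<dots> = wedge_scale (a n) * a n" using True
          by (simp add: wedge_scale_def a_def power2_eq_square del: of_nat_Suc)
        finally show ?thesis .
      next
        case False
        \<comment> \<open>A short block contributes \<open>a n ^ 4\<close>, proportional to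
          \<open>T ^ 4\<close>; \<open>1 \<le> T\<close> reduces this to the diffusive normalisation
          \<open>T\<^sup>2\<close>. Long blocks give \<open>T\<^sup>2\<close> directly and lose only
          between the second and fourth power of \<open>Suc n\<close>.\<close>
        have "T\<^sup>2 / (81 * real (Suc n) ^ 4) \<le> T ^ 4 / (81 * real (Suc n) ^ 4)"
          using power_increasing[OF _ T, of 2 4] by (intro divide_right_mono) auto
        also have "\<dots> = a n ^ 4" by (simp add: a_def power_divide power_mult_distrib del: of_nat_Suc)
        also have "\<dots> = wedge_scale (a n) * a n" using False by (simp add: wedge_scale_def eval_nat_numeral)
        finally show ?thesis .
      qed
      then have "\<sigma> / (wedge_scale (a n) * a n) \<le> \<sigma> / (T\<^sup>2 / (81 * real (Suc n) ^ 4))"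
        using \<sigma> T a[of n] wedge_scale_pos[OF a[of n]] by (intro divide_left_mono) (auto intro!: mult_pos_pos divide_pos_pos)
      also have "\<dots> = K * real (Suc n) ^ 4 / (4 * T\<^sup>2)" using T by (simp add: K_def)
      finally show ?thesis by simp
    qed
    have gm: "g n \<in> borel_measurable M" for n
      unfolding g_def[abs_def] q_def by (intro borel_measurable_continuous_on[OF _ Im] continuous_intros) (use T in auto)
    have g0: "0 \<le> g n \<omega>" for n \<omega> by (simp add: g_def)
    have gi: "integrable M (g n)" for n
    proof (rule integrable_bounded[OF gm])
      have "0 \<le> K * real (Suc n) ^ 4 * q n \<omega>" for \<omega>
        using K I0 by (auto simp: q_def intro!: mult_nonneg_nonneg divide_nonneg_nonneg)
      then have "exp (- (K * real (Suc n) ^ 4 * q n \<omega>)) \<le> 1" for \<omega> by (simp del: of_nat_Suc)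
      then have "g n \<omega> \<le> real (Suc n) ^ (4 * m)" for \<omega>
        unfolding g_def by (intro mult_left_le) auto
      then show "\<bar>g n \<omega>\<bar> \<le> real (Suc n) ^ (4 * m)" for \<omega> using g0[of n \<omega>] by simp
    qed
    have gE: "expectation (g n) \<le> real (Suc n) ^ (4 * m) * \<rho> ^ Suc n" for n
    proof -
      let ?c = "\<sigma> / wedge_scale (a n) / a n"
      have "expectation (g n) \<le> expectation (\<lambda>\<omega>. real (Suc n) ^ (4 * m) * exp (- (?c * I n \<omega>)))"
      proof (rule integral_mono[OF gi])
        have c: "0 \<le> ?c" by (rule divide_nonneg_nonneg[OF s0 less_imp_le[OF a]])
        have "(\<lambda>\<omega>. exp (- (?c * I n \<omega>))) \<in> borel_measurable M"
          by (intro borel_measurable_continuous_on[OF _ Im] continuous_intros)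
        then have "integrable M (\<lambda>\<omega>. exp (- (?c * I n \<omega>)))"
          by (rule integrable_bounded[of _ 1]) (use mult_nonneg_nonneg[OF c I0] in simp)
        then show "integrable M (\<lambda>\<omega>. real (Suc n) ^ (4 * m) * exp (- (?c * I n \<omega>)))"
          by (rule integrable_mult_right)
        show "g n \<omega> \<le> real (Suc n) ^ (4 * m) * exp (- (?c * I n \<omega>))" for \<omega>
        proof -
          have "?c * I n \<omega> \<le> K * real (Suc n) ^ 4 / (4 * T\<^sup>2) * I n \<omega>"
            by (intro mult_right_mono scale I0)
          then have "- (K * real (Suc n) ^ 4 * q n \<omega>) \<le> - (?c * I n \<omega>)" by (simp add: q_def)
          then show ?thesis unfolding g_def by (intro mult_left_mono) (auto simp del: of_nat_Suc)
        qed
      qed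
      also have "\<dots> = real (Suc n) ^ (4 * m) * expectation (\<lambda>\<omega>. exp (- (?c * I n \<omega>)))" by simp
      also have "\<dots> \<le> real (Suc n) ^ (4 * m) * \<rho> ^ Suc n"
        using LI(2)[of n "Suc n"] unfolding I_def by (intro mult_left_mono) auto
      finally show ?thesis .
    qed
    \<comment> \<open>Summed in \<open>ennreal\<close>, the series is defined everywhere. Its
      integral is finite, hence so is the sum almost surely, and \<open>enn2real\<close> alters it
      on a null set only.\<close>
    define We where "We \<omega> = (\<Sum>n. ennreal (g n \<omega>))" for \<omega>
    have Wem: "We \<in> borel_measurable M"
      unfolding We_def[abs_def] using gm by measurable
    have "(\<integral>\<^sup>+ \<omega>. We \<omega> \<partial>M) = (\<Sum>n. \<integral>\<^sup>+ \<omega>. ennreal (g n \<omega>) \<partial>M)"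
      unfolding We_def using gm by (intro nn_integral_suminf) measurable
    also have "\<dots> \<le> (\<Sum>n. ennreal (real (Suc n) ^ (4 * m) * \<rho> ^ Suc n))"
    proof (intro suminf_le summableI)
      show "(\<integral>\<^sup>+ \<omega>. ennreal (g n \<omega>) \<partial>M) \<le> ennreal (real (Suc n) ^ (4 * m) * \<rho> ^ Suc n)" for n
        using nn_integral_eq_integral[OF gi] g0 gE[of n] by (simp add: ennreal_leI del: of_nat_Suc power_Suc)
    qed
    also have "\<dots> = ennreal C1"
      unfolding C1_def using \<rho> by (intro suminf_ennreal2 sumC1) auto
    finally have Wb: "(\<integral>\<^sup>+ \<omega>. We \<omega> \<partial>M) \<le> ennreal C1" .
    have C10: "0 \<le> C1" unfolding C1_def using \<rho> by (intro suminf_nonneg sumC1) auto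
    have fin: "AE \<omega> in M. We \<omega> \<noteq> \<infinity>"
      using Wb by (intro nn_integral_noteq_infinite Wem) (auto simp: top_unique)
    define W where "W \<omega> = 1 + exp (16 * K) * enn2real (We \<omega>)" for \<omega>
    have "(\<integral>\<^sup>+ \<omega>. ennreal (enn2real (We \<omega>)) \<partial>M) \<le> (\<integral>\<^sup>+ \<omega>. We \<omega> \<partial>M)"
      by (intro nn_integral_mono) (metis ennreal_enn2real_if order_refl zero_le)
    then have Wb': "(\<integral>\<^sup>+ \<omega>. ennreal (enn2real (We \<omega>)) \<partial>M) \<le> ennreal C1" using Wb by (rule order_trans)
    have Wi: "integrable M (\<lambda>\<omega>. enn2real (We \<omega>))"
      by (rule integrableI_nonneg) (use Wem Wb' in \<open>auto intro: le_less_trans\<close>)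
    have WE: "expectation (\<lambda>\<omega>. enn2real (We \<omega>)) \<le> C1"
      using Wb' nn_integral_eq_integral[OF Wi] C10 by (simp add: ennreal_le_iff)
    have "AE \<omega> in M. \<forall>c \<eta>. \<eta> \<noteq> 0 \<longrightarrow>
        1 \<le> W \<omega> * (energy (\<lambda>s. B s \<omega>) T c \<eta> / ((cmod \<eta>)\<^sup>2 * T\<^sup>2)) ^ m"
      using fin AE_space
    proof eventually_elim
      case (elim \<omega>)
      then have \<omega>: "\<omega> \<in> space M" by simp
      have gW: "g n \<omega> \<le> enn2real (We \<omega>)" for n
      proof -
        have "ennreal (g n \<omega>) \<le> We \<omega>"
          unfolding We_def using sum_le_suminf[of "\<lambda>n. ennreal (g n \<omega>)" "{n}"] by (simp add: summableI)
        moreover have "We \<omega> < top" using elim by (simp add: less_top)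
        ultimately have "enn2real (ennreal (g n \<omega>)) \<le> enn2real (We \<omega>)" by (rule enn2real_mono)
        then show ?thesis using g0[of n \<omega>] by simp
      qed
      show ?case
      proof (intro allI impI)
        fix c and \<eta> :: complex assume \<eta>: "\<eta> \<noteq> 0"
        define x where "x = energy (\<lambda>s. B s \<omega>) T c \<eta> / ((cmod \<eta>)\<^sup>2 * T\<^sup>2)"
        have x0: "0 \<le> x" unfolding x_def using energy_nonneg by (intro divide_nonneg_nonneg) auto
        have xq: "q n \<omega> \<le> x" for n
        proof -
          have "(cmod \<eta>)\<^sup>2 / 4 * I n \<omega> \<le> energy (\<lambda>s. B s \<omega>) T c \<eta>"
            unfolding I_def energy_def by (rule energy_lower_bound[OF continuous_paths[OF \<omega>] _ aT]) (use a in \<open>auto simp: less_imp_le\<close>)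
          then have "(cmod \<eta>)\<^sup>2 / 4 * I n \<omega> / ((cmod \<eta>)\<^sup>2 * T\<^sup>2) \<le> x"
            unfolding x_def by (intro divide_right_mono) auto
          moreover have "(cmod \<eta>)\<^sup>2 / 4 * I n \<omega> / ((cmod \<eta>)\<^sup>2 * T\<^sup>2) = q n \<omega>" using \<eta> by (simp add: q_def)
          ultimately show ?thesis by simp
        qed
        have W1: "1 \<le> W \<omega>" by (simp add: W_def)
        have Wg: "exp (16 * K) * g n \<omega> \<le> W \<omega>" for n
        proof -
          have "exp (16 * K) * g n \<omega> \<le> exp (16 * K) * enn2real (We \<omega>)"
            by (rule mult_left_mono[OF gW]) simp
          then show ?thesis unfolding W_def by linarith
        qed
        have glow: "real (Suc n) ^ (4 * m) * exp (- (K * real (Suc n) ^ 4 * x)) \<le> g n \<omega>" for n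
          unfolding g_def using xq[of n] K by (intro mult_left_mono) (auto intro!: mult_left_mono simp del: of_nat_Suc)
        consider "1 \<le> x" | "0 < x" "x < 1" | "x = 0" using x0 by linarith
        then show "1 \<le> W \<omega> * x ^ m"
        proof cases
          case 1
          then have "1 * 1 \<le> W \<omega> * x ^ m" using W1 by (intro mult_mono one_le_power) auto
          then show ?thesis by simp
        next
          case 2
          then obtain n where n: "1 \<le> real (Suc n) ^ 4 * x" "real (Suc n) ^ 4 * x \<le> 16"
            using ex_fourth_power_between[of x] by auto
          have "1 \<le> (real (Suc n) ^ 4 * x) ^ m" using n(1) by (rule one_le_power)
          also have "\<dots> = exp (16 * K) * (real (Suc n) ^ (4 * m) * exp (- (16 * K))) * x ^ m"
            by (simp add: power_mult_distrib power_mult flip: exp_add)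
          also have "\<dots> \<le> W \<omega> * x ^ m"
          proof (intro mult_right_mono)
            have "K * (real (Suc n) ^ 4 * x) \<le> K * 16" using n(2) K by (intro mult_left_mono) auto
            then have "exp (- (16 * K)) \<le> exp (- (K * real (Suc n) ^ 4 * x))" by (simp add: mult_ac)
            then have "real (Suc n) ^ (4 * m) * exp (- (16 * K)) \<le> real (Suc n) ^ (4 * m) * exp (- (K * real (Suc n) ^ 4 * x))"
              by (rule mult_left_mono) simp
            also note glow
            finally have "exp (16 * K) * (real (Suc n) ^ (4 * m) * exp (- (16 * K))) \<le> exp (16 * K) * g n \<omega>"
              by (rule mult_left_mono) simp
            also note Wg
            finally show "exp (16 * K) * (real (Suc n) ^ (4 * m) * exp (- (16 * K))) \<le> W \<omega>" .
          qed (use 2 in auto)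
          finally show ?thesis .
        next
          case 3
          \<comment> \<open>For \<open>x = 0\<close> nothing damps the series: its terms are at
            least \<open>real (Suc n) ^ (4 * m)\<close> and outgrow any finite value of the sum. Off
            the null set this excludes zero energy for nonzero \<open>\<eta>\<close>, which is the
            almost sure invertibility of the Gram matrix.\<close>
          obtain n where n: "enn2real (We \<omega>) < real n" using reals_Archimedean2 by blast
          have "real (Suc n) ^ 1 \<le> real (Suc n) ^ (4 * m)" using m by (intro power_increasing) auto
          also have "\<dots> \<le> g n \<omega>" using glow[of n] 3 by simp
          also have "\<dots> \<le> enn2real (We \<omega>)" by (rule gW)
          finally show ?thesis using n by simp
        qed
      qed
    qed
    moreover have "integrable M W" unfolding W_def[abs_def] using Wi by simp
    moreover have "expectation W \<le> C"
      unfolding W_def[abs_def] C_def using Wi WE by (simp add: prob_space)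
    moreover have "0 \<le> W \<omega>" for \<omega> by (simp add: W_def)
    ultimately show ?thesis by blast
  qed
  then show ?thesis by (intro exI[of _ C]) blast
qed

section \<open>The pathwise bound\<close>

text \<open>The complex entry of the column in the double integral of \<open>dual_hdir\<close>. It
  is \<open>- \<i>\<close> times the primitive of \<open>Zint\<close>, hence of order T^(3/2),
  although its integrand suggests T^2.\<close>

definition Pz :: "(real \<Rightarrow> real) \<Rightarrow> real \<Rightarrow> complex" where
  "Pz b s = \<i> * (LBINT r:{0..s}. cis (b r) * complex_of_real (r - s))"

definition Zint_L1 :: "(real \<Rightarrow> real) \<Rightarrow> real \<Rightarrow> real" where
  "Zint_L1 b T = (LBINT t:{0..T}. cmod (Zint b t))"

lemma Pz_has_vector_derivative:
  assumes b: "continuous_on {0..} b" and s: "s \<in> {0..T}"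
  shows "(Pz b has_vector_derivative - \<i> * Zint b s) (at s within {0..T})"
proof -
  have c: "continuous_on {0..u} (\<lambda>r. cis (b r))" for u
    by (intro continuous_on_cis_path continuous_on_subset[OF b]) auto
  have cr: "continuous_on {0..u} (\<lambda>r. cis (b r) * complex_of_real r)" for u
    by (intro continuous_intros c)
  \<comment> \<open>Splitting \<open>r - u\<close> moves the endpoint out of the integrand. The
    product rule then applies, and the two terms with \<open>cis (b s) * complex_of_real s\<close>
    cancel.\<close>
  have "Pz b u = \<i> * (integral {0..u} (\<lambda>r. cis (b r) * complex_of_real r) - complex_of_real u * Zint b u)" for u
  proof -
    have "(LBINT r:{0..u}. cis (b r) * complex_of_real (r - u)) =
        (LBINT r:{0..u}. cis (b r) * complex_of_real r - cis (b r) * complex_of_real u)"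
      by (simp add: right_diff_distrib)
    also have "\<dots> = (LBINT r:{0..u}. cis (b r) * complex_of_real r) - (LBINT r:{0..u}. cis (b r) * complex_of_real u)"
      by (intro set_integral_diff borel_integrable_atLeastAtMost' cr continuous_intros c)
    finally show ?thesis
      unfolding Pz_def LBINT_eq_integral[OF cr] by (simp add: Zint_def mult.commute)
  qed
  then have "Pz b = (\<lambda>u. \<i> * (integral {0..u} (\<lambda>r. cis (b r) * complex_of_real r) - complex_of_real u * Zint b u))"
    by auto
  moreover have "((\<lambda>u. \<i> * (integral {0..u} (\<lambda>r. cis (b r) * complex_of_real r) - complex_of_real u * Zint b u))
     has_vector_derivative \<i> * (cis (b s) * complex_of_real s - (complex_of_real s * cis (b s) + 1 * Zint b s))) (at s within {0..T})"
    by (intro has_vector_derivative_mult_right has_vector_derivative_diff has_vector_derivative_mult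
        integral_has_vector_derivative[OF cr s] Zint_has_vector_derivative[OF b s]
        has_vector_derivative_of_real[of "\<lambda>u. u" 1, simplified] DERIV_ident)
  ultimately show ?thesis by (simp add: algebra_simps)
qed

lemma Pz_0 [simp]: "Pz b 0 = 0"
proof -
  have "AE x in lborel. indicator {0} x *\<^sub>R (cis (b x) * complex_of_real x) = 0"
    by (intro AE_I2) (auto simp: indicator_def)
  then show ?thesis by (simp add: Pz_def set_lebesgue_integral_def integral_eq_zero_AE)
qed

lemma continuous_on_Pz:
  assumes "continuous_on {0..} b"
  shows "continuous_on {0..T} (Pz b)"
  unfolding continuous_on_eq_continuous_within
  using Pz_has_vector_derivative[OF assms] has_vector_derivative_continuous by blast

lemma integral_subinterval_le:
  fixes h :: "real \<Rightarrow> real"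
  assumes "continuous_on {0..T} h" "\<And>s. 0 \<le> h s" "0 \<le> t" "t \<le> T"
  shows "integral {0..t} h \<le> (LBINT s:{0..T}. h s)"
  unfolding LBINT_eq_integral[OF assms(1)]
  by (rule integral_subset_le)
    (use assms in \<open>auto intro!: integrable_continuous_real continuous_on_subset[OF assms(1)]\<close>)

lemma cmod_Pz_le:
  assumes b: "continuous_on {0..} b" and t: "0 \<le> t" "t \<le> T"
  shows "cmod (Pz b t) \<le> Zint_L1 b T"
proof -
  have Z: "continuous_on {0..u} (Zint b)" for u by (rule continuous_on_Zint[OF b])
  have "((\<lambda>s. - \<i> * Zint b s) has_integral (Pz b t - Pz b 0)) {0..t}"
    by (intro fundamental_theorem_of_calculus t Pz_has_vector_derivative b)
  from integral_unique[OF this] have "Pz b t = integral {0..t} (\<lambda>s. - \<i> * Zint b s)"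
    by (simp only: Pz_0 diff_zero)
  also have "cmod \<dots> \<le> integral {0..t} (\<lambda>s. cmod (Zint b s))"
    by (rule integral_norm_bound_integral)
      (auto intro!: integrable_continuous_real continuous_intros Z simp: norm_mult)
  also have "\<dots> \<le> Zint_L1 b T"
    unfolding Zint_L1_def by (rule integral_subinterval_le[OF _ _ t]) (intro continuous_intros Z, simp)
  finally show ?thesis .
qed

text \<open>The oscillating factor \<open>g\<close>, a cosine or sine of the path, is exchanged for
  its primitive \<open>G\<close>, a coordinate of Z; this brings in the square root of
  \<open>T\<close> where a bound on \<open>g\<close> alone would give \<open>T\<close>. The
  remaining integral is extended to \<open>{0..T}\<close>, so that only the boundary term depends on
  \<open>t\<close>.\<close>

lemma by_parts_bound:
  fixes F f G g h :: "real \<Rightarrow> real"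
  assumes F: "\<And>s. s \<in> {0..T} \<Longrightarrow> (F has_vector_derivative f s) (at s within {0..T})"
    and G: "\<And>s. s \<in> {0..T} \<Longrightarrow> (G has_vector_derivative g s) (at s within {0..T})"
    and c: "continuous_on {0..T} f" "continuous_on {0..T} g" "continuous_on {0..T} h"
    and G0: "G 0 = 0" and h: "\<And>s. 0 \<le> h s" "\<And>s. s \<in> {0..T} \<Longrightarrow> \<bar>f s * G s\<bar> \<le> h s"
    and t: "0 \<le> t" "t \<le> T" and Fb: "\<bar>F t\<bar> \<le> Fb" and Gb: "\<bar>G t\<bar> \<le> Gb"
  shows "\<bar>LBINT s:{0..t}. F s * g s\<bar> \<le> Fb * Gb + (LBINT s:{0..T}. h s)"
proof -
  have sub: "{0..t} \<subseteq> {0..T}" using t by auto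
  have "continuous_on {0..T} F" "continuous_on {0..T} G"
    unfolding continuous_on_eq_continuous_within
    using has_vector_derivative_continuous[OF F] has_vector_derivative_continuous[OF G] by blast+
  then have cF: "continuous_on {0..t} F" "continuous_on {0..t} G"
    using sub by (auto intro: continuous_on_subset)
  note cs = continuous_on_subset[OF c(1) sub] continuous_on_subset[OF c(2) sub] continuous_on_subset[OF c(3) sub]
  have "((\<lambda>s. F s * g s + f s * G s) has_integral (F t * G t - F 0 * G 0)) {0..t}"
    by (intro fundamental_theorem_of_calculus t has_vector_derivative_mult
        has_vector_derivative_within_subset[OF F sub] has_vector_derivative_within_subset[OF G sub])
      (use t in auto)
  then have "F t * G t = integral {0..t} (\<lambda>s. F s * g s + f s * G s)" by (simp add: integral_unique G0)
  also have "\<dots> = integral {0..t} (\<lambda>s. F s * g s) + integral {0..t} (\<lambda>s. f s * G s)"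
    by (intro Henstock_Kurzweil_Integration.integral_add integrable_continuous_real continuous_intros cF cs)
  finally have eq: "integral {0..t} (\<lambda>s. F s * g s) = F t * G t - integral {0..t} (\<lambda>s. f s * G s)" by simp
  have "norm (integral {0..t} (\<lambda>s. f s * G s)) \<le> integral {0..t} h"
    by (rule integral_norm_bound_integral)
      (use h(2) t in \<open>auto intro!: integrable_continuous_real continuous_intros cF cs\<close>)
  also have "\<dots> \<le> (LBINT s:{0..T}. h s)" by (rule integral_subinterval_le[OF c(3) h(1) t])
  finally have 1: "\<bar>integral {0..t} (\<lambda>s. f s * G s)\<bar> \<le> (LBINT s:{0..T}. h s)" by simp
  have "\<bar>F t * G t\<bar> \<le> Fb * Gb" unfolding abs_mult using Fb Gb by (intro mult_mono) auto
  moreover have "(LBINT s:{0..t}. F s * g s) = integral {0..t} (\<lambda>s. F s * g s)"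
    by (intro LBINT_eq_integral continuous_intros cF cs)
  ultimately show ?thesis using 1 unfolding eq by linarith
qed

section \<open>Inner integrals against cosine and sine of the path\<close>

definition pvec :: "(real \<Rightarrow> real) \<Rightarrow> real \<Rightarrow> real^3" where
  "pvec b s = col s (Pz b s)"

lemma pvec_nth: "pvec b s $ 1 = s" "pvec b s $ 2 = Re (Pz b s)" "pvec b s $ 3 = Im (Pz b s)"
  by (simp_all add: pvec_def col_def)

lemma continuous_on_pvec:
  assumes "continuous_on {0..} b"
  shows "continuous_on {0..T} (\<lambda>s. pvec b s $ i)"
  using exhaust_3[of i]
  by (elim disjE; simp only: pvec_nth; intro continuous_intros continuous_on_Pz assms)

text \<open>\<open>Kmat b t s\<close> depends on \<open>s\<close> only through the components of
  \<open>cis (b s)\<close>, and linearly. So the integral over \<open>s\<close> needs just these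
  integrals and their sine counterparts \<open>J_sin\<close>.\<close>

definition J_cos :: "(real \<Rightarrow> real) \<Rightarrow> 3 \<Rightarrow> real \<Rightarrow> real" where
  "J_cos b i t = (LBINT s:{0..t}. pvec b s $ i * cos (b s))"

definition J_sin :: "(real \<Rightarrow> real) \<Rightarrow> 3 \<Rightarrow> real \<Rightarrow> real" where
  "J_sin b i t = (LBINT s:{0..t}. pvec b s $ i * sin (b s))"

lemma continuous_on_J:
  assumes b: "continuous_on {0..} b"
  shows "continuous_on {0..T} (J_cos b i)" "continuous_on {0..T} (J_sin b i)"
proof -
  have c: "continuous_on {0..t} b" for t by (rule continuous_on_subset[OF b]) auto
  have "J_cos b i t = integral {0..t} (\<lambda>s. pvec b s $ i * cos (b s))" "J_sin b i t = integral {0..t} (\<lambda>s. pvec b s $ i * sin (b s))" for t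
    unfolding J_cos_def J_sin_def by (intro LBINT_eq_integral continuous_intros continuous_on_pvec b c)+
  then have "J_cos b i = (\<lambda>t. integral {0..t} (\<lambda>s. pvec b s $ i * cos (b s)))" "J_sin b i = (\<lambda>t. integral {0..t} (\<lambda>s. pvec b s $ i * sin (b s)))"
    by auto
  then show "continuous_on {0..T} (J_cos b i)" "continuous_on {0..T} (J_sin b i)"
    by (auto intro!: indefinite_integral_continuous_1 integrable_continuous_real continuous_intros continuous_on_pvec b c)
qed

lemma Re_Im_Zint_has_vector_derivative:
  assumes "continuous_on {0..} b" "s \<in> {0..T}"
  shows "((\<lambda>s. Re (Zint b s)) has_vector_derivative cos (b s)) (at s within {0..T})"
    "((\<lambda>s. Im (Zint b s)) has_vector_derivative sin (b s)) (at s within {0..T})"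
  using bounded_linear.has_vector_derivative[OF bounded_linear_Re Zint_has_vector_derivative[OF assms]]
    bounded_linear.has_vector_derivative[OF bounded_linear_Im Zint_has_vector_derivative[OF assms]]
  by simp_all

text \<open>The weight is \<open>s\<close>, with derivative 1. Both terms are of order T^(3/2),
  where bounding the trigonometric factor by 1 would give T^2.\<close>

lemma J1_bound:
  assumes b: "continuous_on {0..} b" and t: "0 \<le> t" "t \<le> T"
  shows "\<bar>J_cos b 1 t\<bar> \<le> T * cmod (Zint b t) + Zint_L1 b T" "\<bar>J_sin b 1 t\<bar> \<le> T * cmod (Zint b t) + Zint_L1 b T"
proof -
  have c: "continuous_on {0..T} b" by (rule continuous_on_subset[OF b]) auto
  show "\<bar>J_cos b 1 t\<bar> \<le> T * cmod (Zint b t) + Zint_L1 b T"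
    unfolding J_cos_def pvec_nth Zint_L1_def
    by (rule by_parts_bound[where f="\<lambda>_. 1" and G="\<lambda>s. Re (Zint b s)"])
      (use t abs_Re_le_cmod in \<open>auto intro!: has_vector_derivative_id Re_Im_Zint_has_vector_derivative b continuous_intros c continuous_on_Zint\<close>)
  show "\<bar>J_sin b 1 t\<bar> \<le> T * cmod (Zint b t) + Zint_L1 b T"
    unfolding J_sin_def pvec_nth Zint_L1_def
    by (rule by_parts_bound[where f="\<lambda>_. 1" and G="\<lambda>s. Im (Zint b s)"])
      (use t abs_Im_le_cmod in \<open>auto intro!: has_vector_derivative_id Re_Im_Zint_has_vector_derivative b continuous_intros c continuous_on_Zint\<close>)
qed

text \<open>Up to sign the weight has a coordinate of Z as its derivative, so the remaining integral
  is at most the mass of Z. The result is of order T^2 instead of T^(5/2).\<close>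

lemma J23_bound:
  assumes b: "continuous_on {0..} b" and t: "0 \<le> t" "t \<le> T" and i: "i = 2 \<or> i = 3"
  shows "\<bar>J_cos b i t\<bar> \<le> Zint_L1 b T * cmod (Zint b t) + Zint_mass b T" "\<bar>J_sin b i t\<bar> \<le> Zint_L1 b T * cmod (Zint b t) + Zint_mass b T"
proof -
  have c: "continuous_on {0..T} b" by (rule continuous_on_subset[OF b]) auto
  have Z: "continuous_on {0..T} (Zint b)" by (rule continuous_on_Zint[OF b])
  define f where "f s = (if i = 2 then Im (Zint b s) else - Re (Zint b s))" for s
  have F: "((\<lambda>s. pvec b s $ i) has_vector_derivative f s) (at s within {0..T})" if "s \<in> {0..T}" for s
    using i bounded_linear.has_vector_derivative[OF bounded_linear_Re Pz_has_vector_derivative[OF b that]]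
      bounded_linear.has_vector_derivative[OF bounded_linear_Im Pz_has_vector_derivative[OF b that]]
    by (auto simp: pvec_nth f_def)
  have fc: "continuous_on {0..T} f"
    using i by (auto simp: f_def[abs_def] intro!: continuous_intros Z)
  have fb: "\<bar>f s\<bar> \<le> cmod (Zint b s)" for s
    using abs_Re_le_cmod[of "Zint b s"] abs_Im_le_cmod[of "Zint b s"] by (auto simp: f_def)
  have hb: "\<bar>f s * g\<bar> \<le> (cmod (Zint b s))\<^sup>2" if "\<bar>g\<bar> \<le> cmod (Zint b s)" for s g
    unfolding abs_mult power2_eq_square using fb that by (intro mult_mono) auto
  have Fb: "\<bar>pvec b t $ i\<bar> \<le> Zint_L1 b T"
    using i cmod_Pz_le[OF b t] abs_Re_le_cmod[of "Pz b t"] abs_Im_le_cmod[of "Pz b t"] by (auto simp: pvec_nth)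
  have h: "continuous_on {0..T} (\<lambda>s. (cmod (Zint b s))\<^sup>2)" by (intro continuous_intros Z)
  have cc: "continuous_on {0..T} (\<lambda>s. cos (b s))" "continuous_on {0..T} (\<lambda>s. sin (b s))"
    by (intro continuous_intros c)+
  show "\<bar>J_cos b i t\<bar> \<le> Zint_L1 b T * cmod (Zint b t) + Zint_mass b T"
    unfolding J_cos_def Zint_mass_def
    by (rule by_parts_bound[OF F Re_Im_Zint_has_vector_derivative(1)[OF b] fc cc(1) h _ _ hb[OF abs_Re_le_cmod] t Fb abs_Re_le_cmod])
      simp_all
  show "\<bar>J_sin b i t\<bar> \<le> Zint_L1 b T * cmod (Zint b t) + Zint_mass b T"
    unfolding J_sin_def Zint_mass_def
    by (rule by_parts_bound[OF F Re_Im_Zint_has_vector_derivative(2)[OF b] fc cc(2) h _ _ hb[OF abs_Im_le_cmod] t Fb abs_Im_le_cmod])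
      simp_all
qed

text \<open>Coefficient of \<open>cos (b s)\<close> in row \<open>i\<close> of
  \<open>A *v (Kmat b t s *v y)\<close>, with \<open>z = Zint b t\<close>; \<open>beta\<close> is
  the coefficient of the sine. The combination \<open>Re z * y $ 3 - Im z * y $ 2\<close> is the
  inner product of \<open>\<i> * z\<close> with the last two entries of \<open>y\<close>.\<close>

definition alpha :: "real^3^3 \<Rightarrow> real^3 \<Rightarrow> complex \<Rightarrow> 3 \<Rightarrow> real" where
  "alpha A y z i = A $ i $ 1 * y $ 2
     + A $ i $ 2 * (y $ 1 - (Re z * y $ 3 - Im z * y $ 2) + Im z * y $ 2) - A $ i $ 3 * (Re z * y $ 2)"

definition beta :: "real^3^3 \<Rightarrow> real^3 \<Rightarrow> complex \<Rightarrow> 3 \<Rightarrow> real" where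
  "beta A y z i = A $ i $ 1 * y $ 3
     + A $ i $ 3 * (y $ 1 - (Re z * y $ 3 - Im z * y $ 2) - Re z * y $ 3) + A $ i $ 2 * (Im z * y $ 3)"

lemma Kmat_mult:
  "(A *v (Kmat b t s *v y)) $ i = cos (b s) * alpha A y (Zint b t) i + sin (b s) * beta A y (Zint b t) i"
  unfolding Kmat_def alpha_def beta_def Zint_def[symmetric]
  by (simp add: matrix_vector_mult_def sum_3 block_def outer_def cvec_def Let_def algebra_simps)

text \<open>Neither \<open>A\<close>, \<open>y\<close> nor the coefficients \<open>alpha\<close> and
  \<open>beta\<close> depend on \<open>s\<close>, so the iterated integral becomes a single integral
  over \<open>t\<close> of products of continuous functions. Both the bound and the measurability of
  the dual start from this form.\<close>

lemma dual_hdir_eq: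
  fixes T :: real and x v :: "real \<times> complex"
  assumes b: "continuous_on {0..} b"
  defines "A \<equiv> matrix_inv (Cmat b T)"
  defines "y \<equiv> A *v rotated x v"
  shows "dual_hdir b x v T = - (col (b T) (- \<i> * (LBINT t:{0..T}. cis (b t) * complex_of_real (b T - b t))) \<bullet> y
     + (LBINT t:{0..T}. \<Sum>i\<in>UNIV. J_cos b i t * alpha A y (Zint b t) i + J_sin b i t * beta A y (Zint b t) i))"
proof -
  have c: "continuous_on {0..t} b" for t by (rule continuous_on_subset[OF b]) auto
  have "(LBINT s:{0..t}. pvec b s \<bullet> ((A ** Kmat b t s ** A) *v rotated x v)) =
      (\<Sum>i\<in>UNIV. J_cos b i t * alpha A y (Zint b t) i + J_sin b i t * beta A y (Zint b t) i)" for t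
  proof -
    have "pvec b s \<bullet> ((A ** Kmat b t s ** A) *v rotated x v) =
       (\<Sum>i\<in>UNIV. pvec b s $ i * cos (b s) * alpha A y (Zint b t) i + pvec b s $ i * sin (b s) * beta A y (Zint b t) i)" for s
      unfolding matrix_vector_mul_assoc[symmetric] y_def[symmetric] inner_vec_def Kmat_mult
      by (simp add: algebra_simps)
    then have "(LBINT s:{0..t}. pvec b s \<bullet> ((A ** Kmat b t s ** A) *v rotated x v)) = (LBINT s:{0..t}.
       \<Sum>i\<in>UNIV. pvec b s $ i * cos (b s) * alpha A y (Zint b t) i + pvec b s $ i * sin (b s) * beta A y (Zint b t) i)"
      by simp
    also have "\<dots> = (\<Sum>i\<in>UNIV. LBINT s:{0..t}.
         pvec b s $ i * cos (b s) * alpha A y (Zint b t) i + pvec b s $ i * sin (b s) * beta A y (Zint b t) i)"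
      unfolding set_lebesgue_integral_def scaleR_sum_right
    proof (rule Bochner_Integration.integral_sum)
      fix i
      have "set_integrable lborel {0..t} (\<lambda>s. pvec b s $ i * cos (b s) * alpha A y (Zint b t) i + pvec b s $ i * sin (b s) * beta A y (Zint b t) i)"
        by (intro borel_integrable_atLeastAtMost' continuous_intros continuous_on_pvec b c)
      then show "integrable lborel (\<lambda>s. indicator {0..t} s *\<^sub>R (pvec b s $ i * cos (b s) * alpha A y (Zint b t) i + pvec b s $ i * sin (b s) * beta A y (Zint b t) i))"
        unfolding set_integrable_def .
    qed
    also have "\<dots> = (\<Sum>i\<in>UNIV. J_cos b i t * alpha A y (Zint b t) i + J_sin b i t * beta A y (Zint b t) i)"
    proof (rule sum.cong[OF refl])
      fix i :: 3
      have "(LBINT s:{0..t}. pvec b s $ i * cos (b s) * alpha A y (Zint b t) i + pvec b s $ i * sin (b s) * beta A y (Zint b t) i) =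
        (LBINT s:{0..t}. pvec b s $ i * cos (b s) * alpha A y (Zint b t) i) + (LBINT s:{0..t}. pvec b s $ i * sin (b s) * beta A y (Zint b t) i)"
        by (intro set_integral_add(2) borel_integrable_atLeastAtMost' continuous_intros continuous_on_pvec b c)
      then show "(LBINT s:{0..t}. pvec b s $ i * cos (b s) * alpha A y (Zint b t) i + pvec b s $ i * sin (b s) * beta A y (Zint b t) i) =
         J_cos b i t * alpha A y (Zint b t) i + J_sin b i t * beta A y (Zint b t) i"
        unfolding J_cos_def J_sin_def set_integral_mult_left .
    qed
    finally show ?thesis .
  qed
  then show ?thesis
    unfolding dual_hdir_def A_def[symmetric] y_def[symmetric] pvec_def Pz_def by simp
qed

lemma alpha_beta_bound:
  assumes A: "\<bar>A $ i $ 1\<bar> \<le> p1" "\<bar>A $ i $ 2\<bar> \<le> p2" "\<bar>A $ i $ 3\<bar> \<le> p2"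
    and y: "\<bar>y $ 1\<bar> \<le> q1" "\<bar>y $ 2\<bar> \<le> q2" "\<bar>y $ 3\<bar> \<le> q2"
  shows "\<bar>alpha A y z i\<bar> \<le> p1 * q2 + p2 * (q1 + 4 * cmod z * q2)"
    "\<bar>beta A y z i\<bar> \<le> p1 * q2 + p2 * (q1 + 4 * cmod z * q2)"
proof -
  have q0: "0 \<le> q1" "0 \<le> q2" "0 \<le> p2" "0 \<le> p1" using y A by linarith+
  have m: "\<bar>Re z * u\<bar> \<le> cmod z * q2" "\<bar>Im z * u\<bar> \<le> cmod z * q2" if "\<bar>u\<bar> \<le> q2" for u
    unfolding abs_mult using that by (intro mult_mono abs_Re_le_cmod abs_Im_le_cmod; simp)+
  note mm = m[OF y(2)] m[OF y(3)]
  have 1: "\<bar>A $ i $ 1 * y $ 2\<bar> \<le> p1 * q2" "\<bar>A $ i $ 1 * y $ 3\<bar> \<le> p1 * q2"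
    unfolding abs_mult using A y q0 by (intro mult_mono; simp)+
  have h: "\<bar>y $ 1 - (Re z * y $ 3 - Im z * y $ 2) + Im z * y $ 2\<bar> \<le> q1 + 3 * (cmod z * q2)"
    "\<bar>y $ 1 - (Re z * y $ 3 - Im z * y $ 2) - Re z * y $ 3\<bar> \<le> q1 + 3 * (cmod z * q2)"
    using mm y by linarith+
  have 2: "\<bar>A $ i $ 2 * (y $ 1 - (Re z * y $ 3 - Im z * y $ 2) + Im z * y $ 2)\<bar> \<le> p2 * (q1 + 3 * (cmod z * q2))"
    unfolding abs_mult[of "A $ i $ 2"] by (rule mult_mono[OF A(2) h(1) q0(3) abs_ge_zero])
  have 4: "\<bar>A $ i $ 3 * (y $ 1 - (Re z * y $ 3 - Im z * y $ 2) - Re z * y $ 3)\<bar> \<le> p2 * (q1 + 3 * (cmod z * q2))"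
    unfolding abs_mult[of "A $ i $ 3"] by (rule mult_mono[OF A(3) h(2) q0(3) abs_ge_zero])
  have 3: "\<bar>A $ i $ 3 * (Re z * y $ 2)\<bar> \<le> p2 * (cmod z * q2)"
    unfolding abs_mult[of "A $ i $ 3"] by (rule mult_mono[OF A(3) mm(1) q0(3) abs_ge_zero])
  have 5: "\<bar>A $ i $ 2 * (Im z * y $ 3)\<bar> \<le> p2 * (cmod z * q2)"
    unfolding abs_mult[of "A $ i $ 2"] by (rule mult_mono[OF A(2) mm(4) q0(3) abs_ge_zero])
  have e: "p1 * q2 + p2 * (q1 + 4 * cmod z * q2) = p1 * q2 + p2 * (q1 + 3 * (cmod z * q2)) + p2 * (cmod z * q2)"
    by (simp add: algebra_simps)
  show "\<bar>alpha A y z i\<bar> \<le> p1 * q2 + p2 * (q1 + 4 * cmod z * q2)"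
    "\<bar>beta A y z i\<bar> \<le> p1 * q2 + p2 * (q1 + 4 * cmod z * q2)"
    unfolding alpha_def beta_def e using 1 2 3 4 5 by linarith+
qed

lemma matrix_inv_right:
  fixes A :: "real^'n^'n"
  assumes "invertible A" shows "A ** matrix_inv A = mat 1"
  using assms unfolding invertible_def matrix_inv_def by (rule someI2_ex) blast

lemma matrix_column: "(A *v axis j 1) $ i = (A $ i $ j :: real)"
  by (simp add: matrix_vector_mult_def axis_def if_distrib cong: if_cong)

lemma rotated_bound:
  "\<bar>rotated x v $ 1\<bar> \<le> \<bar>fst v\<bar>" "\<bar>rotated x v $ 2\<bar> \<le> cmod (snd v)" "\<bar>rotated x v $ 3\<bar> \<le> cmod (snd v)"
proof -
  have e: "rotated x v $ 1 = fst v" "rotated x v $ 2 = Re (cis (- fst x) * snd v)" "rotated x v $ 3 = Im (cis (- fst x) * snd v)"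
    by (simp_all add: rotated_def matrix_vector_mult_def sum_3 block_def rot_def col_def)
  show "\<bar>rotated x v $ 1\<bar> \<le> \<bar>fst v\<bar>" unfolding e by simp
  have c: "cmod (cis (- fst x) * snd v) = cmod (snd v)" by (simp add: norm_mult)
  show "\<bar>rotated x v $ 2\<bar> \<le> cmod (snd v)" "\<bar>rotated x v $ 3\<bar> \<le> cmod (snd v)"
    unfolding e c[symmetric] by (rule abs_Re_le_cmod abs_Im_le_cmod)+
qed

text \<open>Size of the column in the first term of the dual after multiplication by the scales 1 /
  T and T^(-3/2) of the solution \<open>y\<close>; the factor 2 counts the real and imaginary
  parts.\<close>

definition fluct :: "(real \<Rightarrow> real) \<Rightarrow> real \<Rightarrow> real" where
  "fluct b T = \<bar>b T\<bar> / T + 2 * (LBINT t:{0..T}. \<bar>b T - b t\<bar>) / sqrt T ^ 3"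

text \<open>A count of powers of \<open>\<tau>\<close>, the square root of \<open>T\<close>. With Z
  of order \<open>\<tau>\<close>, row 1 of \<open>alpha\<close> and \<open>beta\<close> has order
  \<open>\<tau>\<close> to the power -5 and meets \<open>J1_bound\<close> of order 3; rows 2 and 3
  have order -6 and meet \<open>J23_bound\<close> of order 4. Both products have order -2, and the
  integral over \<open>t\<close> supplies the missing factor \<open>T\<close>.\<close>

lemma dual_hdir_bound:
  assumes b: "continuous_on {0..} b" and T: "0 < T"
    and r: "0 \<le> r" "\<And>c \<eta>. (cmod \<eta>)\<^sup>2 * T\<^sup>2 \<le> r\<^sup>2 * energy b T c \<eta>"
    and p: "p = sqrt (Zint_mass b T) / T"
    and k: "k = 2 * (2 * (1 + r + r * p))\<^sup>2"
    and V: "V = \<bar>fst v\<bar> + cmod (snd v) / sqrt T"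
  shows "\<bar>dual_hdir b x v T\<bar> \<le> V * (k * fluct b T + k\<^sup>2 * (8 * p + 32 * p\<^sup>2 + 32 * p ^ 3))"
proof -
  define \<tau> where "\<tau> = sqrt T"
  have \<tau>: "0 < \<tau>" "\<tau>\<^sup>2 = T" "0 \<le> \<tau>" using T by (auto simp: \<tau>_def)
  define A where "A = matrix_inv (Cmat b T)"
  define y where "y = A *v rotated x v"
  have "Cmat b T ** A = mat 1" unfolding A_def by (rule matrix_inv_right[OF invertible_Cmat[OF b T r(2)]])
  then have CA: "Cmat b T *v (A *v w) = w" for w by (simp add: matrix_vector_mul_assoc)
  note sb = solution_bound[OF b T \<tau>_def r p refl CA, folded k]
  have k0: "0 \<le> k" unfolding k by simp
  have V0: "0 \<le> V" unfolding V using T by simp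
  have yb: "\<bar>y $ 1\<bar> \<le> k * V / \<tau>\<^sup>2" "\<bar>y $ 2\<bar> \<le> k * V / \<tau> ^ 3" "\<bar>y $ 3\<bar> \<le> k * V / \<tau> ^ 3"
    unfolding y_def V \<tau>_def[symmetric] by (rule sb[OF rotated_bound])+
  have ax: "axis 1 1 $ (1::3) = (1::real)" "axis 1 1 $ (2::3) = (0::real)" "axis 1 1 $ (3::3) = (0::real)"
    "axis 2 1 $ (1::3) = (0::real)" "axis 2 1 $ (2::3) = (1::real)" "axis 2 1 $ (3::3) = (0::real)"
    "axis 3 1 $ (1::3) = (0::real)" "axis 3 1 $ (2::3) = (0::real)" "axis 3 1 $ (3::3) = (1::real)"
    by (simp_all add: axis_def)
  \<comment> \<open>The columns of \<open>A\<close> solve the Gram system with unit vectors on the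
    right. The weight \<open>v1 + v2 / \<tau>\<close> of \<open>solution_bound\<close> is 1 for the
    first and \<open>1 / \<tau>\<close> for the other two, hence the extra power of
    \<open>\<tau>\<close> in \<open>Aj\<close>.\<close>
  have A1: "\<bar>A $ 1 $ 1\<bar> \<le> k / \<tau>\<^sup>2" "\<bar>A $ 2 $ 1\<bar> \<le> k / \<tau> ^ 3" "\<bar>A $ 3 $ 1\<bar> \<le> k / \<tau> ^ 3"
    using sb[of "axis 1 1" 1 0] unfolding matrix_column ax by simp_all
  have Aj: "\<bar>A $ 1 $ j\<bar> \<le> k / \<tau> ^ 3" "\<bar>A $ 2 $ j\<bar> \<le> k / \<tau> ^ 4" "\<bar>A $ 3 $ j\<bar> \<le> k / \<tau> ^ 4" if "j = 2 \<or> j = 3" for j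
  proof -
    have w: "\<bar>axis j 1 $ (1::3)\<bar> \<le> (0::real)" "\<bar>axis j 1 $ (2::3)\<bar> \<le> (1::real)" "\<bar>axis j 1 $ (3::3)\<bar> \<le> (1::real)"
      using that ax by auto
    have e: "k * (0 + 1 / \<tau>) / \<tau>\<^sup>2 = k / \<tau> ^ 3" "k * (0 + 1 / \<tau>) / \<tau> ^ 3 = k / \<tau> ^ 4"
      by (simp_all add: eval_nat_numeral)
    show "\<bar>A $ 1 $ j\<bar> \<le> k / \<tau> ^ 3" "\<bar>A $ 2 $ j\<bar> \<le> k / \<tau> ^ 4" "\<bar>A $ 3 $ j\<bar> \<le> k / \<tau> ^ 4"
      using sb[OF w] unfolding matrix_column e .
  qed
  define Q where "Q = Zint_mass b T"
  define I where "I = Zint_L1 b T"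
  define \<iota> where "\<iota> = I / \<tau> ^ 3"
  have Z: "continuous_on {0..T} (Zint b)" by (rule continuous_on_Zint[OF b])
  have Q0: "0 \<le> Q" unfolding Q_def Zint_mass_def by (intro LBINT_nonneg) auto
  have I0: "0 \<le> I" unfolding I_def Zint_L1_def by (intro LBINT_nonneg) auto
  have p0: "0 \<le> p" unfolding p using Q0 T by (simp add: Q_def)
  have QT: "Q = p\<^sup>2 * \<tau> ^ 4"
  proof -
    have "\<tau> ^ 4 = T\<^sup>2" using \<tau>(2) by (metis mult_2 numeral_Bit0 power2_eq_square power_add)
    then show ?thesis using Q0 T by (simp add: p Q_def power_divide)
  qed
  have IT: "I = \<iota> * \<tau> ^ 3" using \<tau>(1) by (simp add: \<iota>_def)
  have \<iota>0: "0 \<le> \<iota>" using I0 \<tau>(1) by (simp add: \<iota>_def)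
  have \<iota>p: "\<iota> \<le> p"
  proof -
    \<comment> \<open>Cauchy-Schwarz in time; after it \<open>p\<close> alone measures the size of
      the path.\<close>
    have "T * I\<^sup>2 \<le> T\<^sup>2 * Q"
      using power_LBINT_le[OF T, of "\<lambda>t. cmod (Zint b t)" 2] unfolding I_def Q_def Zint_L1_def Zint_mass_def
      by (simp add: continuous_intros Z)
    then have "I\<^sup>2 \<le> T * Q" using T by (simp add: power2_eq_square mult.assoc)
    also have "T * Q = (p * \<tau> ^ 3)\<^sup>2" unfolding QT \<tau>(2)[symmetric]
      by (simp add: power_mult_distrib eval_nat_numeral)
    finally have "I \<le> p * \<tau> ^ 3" by (rule power2_le_imp_le) (use p0 \<tau>(1) in simp)
    then show ?thesis using \<tau>(1) by (simp add: \<iota>_def divide_le_eq)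
  qed
  define g where "g t = cmod (Zint b t)" for t
  define c1 where "c1 = (\<lambda>\<gamma>. k / \<tau>\<^sup>2 * (k * V / \<tau> ^ 3) + k / \<tau> ^ 3 * (k * V / \<tau>\<^sup>2 + 4 * \<gamma> * (k * V / \<tau> ^ 3)))"
  define c2 where "c2 = (\<lambda>\<gamma>. k / \<tau> ^ 3 * (k * V / \<tau> ^ 3) + k / \<tau> ^ 4 * (k * V / \<tau>\<^sup>2 + 4 * \<gamma> * (k * V / \<tau> ^ 3)))"
  let ?F = "\<lambda>t. \<Sum>i\<in>UNIV. J_cos b i t * alpha A y (Zint b t) i + J_sin b i t * beta A y (Zint b t) i"
  have g0: "0 \<le> g t" for t by (simp add: g_def)
  have gc: "continuous_on {0..T} g" unfolding g_def[abs_def] by (intro continuous_intros Z)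
  have F: "\<bar>?F t\<bar> \<le> 2 * ((T * g t + I) * c1 (g t)) + 4 * ((I * g t + Q) * c2 (g t))" if "t \<in> {0..T}" for t
  proof -
    have t: "0 \<le> t" "t \<le> T" using that by auto
    have ab1: "\<bar>alpha A y (Zint b t) 1\<bar> \<le> c1 (g t)" "\<bar>beta A y (Zint b t) 1\<bar> \<le> c1 (g t)"
      unfolding c1_def g_def by (rule alpha_beta_bound[OF A1(1) Aj(1) Aj(1) yb]; simp)+
    have ab2: "\<bar>alpha A y (Zint b t) 2\<bar> \<le> c2 (g t)" "\<bar>beta A y (Zint b t) 2\<bar> \<le> c2 (g t)"
      unfolding c2_def g_def by (rule alpha_beta_bound[OF A1(2) Aj(2) Aj(2) yb]; simp)+
    have ab3: "\<bar>alpha A y (Zint b t) 3\<bar> \<le> c2 (g t)" "\<bar>beta A y (Zint b t) 3\<bar> \<le> c2 (g t)"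
      unfolding c2_def g_def by (rule alpha_beta_bound[OF A1(3) Aj(3) Aj(3) yb]; simp)+
    note J1 = J1_bound[OF b t, folded I_def g_def]
    have J2: "\<bar>J_cos b 2 t\<bar> \<le> I * g t + Q" "\<bar>J_sin b 2 t\<bar> \<le> I * g t + Q"
      "\<bar>J_cos b 3 t\<bar> \<le> I * g t + Q" "\<bar>J_sin b 3 t\<bar> \<le> I * g t + Q"
      unfolding I_def Q_def g_def by (rule J23_bound[OF b t]; simp)+
    have mm: "\<bar>u * w\<bar> \<le> U * W" if "\<bar>u\<bar> \<le> U" "\<bar>w\<bar> \<le> W" for u w U W :: real
      unfolding abs_mult using that by (intro mult_mono) auto
    have "\<bar>?F t\<bar> \<le> \<bar>J_cos b 1 t * alpha A y (Zint b t) 1\<bar> + \<bar>J_sin b 1 t * beta A y (Zint b t) 1\<bar>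
      + \<bar>J_cos b 2 t * alpha A y (Zint b t) 2\<bar> + \<bar>J_sin b 2 t * beta A y (Zint b t) 2\<bar>
      + \<bar>J_cos b 3 t * alpha A y (Zint b t) 3\<bar> + \<bar>J_sin b 3 t * beta A y (Zint b t) 3\<bar>"
      unfolding sum_3 by linarith
    then show ?thesis
      using mm[OF J1(1) ab1(1)] mm[OF J1(2) ab1(2)] mm[OF J2(1) ab2(1)] mm[OF J2(2) ab2(2)]
        mm[OF J2(3) ab3(1)] mm[OF J2(4) ab3(2)] by linarith
  qed
  \<comment> \<open>Coefficients of 1, \<open>g t\<close> and \<open>(g t)\<^sup>2\<close> in the
    bound of the integrand. Integrated over \<open>{0..T}\<close> these functions give
    \<open>T\<close>, \<open>I\<close> and \<open>Q\<close>, so that no supremum of Z has to be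
    controlled.\<close>
  define A0 where "A0 = 4 * I / \<tau> ^ 5 + 8 * Q / \<tau> ^ 6"
  define A1' where "A1' = 4 * T / \<tau> ^ 5 + 16 * I / \<tau> ^ 6 + 16 * Q / \<tau> ^ 7"
  define A2 where "A2 = 8 * T / \<tau> ^ 6 + 16 * I / \<tau> ^ 7"
  have poly: "2 * ((T * \<gamma> + I) * c1 \<gamma>) + 4 * ((I * \<gamma> + Q) * c2 \<gamma>) = k\<^sup>2 * V * (A0 + A1' * \<gamma> + A2 * \<gamma>\<^sup>2)" for \<gamma>
  proof -
    have e1: "c1 \<gamma> = k\<^sup>2 * V * (2 / \<tau> ^ 5 + 4 * \<gamma> / \<tau> ^ 6)"
      unfolding c1_def using \<tau>(1) by (simp add: field_simps eval_nat_numeral)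
    have e2: "c2 \<gamma> = k\<^sup>2 * V * (2 / \<tau> ^ 6 + 4 * \<gamma> / \<tau> ^ 7)"
      unfolding c2_def using \<tau>(1) by (simp add: field_simps eval_nat_numeral)
    have "2 * ((T * \<gamma> + I) * (2 / \<tau> ^ 5 + 4 * \<gamma> / \<tau> ^ 6)) + 4 * ((I * \<gamma> + Q) * (2 / \<tau> ^ 6 + 4 * \<gamma> / \<tau> ^ 7))
      = A0 + A1' * \<gamma> + A2 * \<gamma>\<^sup>2"
      unfolding A0_def A1'_def A2_def by (simp add: algebra_simps add_divide_distrib power2_eq_square)
    note e3 = this
    have "2 * ((T * \<gamma> + I) * (k\<^sup>2 * V * u)) + 4 * ((I * \<gamma> + Q) * (k\<^sup>2 * V * w)) =
      k\<^sup>2 * V * (2 * ((T * \<gamma> + I) * u) + 4 * ((I * \<gamma> + Q) * w))" for u w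
      by (simp add: algebra_simps)
    then show ?thesis unfolding e1 e2 by (simp only: e3)
  qed
  have Fc: "continuous_on {0..T} ?F"
    unfolding alpha_def beta_def by (intro continuous_intros continuous_on_J b Z)
  have "\<bar>LBINT t:{0..T}. ?F t\<bar> \<le> (LBINT t:{0..T}. k\<^sup>2 * V * (A0 + A1' * g t + A2 * (g t)\<^sup>2))"
  proof -
    have "\<bar>LBINT t:{0..T}. ?F t\<bar> \<le> (LBINT t:{0..T}. \<bar>?F t\<bar>)"
      using set_integral_norm_bound[OF borel_integrable_atLeastAtMost'[OF Fc]] by simp
    also have "\<dots> \<le> (LBINT t:{0..T}. k\<^sup>2 * V * (A0 + A1' * g t + A2 * (g t)\<^sup>2))"
      by (rule set_integral_mono_continuous)
        (use F in \<open>auto intro!: borel_integrable_atLeastAtMost' continuous_intros gc Fc simp: poly\<close>)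
    finally show ?thesis .
  qed
  also have "\<dots> = k\<^sup>2 * V * (LBINT t:{0..T}. A0 + A1' * g t + A2 * (g t)\<^sup>2)" by (rule set_integral_mult_right)
  also have "(LBINT t:{0..T}. A0 + A1' * g t + A2 * (g t)\<^sup>2) = T * A0 + A1' * I + A2 * Q"
  proof -
    have "(LBINT t:{0..T}. A0 + A1' * g t + A2 * (g t)\<^sup>2) = (LBINT t:{0..T}. A0 + A1' * g t) + (LBINT t:{0..T}. A2 * (g t)\<^sup>2)"
      by (intro set_integral_add borel_integrable_atLeastAtMost' continuous_intros gc)
    also have "(LBINT t:{0..T}. A0 + A1' * g t) = (LBINT t:{0..T}. A0) + (LBINT t:{0..T}. A1' * g t)"
      by (intro set_integral_add borel_integrable_atLeastAtMost' continuous_intros gc)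
    finally show ?thesis using T
      by (simp add: LBINT_const I_def Q_def Zint_L1_def Zint_mass_def g_def)
  qed
  \<comment> \<open>With \<open>I = \<iota> * \<tau> ^ 3\<close> and
    \<open>Q = p\<^sup>2 * \<tau> ^ 4\<close> all powers of \<open>\<tau>\<close> cancel, which is
    where uniformity in \<open>T\<close> appears.\<close>
  also have "T * A0 + A1' * I + A2 * Q = 8 * \<iota> + 16 * p\<^sup>2 + 16 * \<iota>\<^sup>2 + 32 * p\<^sup>2 * \<iota>"
    unfolding A0_def A1'_def A2_def QT IT \<tau>(2)[symmetric] using \<tau>(1)
    by (simp add: field_simps eval_nat_numeral)
  also have "k\<^sup>2 * V * \<dots> \<le> k\<^sup>2 * V * (8 * p + 32 * p\<^sup>2 + 32 * p ^ 3)"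
  proof (rule mult_left_mono)
    have "\<iota>\<^sup>2 \<le> p\<^sup>2" "p\<^sup>2 * \<iota> \<le> p\<^sup>2 * p" using \<iota>p \<iota>0 by (auto intro: power_mono mult_left_mono)
    then show "8 * \<iota> + 16 * p\<^sup>2 + 16 * \<iota>\<^sup>2 + 32 * p\<^sup>2 * \<iota> \<le> 8 * p + 32 * p\<^sup>2 + 32 * p ^ 3"
      using \<iota>p by (simp add: power3_eq_cube power2_eq_square)
  qed (use V0 in simp)
  finally have T2: "\<bar>LBINT t:{0..T}. ?F t\<bar> \<le> k\<^sup>2 * V * (8 * p + 32 * p\<^sup>2 + 32 * p ^ 3)" .
  define Pb where "Pb = - \<i> * (LBINT t:{0..T}. cis (b t) * complex_of_real (b T - b t))"
  define D where "D = (LBINT t:{0..T}. \<bar>b T - b t\<bar>)"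
  have c: "continuous_on {0..T} b" by (rule continuous_on_subset[OF b]) auto
  have Pb: "cmod Pb \<le> D"
  proof -
    have "set_integrable lborel {0..T} (\<lambda>t. cis (b t) * complex_of_real (b T - b t))"
      by (intro borel_integrable_atLeastAtMost' continuous_intros c)
    from set_integral_norm_bound[OF this] show ?thesis
      by (simp add: Pb_def D_def norm_mult flip: of_real_diff)
  qed
  have D0: "0 \<le> D" unfolding D_def by (intro LBINT_nonneg) auto
  have "\<bar>col (b T) Pb \<bullet> y\<bar> \<le> \<bar>b T\<bar> * (k * V / \<tau>\<^sup>2) + D * (k * V / \<tau> ^ 3) + D * (k * V / \<tau> ^ 3)"
  proof -
    have "\<bar>col (b T) Pb \<bullet> y\<bar> \<le> \<bar>b T * y $ 1\<bar> + \<bar>Re Pb * y $ 2\<bar> + \<bar>Im Pb * y $ 3\<bar>"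
      by (simp add: inner_vec_def sum_3 col_def)
    moreover have "\<bar>b T * y $ 1\<bar> \<le> \<bar>b T\<bar> * (k * V / \<tau>\<^sup>2)" unfolding abs_mult using yb(1) by (intro mult_left_mono) auto
    moreover have "\<bar>Re Pb * y $ 2\<bar> \<le> D * (k * V / \<tau> ^ 3)" "\<bar>Im Pb * y $ 3\<bar> \<le> D * (k * V / \<tau> ^ 3)"
      unfolding abs_mult using yb(2,3) Pb D0 abs_Re_le_cmod[of Pb] abs_Im_le_cmod[of Pb] by (intro mult_mono; simp)+
    ultimately show ?thesis by linarith
  qed
  also have "\<dots> = V * (k * fluct b T)"
  proof -
    have f: "fluct b T = \<bar>b T\<bar> / T + 2 * D / \<tau> ^ 3" by (simp add: fluct_def D_def \<tau>_def)
    have "B * (k * V / T) + D' * (k * V / u) + D' * (k * V / u) = V * (k * (B / T + 2 * D' / u))" for B D' u :: real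
      by (simp add: distrib_left mult_ac)
    then show ?thesis unfolding f \<tau>(2) .
  qed
  finally have T1: "\<bar>col (b T) Pb \<bullet> y\<bar> \<le> V * (k * fluct b T)" .
  have "dual_hdir b x v T = - (col (b T) Pb \<bullet> y + (LBINT t:{0..T}. ?F t))"
    unfolding Pb_def y_def A_def by (rule dual_hdir_eq[OF b])
  then have "\<bar>dual_hdir b x v T\<bar> \<le> V * (k * fluct b T) + k\<^sup>2 * V * (8 * p + 32 * p\<^sup>2 + 32 * p ^ 3)"
    using T1 T2 by linarith
  then show ?thesis by (simp add: algebra_simps)
qed

section \<open>Measurability of the dual\<close>

text \<open>On singular matrices \<open>matrix_inv\<close> chooses from the empty predicate, so it is constant there.\<close>

lemma matrix_inv_nth:
  fixes A :: "real^3^3"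
  shows "matrix_inv A $ i $ j = (if det A = 0 then (SOME A' :: real^3^3. False) $ i $ j
    else det (\<chi> k l. if l = i then axis j 1 $ k else A $ k $ l) / det A)"
proof (cases "det A = 0")
  case True
  then have "\<not> invertible A" by (simp add: invertible_det_nz)
  then have "(\<lambda>A'. A ** A' = mat 1 \<and> A' ** A = mat 1) = (\<lambda>_. False)" unfolding invertible_def by auto
  then have "matrix_inv A = (SOME A'. False)" unfolding matrix_inv_def by simp
  then show ?thesis using True by simp
next
  case False
  then have "A ** matrix_inv A = mat 1" by (intro matrix_inv_right) (simp add: invertible_det_nz)
  then have "A *v (matrix_inv A *v axis j 1) = axis j 1" by (simp add: matrix_vector_mul_assoc)
  then have "matrix_inv A *v axis j 1 = (\<chi> i. det (\<chi> k l. if l = i then axis j 1 $ k else A $ k $ l) / det A)"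
    using cramer[OF False] by blast
  then show ?thesis using False by (simp add: matrix_column[symmetric])
qed

lemma borel_measurable_matrix_inv:
  fixes A :: "'a \<Rightarrow> real^3^3"
  assumes A: "\<And>i j. (\<lambda>\<omega>. A \<omega> $ i $ j) \<in> borel_measurable M"
  shows "(\<lambda>\<omega>. matrix_inv (A \<omega>) $ i $ j) \<in> borel_measurable M"
proof -
  have det: "(\<lambda>\<omega>. det (F \<omega>)) \<in> borel_measurable M" if "\<And>k l. (\<lambda>\<omega>. F \<omega> $ k $ l) \<in> borel_measurable M"
    for F :: "'a \<Rightarrow> real^3^3"
    unfolding det_3 by (intro borel_measurable_diff borel_measurable_add borel_measurable_times that)
  have d: "(\<lambda>\<omega>. det (A \<omega>)) \<in> borel_measurable M" by (rule det[OF A])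
  have "(\<lambda>\<omega>. det (\<chi> k l. if l = i then axis j 1 $ k else A \<omega> $ k $ l)) \<in> borel_measurable M"
  proof (rule det)
    show "(\<lambda>\<omega>. (\<chi> k l. if l = i then axis j 1 $ k else A \<omega> $ k $ l) $ k $ l) \<in> borel_measurable M" for k l
      by (cases "l = i") (simp_all add: A)
  qed
  then show ?thesis unfolding matrix_inv_nth using d by measurable
qed

context standard_brownian_motion
begin

text \<open>\<open>dual_hdir_eq\<close> leaves only single integrals of processes with continuous
  paths, to which \<open>borel_measurable_LBINT_paths\<close> applies; the inverse matrix is
  measurable by Cramer's rule.\<close>

lemma dual_hdir_measurable:
  assumes T: "0 \<le> T"
  shows "(\<lambda>\<omega>. dual_hdir (sample \<omega>) x v T) \<in> borel_measurable M"
proof -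
  have cb: "continuous_on {0..t} (\<lambda>s. B s \<omega>)" if "\<omega> \<in> space M" for t \<omega>
    by (rule continuous_on_subset[OF continuous_paths[OF that]]) auto
  have bc: "(\<lambda>\<omega>. h (f \<omega>)) \<in> borel_measurable M"
    if "f \<in> borel_measurable M" "continuous_on UNIV h" for f :: "'a \<Rightarrow> 'x::topological_space" and h :: "'x \<Rightarrow> 'y::topological_space"
    by (rule borel_measurable_continuous_on[OF that(2,1)])
  have RI: "(\<lambda>\<omega>. Re (Zint (sample \<omega>) t)) \<in> borel_measurable M" "(\<lambda>\<omega>. Im (Zint (sample \<omega>) t)) \<in> borel_measurable M"
    if "0 \<le> t" for t
    by (intro bc[OF Zint_measurable[OF that]] continuous_intros)+
  have hm: "(\<lambda>\<omega>. hvec (sample \<omega>) t $ i) \<in> borel_measurable M" if "0 \<le> t" for t i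
  proof -
    have "(\<lambda>\<omega>. if i = 1 then 1 else if i = 2 then Im (Zint (sample \<omega>) t) else - Re (Zint (sample \<omega>) t)) \<in> borel_measurable M"
      using RI[OF that] by auto
    then show ?thesis
      by (rule measurable_cong[THEN iffD1, rotated])
        (use exhaust_3[of i] in \<open>auto simp: hvec_Zint[OF continuous_paths]\<close>)
  qed
  have Cm: "(\<lambda>\<omega>. Cmat (sample \<omega>) T $ i $ j) \<in> borel_measurable M" for i j
    unfolding Cmat_def ip_def vec_lambda_beta
    by (intro borel_measurable_LBINT_paths(2) borel_measurable_times hm continuous_intros continuous_on_hvec continuous_paths T)
  define A where "A \<omega> = matrix_inv (Cmat (sample \<omega>) T)" for \<omega>
  have Am: "(\<lambda>\<omega>. A \<omega> $ i $ j) \<in> borel_measurable M" for i j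
    unfolding A_def by (rule borel_measurable_matrix_inv[OF Cm])
  define y where "y \<omega> = A \<omega> *v rotated x v" for \<omega>
  have ym: "(\<lambda>\<omega>. y \<omega> $ i) \<in> borel_measurable M" for i
    unfolding y_def matrix_vector_mult_def vec_lambda_beta
    by (intro borel_measurable_sum borel_measurable_times Am borel_measurable_const)
  have Pm: "(\<lambda>\<omega>. Pz (sample \<omega>) s) \<in> borel_measurable M" if "0 \<le> s" for s
    unfolding Pz_def
    by (intro borel_measurable_times borel_measurable_const borel_measurable_LBINT_paths(2)
        bc[OF measurable_B] continuous_intros cb that)
  have pm: "(\<lambda>\<omega>. pvec (sample \<omega>) s $ i) \<in> borel_measurable M" if "0 \<le> s" for s i
    using exhaust_3[of i] by (elim disjE; simp only: pvec_nth; intro borel_measurable_const bc[OF Pm[OF that]] continuous_intros)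
  have Jm: "(\<lambda>\<omega>. J_cos (sample \<omega>) i t) \<in> borel_measurable M" "(\<lambda>\<omega>. J_sin (sample \<omega>) i t) \<in> borel_measurable M"
    if "0 \<le> t" for i t
    unfolding J_cos_def J_sin_def
    by (intro borel_measurable_LBINT_paths(2) borel_measurable_times pm bc[OF measurable_B] that
        continuous_intros continuous_on_pvec continuous_paths cb; assumption?)+
  have abm: "(\<lambda>\<omega>. alpha (A \<omega>) (y \<omega>) (Zint (sample \<omega>) t) i) \<in> borel_measurable M"
    "(\<lambda>\<omega>. beta (A \<omega>) (y \<omega>) (Zint (sample \<omega>) t) i) \<in> borel_measurable M" if "0 \<le> t" for i t
    unfolding alpha_def beta_def
    by (intro borel_measurable_add borel_measurable_diff borel_measurable_times Am ym RI that)+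
  have Fm: "(\<lambda>\<omega>. LBINT t:{0..T}. \<Sum>i\<in>UNIV. J_cos (sample \<omega>) i t * alpha (A \<omega>) (y \<omega>) (Zint (sample \<omega>) t) i
      + J_sin (sample \<omega>) i t * beta (A \<omega>) (y \<omega>) (Zint (sample \<omega>) t) i) \<in> borel_measurable M"
  proof (rule borel_measurable_LBINT_paths(2)[OF _ _ T])
    show "continuous_on {0..T} (\<lambda>t. \<Sum>i\<in>UNIV. J_cos (sample \<omega>) i t * alpha (A \<omega>) (y \<omega>) (Zint (sample \<omega>) t) i
      + J_sin (sample \<omega>) i t * beta (A \<omega>) (y \<omega>) (Zint (sample \<omega>) t) i)" if "\<omega> \<in> space M" for \<omega>
      unfolding alpha_def beta_def
      by (intro continuous_intros continuous_on_J continuous_on_Zint continuous_paths that)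
  qed (intro borel_measurable_sum borel_measurable_add borel_measurable_times Jm abm; assumption)
  have Bm: "(\<lambda>\<omega>. LBINT t:{0..T}. cis (B t \<omega>) * complex_of_real (B T \<omega> - B t \<omega>)) \<in> borel_measurable M"
    by (intro borel_measurable_LBINT_paths(2) borel_measurable_times bc[OF measurable_B] continuous_intros cb T
        bc[OF borel_measurable_diff[OF measurable_B measurable_B]]; assumption?)
  have "(\<lambda>\<omega>. - \<i> * (LBINT t:{0..T}. cis (B t \<omega>) * complex_of_real (B T \<omega> - B t \<omega>))) \<in> borel_measurable M"
    by (intro borel_measurable_times borel_measurable_const Bm)
  then have cm: "(\<lambda>\<omega>. col (B T \<omega>) (- \<i> * (LBINT t:{0..T}. cis (B t \<omega>) * complex_of_real (B T \<omega> - B t \<omega>))) $ i) \<in> borel_measurable M" for i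
    using exhaust_3[of i] measurable_B[OF T]
    by (elim disjE; simp only: col_def vector_3; intro bc[OF _ continuous_on_Re] bc[OF _ continuous_on_Im] continuous_on_id; simp)
  have "(\<lambda>\<omega>. - (col (B T \<omega>) (- \<i> * (LBINT t:{0..T}. cis (B t \<omega>) * complex_of_real (B T \<omega> - B t \<omega>))) \<bullet> y \<omega>
     + (LBINT t:{0..T}. \<Sum>i\<in>UNIV. J_cos (sample \<omega>) i t * alpha (A \<omega>) (y \<omega>) (Zint (sample \<omega>) t) i
      + J_sin (sample \<omega>) i t * beta (A \<omega>) (y \<omega>) (Zint (sample \<omega>) t) i))) \<in> borel_measurable M"
    unfolding inner_vec_def inner_real_def
    by (intro borel_measurable_uminus borel_measurable_add borel_measurable_sum borel_measurable_times cm ym Fm)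
  then show ?thesis
    by (rule measurable_cong[THEN iffD1, rotated]) (simp add: dual_hdir_eq[OF continuous_paths] A_def y_def)
qed

end

section \<open>Moments of the Malliavin dual\<close>

text \<open>Separates the variables into a product of powers of \<open>1 + r\<^sup>2\<close>,
  \<open>1 + p\<^sup>2\<close> and \<open>1 + f\<close>, the quantities with known moments. With
  \<open>X = (1 + r\<^sup>2) * (1 + p\<^sup>2)\<close> one has \<open>k \<le> 24 * X\<close>;
  moreover 8 + 32 + 32 = 72 and 24 + 24^2 * 72 = 41496.\<close>

lemma weight_bound:
  fixes r p f :: real
  assumes r: "0 \<le> r" and p: "0 \<le> p" and f: "0 \<le> f" and k: "k = 2 * (2 * (1 + r + r * p))\<^sup>2"
  shows "k * f + k\<^sup>2 * (8 * p + 32 * p\<^sup>2 + 32 * p ^ 3) \<le> 41496 * ((1 + r\<^sup>2)\<^sup>2 * (1 + p\<^sup>2) ^ 4 * (1 + f))"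
proof -
  define u where "u = 1 + p\<^sup>2"
  define X where "X = (1 + r\<^sup>2) * u"
  have u: "1 \<le> u" by (simp add: u_def)
  have X1: "1 \<le> X" unfolding X_def using mult_mono[of 1 "1 + r\<^sup>2" 1 u] u by simp
  have sq3: "(a + b + c)\<^sup>2 \<le> 3 * (a\<^sup>2 + b\<^sup>2 + c\<^sup>2)" for a b c :: real
    using zero_le_power2[of "a - b"] zero_le_power2[of "b - c"] zero_le_power2[of "a - c"]
    by (simp add: power2_eq_square algebra_simps)
  have "(1 + r + r * p)\<^sup>2 \<le> 3 * (1 + r\<^sup>2 + (r * p)\<^sup>2)" using sq3[of 1 r "r * p"] by simp
  also have "\<dots> \<le> 3 * X" unfolding X_def u_def by (simp add: power_mult_distrib algebra_simps)
  finally have "(1 + r + r * p)\<^sup>2 \<le> 3 * X" .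
  then have kX: "k \<le> 24 * X" unfolding k power_mult_distrib[of 2] by simp
  have k0: "0 \<le> k" by (simp add: k)
  have pu: "p \<le> u"
  proof -
    have "2 * p \<le> 1 + p\<^sup>2" using zero_le_power2[of "p - 1"] by (simp add: power2_eq_square algebra_simps)
    then show ?thesis using p unfolding u_def by linarith
  qed
  have uu: "u \<le> u\<^sup>2" using u by (simp add: power2_eq_square)
  have "p\<^sup>2 * p \<le> u * u" using pu p u by (intro mult_mono) (auto simp: u_def)
  then have p3: "p ^ 3 \<le> u\<^sup>2" by (simp add: power3_eq_cube power2_eq_square)
  have p2: "p\<^sup>2 \<le> u\<^sup>2" using uu by (simp add: u_def)
  have P: "8 * p + 32 * p\<^sup>2 + 32 * p ^ 3 \<le> 72 * u\<^sup>2" using pu uu p2 p3 by linarith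
  have XX: "X \<le> X\<^sup>2 * u\<^sup>2"
  proof -
    have "X * 1 \<le> X * (X * u\<^sup>2)" using X1 u uu mult_mono[of 1 X 1 "u\<^sup>2"] by (intro mult_left_mono) auto
    then show ?thesis by (simp add: power2_eq_square mult.assoc)
  qed
  have "k * f \<le> 24 * (X\<^sup>2 * u\<^sup>2) * f" using kX XX f by (intro mult_right_mono) auto
  moreover have "k\<^sup>2 * (8 * p + 32 * p\<^sup>2 + 32 * p ^ 3) \<le> (24 * X)\<^sup>2 * (72 * u\<^sup>2)"
    using kX k0 P p by (intro mult_mono power_mono) auto
  moreover have "(24 * X)\<^sup>2 * (72 * u\<^sup>2) = 41472 * (X\<^sup>2 * u\<^sup>2)" by (simp add: power_mult_distrib)
  moreover have "0 \<le> X\<^sup>2 * u\<^sup>2" "0 \<le> X\<^sup>2 * u\<^sup>2 * f" using f by auto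
  ultimately have "k * f + k\<^sup>2 * (8 * p + 32 * p\<^sup>2 + 32 * p ^ 3) \<le> 41496 * (X\<^sup>2 * u\<^sup>2) + 41496 * (X\<^sup>2 * u\<^sup>2 * f)"
    by linarith
  also have "\<dots> = 41496 * ((1 + r\<^sup>2)\<^sup>2 * (u\<^sup>2 * u\<^sup>2) * (1 + f))"
  proof -
    have "X\<^sup>2 * u\<^sup>2 = (1 + r\<^sup>2)\<^sup>2 * (u\<^sup>2 * u\<^sup>2)"
      unfolding X_def power_mult_distrib by (rule mult.assoc)
    then show ?thesis by (simp only: distrib_left mult_1_right mult.assoc)
  qed
  also have "u\<^sup>2 * u\<^sup>2 = (1 + p\<^sup>2) ^ 4" unfolding u_def by (simp flip: power_add)
  finally show ?thesis .
qed

text \<open>Takes the place of Hoelder's inequality: a product of three factors is at most the cube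
  of the largest one, and its power at most the sum of the three powers. The exponents 6, 12 and 3
  are three times 2, 4 and 1.\<close>

lemma product_power_le:
  fixes x y z :: real
  assumes "0 \<le> x" "0 \<le> y" "0 \<le> z"
  shows "(x\<^sup>2 * y ^ 4 * z) ^ n \<le> x ^ (6 * n) + y ^ (12 * n) + z ^ (3 * n)"
proof -
  define m where "m = max (x\<^sup>2) (max (y ^ 4) z)"
  have m: "x\<^sup>2 \<le> m" "y ^ 4 \<le> m" "z \<le> m" "0 \<le> m" using assms by (auto simp: m_def le_max_iff_disj)
  have "x\<^sup>2 * y ^ 4 * z \<le> m * m * m" using m assms by (intro mult_mono) auto
  then have "(x\<^sup>2 * y ^ 4 * z) ^ n \<le> (m ^ 3) ^ n"
    using assms by (intro power_mono) (auto simp: power3_eq_cube)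
  also have "(m ^ 3) ^ n = m ^ (3 * n)" by (simp add: power_mult)
  also have "m ^ (3 * n) \<le> x ^ (6 * n) + y ^ (12 * n) + z ^ (3 * n)"
  proof -
    have e: "(x\<^sup>2) ^ (3 * n) = x ^ (6 * n)" "(y ^ 4) ^ (3 * n) = y ^ (12 * n)"
      by (simp_all flip: power_mult)
    have nn: "0 \<le> x ^ (6 * n)" "0 \<le> y ^ (12 * n)" "0 \<le> z ^ (3 * n)" using assms by auto
    have "m = x\<^sup>2 \<or> m = y ^ 4 \<or> m = z" unfolding m_def by linarith
    then show ?thesis using e nn by (elim disjE) auto
  qed
  finally show ?thesis .
qed

lemma fluct_nonneg: "0 < T \<Longrightarrow> 0 \<le> fluct b T"
  unfolding fluct_def using LBINT_nonneg[of "\<lambda>t. \<bar>b T - b t\<bar>" 0 T] by simp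

lemma Zint_mass_nonneg: "0 \<le> Zint_mass b T"
  unfolding Zint_mass_def by (intro LBINT_nonneg) auto

context standard_brownian_motion
begin

lemma Zint_mass_moment:
  assumes T: "0 < T"
  shows "integrable M (\<lambda>\<omega>. Zint_mass (sample \<omega>) T ^ N) \<and>
    expectation (\<lambda>\<omega>. Zint_mass (sample \<omega>) T ^ N) \<le> T ^ N * (2 ^ Suc N * moment_const N * T ^ N)"
  unfolding Zint_mass_def
proof (rule moment_LBINT)
  fix s assume s: "0 \<le> s" "s \<le> T"
  have n: "(\<lambda>\<omega>. cmod (Zint (sample \<omega>) s)) \<in> borel_measurable M"
    by (rule borel_measurable_continuous_on[OF _ Zint_measurable[OF s(1)]]) (intro continuous_intros)
  show "(\<lambda>\<omega>. (cmod (Zint (sample \<omega>) s))\<^sup>2) \<in> borel_measurable M" by (intro borel_measurable_power n)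
  show "integrable M (\<lambda>\<omega>. ((cmod (Zint (sample \<omega>) s))\<^sup>2) ^ N)"
    using integrable_Zint_power[OF s(1), of "2 * N"] by (simp add: power_mult)
  have "expectation (\<lambda>\<omega>. ((cmod (Zint (sample \<omega>) s))\<^sup>2) ^ N) \<le> 2 ^ Suc N * moment_const N * s ^ N"
    using even_moment_Zint[OF s(1), of N] by (simp add: power_mult)
  also have "\<dots> \<le> 2 ^ Suc N * moment_const N * T ^ N"
    using s moment_const_pos[of N] by (intro mult_left_mono power_mono) auto
  finally show "expectation (\<lambda>\<omega>. ((cmod (Zint (sample \<omega>) s))\<^sup>2) ^ N) \<le> 2 ^ Suc N * moment_const N * T ^ N" .
qed (use T in \<open>auto intro!: continuous_intros continuous_on_Zint continuous_paths\<close>)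

text \<open>The integral term of \<open>fluct\<close> is invariant under the diffusive scaling,
  whereas \<open>\<bar>B T\<bar> / T\<close> is of order T^(-1/2) and is bounded by means of
  \<open>1 \<le> T\<close>. The exponents are even because the Gaussian moments are computed for
  even powers.\<close>

lemma fluct_moment:
  assumes T: "1 \<le> T"
  shows "(\<lambda>\<omega>. fluct (sample \<omega>) T) \<in> borel_measurable M"
    and "integrable M (\<lambda>\<omega>. fluct (sample \<omega>) T ^ (2 * l))"
    and "expectation (\<lambda>\<omega>. fluct (sample \<omega>) T ^ (2 * l)) \<le> 2 ^ (2 * l) * (gauss_const l + 2 ^ (2 * l) * gauss_const l)"
proof -
  have T0: "0 \<le> T" "0 < T" using T by auto
  have g0: "0 \<le> gauss_const l" by (simp add: gauss_const_def)
  let ?D = "\<lambda>\<omega>. LBINT t:{0..T}. \<bar>B T \<omega> - B t \<omega>\<bar>"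
  have cb: "continuous_on {0..T} (\<lambda>s. B s \<omega>)" if "\<omega> \<in> space M" for \<omega>
    by (rule continuous_on_subset[OF continuous_paths[OF that]]) auto
  have am: "(\<lambda>\<omega>. \<bar>B T \<omega> - B s \<omega>\<bar>) \<in> borel_measurable M" if "0 \<le> s" for s
    using that T0 by (intro borel_measurable_abs borel_measurable_diff measurable_B) auto
  have e: "\<bar>x\<bar> ^ (2 * l) = x ^ (2 * l)" for x :: real by (simp add: power_mult)
  have "integrable M (\<lambda>\<omega>. ?D \<omega> ^ (2 * l)) \<and>
    expectation (\<lambda>\<omega>. ?D \<omega> ^ (2 * l)) \<le> T ^ (2 * l) * (gauss_const l * T ^ l)"
  proof (rule moment_LBINT[of T "\<lambda>s \<omega>. \<bar>B T \<omega> - B s \<omega>\<bar>"])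
    fix s assume s: "0 \<le> s" "s \<le> T"
    show "integrable M (\<lambda>\<omega>. \<bar>B T \<omega> - B s \<omega>\<bar> ^ (2 * l))"
      unfolding e by (rule even_moment_increment(1)[OF s])
    show "expectation (\<lambda>\<omega>. \<bar>B T \<omega> - B s \<omega>\<bar> ^ (2 * l)) \<le> gauss_const l * T ^ l"
      unfolding e even_moment_increment(2)[OF s] using s g0 by (intro mult_left_mono power_mono) auto
  qed (use T0 am cb in \<open>auto intro!: continuous_intros\<close>)
  then have D: "integrable M (\<lambda>\<omega>. ?D \<omega> ^ (2 * l))"
    "expectation (\<lambda>\<omega>. ?D \<omega> ^ (2 * l)) \<le> T ^ (2 * l) * (gauss_const l * T ^ l)" by auto
  have "\<bar>B T \<omega>\<bar> ^ (2 * l) = (B T \<omega> - B 0 \<omega>) ^ (2 * l)" if "\<omega> \<in> space M" for \<omega>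
    using start_zero[OF that] unfolding e by simp
  then have BT: "integrable M (\<lambda>\<omega>. \<bar>B T \<omega>\<bar> ^ (2 * l))" "expectation (\<lambda>\<omega>. \<bar>B T \<omega>\<bar> ^ (2 * l)) = gauss_const l * T ^ l"
    using even_moment_increment[OF order_refl T0(1), of l]
    by (simp_all cong: Bochner_Integration.integrable_cong Bochner_Integration.integral_cong)
  have Dm: "?D \<in> borel_measurable M"
    by (rule borel_measurable_LBINT_paths(2)) (use T0 am cb in \<open>auto intro!: continuous_intros\<close>)
  show fm: "(\<lambda>\<omega>. fluct (sample \<omega>) T) \<in> borel_measurable M"
    unfolding fluct_def
    by (intro borel_measurable_add borel_measurable_divide borel_measurable_times borel_measurable_const
        borel_measurable_abs measurable_B T0 Dm)
  let ?G = "\<lambda>\<omega>. 2 ^ (2 * l) * (\<bar>B T \<omega>\<bar> ^ (2 * l) / T ^ (2 * l) + 2 ^ (2 * l) * ?D \<omega> ^ (2 * l) / T ^ (3 * l))"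
  have "(sqrt T ^ 3) ^ (2 * l) = T ^ (3 * l)"
  proof -
    have "(sqrt T ^ 3) ^ (2 * l) = ((sqrt T)\<^sup>2) ^ (3 * l)" by (simp add: mult.commute mult.left_commute flip: power_mult)
    then show ?thesis using T0 by simp
  qed
  note sq = this
  have bnd: "fluct (sample \<omega>) T ^ (2 * l) \<le> ?G \<omega>" for \<omega>
  proof -
    have "fluct (sample \<omega>) T ^ (2 * l) \<le> 2 ^ (2 * l) * ((\<bar>B T \<omega>\<bar> / T) ^ (2 * l) + (2 * ?D \<omega> / sqrt T ^ 3) ^ (2 * l))"
      unfolding fluct_def using T0 LBINT_nonneg[of "\<lambda>t. \<bar>B T \<omega> - B t \<omega>\<bar>" 0 T] by (intro power_add_le) auto
    then show ?thesis unfolding power_divide sq power_mult_distrib .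
  qed
  have Gi: "integrable M ?G"
    by (intro integrable_mult_right Bochner_Integration.integrable_add integrable_divide_zero BT D)
  show fi: "integrable M (\<lambda>\<omega>. fluct (sample \<omega>) T ^ (2 * l))"
  proof (rule Bochner_Integration.integrable_bound[OF Gi])
    have "0 \<le> fluct (sample \<omega>) T ^ (2 * l)" for \<omega> using fluct_nonneg[OF T0(2)] by simp
    moreover have "norm a \<le> norm c" if "0 \<le> a" "a \<le> c" for a c :: real using that by simp
    ultimately have "norm (fluct (sample \<omega>) T ^ (2 * l)) \<le> norm (?G \<omega>)" for \<omega>
      using bnd by blast
    then show "AE \<omega> in M. norm (fluct (sample \<omega>) T ^ (2 * l)) \<le> norm (?G \<omega>)" by (rule AE_I2)
  qed (intro borel_measurable_power fm)
  have "expectation (\<lambda>\<omega>. fluct (sample \<omega>) T ^ (2 * l)) \<le> expectation ?G"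
    by (rule integral_mono[OF fi Gi bnd])
  also have "\<dots> = 2 ^ (2 * l) * (gauss_const l * T ^ l / T ^ (2 * l) + 2 ^ (2 * l) * expectation (\<lambda>\<omega>. ?D \<omega> ^ (2 * l)) / T ^ (3 * l))"
    using BT D by simp
  also have "\<dots> \<le> 2 ^ (2 * l) * (gauss_const l + 2 ^ (2 * l) * gauss_const l)"
  proof (intro mult_left_mono add_mono)
    have "T ^ l \<le> T ^ (2 * l)" using T by (intro power_increasing) auto
    then have "gauss_const l * T ^ l \<le> gauss_const l * T ^ (2 * l)" using g0 by (rule mult_left_mono)
    then show "gauss_const l * T ^ l / T ^ (2 * l) \<le> gauss_const l" using T0 by (simp add: divide_le_eq)
    have "T ^ (2 * l) * (gauss_const l * T ^ l) = gauss_const l * T ^ (3 * l)"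
      by (simp add: mult.left_commute flip: power_add)
    note eq = this
    have "expectation (\<lambda>\<omega>. ?D \<omega> ^ (2 * l)) \<le> gauss_const l * T ^ (3 * l)" using D(2) unfolding eq .
    then have "expectation (\<lambda>\<omega>. ?D \<omega> ^ (2 * l)) / T ^ (3 * l) \<le> gauss_const l"
      using T0 by (simp add: divide_le_eq)
    then have "2 ^ (2 * l) * (expectation (\<lambda>\<omega>. ?D \<omega> ^ (2 * l)) / T ^ (3 * l)) \<le> 2 ^ (2 * l) * gauss_const l"
      by (rule mult_left_mono) simp
    then show "2 ^ (2 * l) * expectation (\<lambda>\<omega>. ?D \<omega> ^ (2 * l)) / T ^ (3 * l) \<le> 2 ^ (2 * l) * gauss_const l" by simp
  qed simp
  finally show "expectation (\<lambda>\<omega>. fluct (sample \<omega>) T ^ (2 * l)) \<le> 2 ^ (2 * l) * (gauss_const l + 2 ^ (2 * l) * gauss_const l)" .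
qed

end

theorem proposition4p7:
  fixes M :: "'a measure" and B :: "real \<Rightarrow> 'a \<Rightarrow> real" and q :: real
  assumes "standard_brownian_motion M B" and "1 \<le> q"
  shows "\<exists>C>0. \<forall>T\<ge>sqrt 2. \<forall>(x :: real \<times> complex) (v :: real \<times> complex).
    integrable M (\<lambda>\<omega>. \<bar>dual_hdir (\<lambda>t. B t \<omega>) x v T\<bar> powr q) \<and>
    (\<integral>\<omega>. \<bar>dual_hdir (\<lambda>t. B t \<omega>) x v T\<bar> powr q \<partial>M) powr (1 / q)
      \<le> C * (\<bar>fst v\<bar> + 1 / sqrt T * cmod (snd v))"
proof -
  interpret standard_brownian_motion M B by fact
  define n' where "n' = nat \<lceil>q\<rceil>"
  \<comment> \<open>An even number, so that \<open>3 * n = 2 * (3 * n')\<close> is an exponent to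
    which \<open>fluct_moment\<close> applies.\<close>
  define n where "n = 2 * n'"
  have n: "q \<le> real n" "1 \<le> n" using assms(2) unfolding n_def n'_def by linarith+
  \<comment> \<open>The exponent that \<open>product_power_le\<close> puts on the factor
    \<open>1 + R \<omega>\<close>; with this choice the power \<open>R \<omega> ^ (6 * n)\<close> is
    \<open>W \<omega>\<close> itself.\<close>
  define m where "m = 6 * n"
  have m: "1 \<le> m" "0 < m" using n by (auto simp: m_def)
  obtain Cm where Cm: "\<And>T. 1 \<le> T \<Longrightarrow>
    \<exists>W. integrable M W \<and> (\<integral>\<omega>. W \<omega> \<partial>M) \<le> Cm \<and> (\<forall>\<omega>. 0 \<le> W \<omega>) \<and>
      (AE \<omega> in M. \<forall>c \<eta>. \<eta> \<noteq> 0 \<longrightarrow>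
        1 \<le> W \<omega> * (energy (\<lambda>s. B s \<omega>) T c \<eta> / ((cmod \<eta>)\<^sup>2 * T\<^sup>2)) ^ m)"
    using inverse_moment[OF m(1), where 'a='a] assms(1) by blast
  \<comment> \<open>The three summands bound those of the expectation of \<open>G\<close>, in the
    same order; the maximum with 1 makes the constant positive.\<close>
  define CG where "CG = max 1 (2 ^ (6 * n) * (1 + Cm) + 2 ^ (12 * n) * (1 + 2 ^ Suc (12 * n) * moment_const (12 * n))
    + 2 ^ (3 * n) * (1 + 2 ^ (2 * (3 * n')) * (gauss_const (3 * n') + 2 ^ (2 * (3 * n')) * gauss_const (3 * n'))))"
  have CG: "0 < CG" by (simp add: CG_def)
  define C where "C = 41496 * CG powr (1 / q)"
  have "integrable M (\<lambda>\<omega>. \<bar>dual_hdir (sample \<omega>) x v T\<bar> powr q) \<and>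
    (\<integral>\<omega>. \<bar>dual_hdir (sample \<omega>) x v T\<bar> powr q \<partial>M) powr (1 / q) \<le> C * (\<bar>fst v\<bar> + 1 / sqrt T * cmod (snd v))"
    if T2: "sqrt 2 \<le> T" for T and x v :: "real \<times> complex"
  proof -
    have "1 \<le> sqrt (2::real)" by simp
    then have T: "1 \<le> T" "0 < T" "0 \<le> T" using T2 by linarith+
    obtain W where W: "integrable M W" "expectation W \<le> Cm" "\<And>\<omega>. 0 \<le> W \<omega>"
      and WE: "AE \<omega> in M. \<forall>c \<eta>. \<eta> \<noteq> 0 \<longrightarrow>
        1 \<le> W \<omega> * (energy (sample \<omega>) T c \<eta> / ((cmod \<eta>)\<^sup>2 * T\<^sup>2)) ^ m"
      using Cm[OF T(1)] by blast
    \<comment> \<open>\<open>R\<close> dominates the inverse of the normalised energy in every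
      direction, since \<open>W\<close> was built to dominate its \<open>m\<close>-th power. Its
      square root is the \<open>r\<close> of the pathwise bound.\<close>
    define R where "R \<omega> = root m (W \<omega>)" for \<omega>
    have R0: "0 \<le> R \<omega>" and Rm: "R \<omega> ^ m = W \<omega>" for \<omega>
      using W(3)[of \<omega>] m by (auto simp: R_def)
    define mu where "mu \<omega> = Zint_mass (sample \<omega>) T / T\<^sup>2" for \<omega>
    have mu0: "0 \<le> mu \<omega>" for \<omega> using Zint_mass_nonneg by (simp add: mu_def)
    define f where "f \<omega> = fluct (sample \<omega>) T" for \<omega>
    have f0: "0 \<le> f \<omega>" for \<omega> using fluct_nonneg[OF T(2)] by (simp add: f_def)
    define V where "V = \<bar>fst v\<bar> + cmod (snd v) / sqrt T"
    have V0: "0 \<le> V" using T by (simp add: V_def)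
    define H where "H \<omega> = (1 + R \<omega>)\<^sup>2 * (1 + mu \<omega>) ^ 4 * (1 + f \<omega>)" for \<omega>
    have H1: "1 \<le> H \<omega>" for \<omega>
    proof -
      have "1 * 1 * 1 \<le> H \<omega>" unfolding H_def
        using R0[of \<omega>] mu0[of \<omega>] f0[of \<omega>] by (intro mult_mono one_le_power) auto
      then show ?thesis by simp
    qed
    have bound: "AE \<omega> in M. \<bar>dual_hdir (sample \<omega>) x v T\<bar> \<le> V * 41496 * H \<omega>"
      using WE AE_space
    proof eventually_elim
      case (elim \<omega>)
      then have b: "continuous_on {0..} (sample \<omega>)" by (intro continuous_paths)
      define r where "r = sqrt (R \<omega>)"
      define p where "p = sqrt (Zint_mass (sample \<omega>) T) / T"
      have r: "0 \<le> r" "r\<^sup>2 = R \<omega>" using R0[of \<omega>] by (auto simp: r_def)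
      have p: "0 \<le> p" "p\<^sup>2 = mu \<omega>" using Zint_mass_nonneg T by (auto simp: p_def mu_def power_divide)
      have E: "(cmod \<eta>)\<^sup>2 * T\<^sup>2 \<le> r\<^sup>2 * energy (sample \<omega>) T c \<eta>" for c \<eta>
      proof (cases "\<eta> = 0")
        case True
        then show ?thesis using energy_nonneg by simp
      next
        case False
        let ?x = "energy (sample \<omega>) T c \<eta> / ((cmod \<eta>)\<^sup>2 * T\<^sup>2)"
        have x0: "0 \<le> ?x" using energy_nonneg by (intro divide_nonneg_nonneg) auto
        have "1 \<le> (R \<omega> * ?x) ^ m" using elim(1) False unfolding power_mult_distrib Rm by blast
        then have "1 \<le> R \<omega> * ?x"
          using power_less_one_iff[of "R \<omega> * ?x" m] x0 R0[of \<omega>] m by (meson linorder_not_le mult_nonneg_nonneg)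
        then show ?thesis using False T unfolding r by (simp add: le_divide_eq)
      qed
      have "\<bar>dual_hdir (sample \<omega>) x v T\<bar> \<le> V * (2 * (2 * (1 + r + r * p))\<^sup>2 * f \<omega> +
          (2 * (2 * (1 + r + r * p))\<^sup>2)\<^sup>2 * (8 * p + 32 * p\<^sup>2 + 32 * p ^ 3))"
        unfolding f_def by (rule dual_hdir_bound[OF b T(2) r(1) E p_def refl V_def])
      also have "\<dots> \<le> V * (41496 * H \<omega>)"
        unfolding H_def r(2)[symmetric] p(2)[symmetric]
        by (intro mult_left_mono weight_bound r(1) p(1) f0 refl V0)
      finally show ?case by (simp add: mult.assoc)
    qed
    define G where "G \<omega> = 2 ^ (6 * n) * (1 + W \<omega>) + 2 ^ (12 * n) * (1 + mu \<omega> ^ (12 * n)) + 2 ^ (3 * n) * (1 + f \<omega> ^ (3 * n))" for \<omega>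
    have HG: "H \<omega> ^ n \<le> G \<omega>" for \<omega>
    proof -
      have "H \<omega> ^ n \<le> (1 + R \<omega>) ^ (6 * n) + (1 + mu \<omega>) ^ (12 * n) + (1 + f \<omega>) ^ (3 * n)"
        unfolding H_def using R0[of \<omega>] mu0[of \<omega>] f0[of \<omega>] by (intro product_power_le) auto
      also have "\<dots> \<le> 2 ^ (6 * n) * (1 ^ (6 * n) + R \<omega> ^ (6 * n)) + 2 ^ (12 * n) * (1 ^ (12 * n) + mu \<omega> ^ (12 * n))
          + 2 ^ (3 * n) * (1 ^ (3 * n) + f \<omega> ^ (3 * n))"
        using R0[of \<omega>] mu0[of \<omega>] f0[of \<omega>] by (intro add_mono power_add_le) auto
      finally show ?thesis unfolding G_def using Rm[of \<omega>] by (simp add: m_def)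
    qed
    have n3: "3 * n = 2 * (3 * n')" by (simp add: n_def)
    note fm = fluct_moment(2,3)[OF T(1), of "3 * n'", folded n3 f_def]
    have mui: "integrable M (\<lambda>\<omega>. mu \<omega> ^ (12 * n))"
      and muE: "expectation (\<lambda>\<omega>. mu \<omega> ^ (12 * n)) \<le> 2 ^ Suc (12 * n) * moment_const (12 * n)"
    proof -
      note mm = Zint_mass_moment[OF T(2), of "12 * n"]
      show "integrable M (\<lambda>\<omega>. mu \<omega> ^ (12 * n))"
        unfolding mu_def power_divide using mm by (intro integrable_divide_zero) auto
      have "expectation (\<lambda>\<omega>. mu \<omega> ^ (12 * n)) = expectation (\<lambda>\<omega>. Zint_mass (sample \<omega>) T ^ (12 * n)) / (T\<^sup>2) ^ (12 * n)"
        unfolding mu_def power_divide by simp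
      also have "\<dots> \<le> (T ^ (12 * n) * (2 ^ Suc (12 * n) * moment_const (12 * n) * T ^ (12 * n))) / (T\<^sup>2) ^ (12 * n)"
        using mm by (intro divide_right_mono) auto
      also have "\<dots> = 2 ^ Suc (12 * n) * moment_const (12 * n)"
        using T by (simp add: power2_eq_square power_mult_distrib)
      finally show "expectation (\<lambda>\<omega>. mu \<omega> ^ (12 * n)) \<le> 2 ^ Suc (12 * n) * moment_const (12 * n)" .
    qed
    have Gi: "integrable M G"
      unfolding G_def[abs_def] using W(1) mui fm(1) by simp
    have "expectation G = 2 ^ (6 * n) * (1 + expectation W) + 2 ^ (12 * n) * (1 + expectation (\<lambda>\<omega>. mu \<omega> ^ (12 * n)))
        + 2 ^ (3 * n) * (1 + expectation (\<lambda>\<omega>. f \<omega> ^ (3 * n)))"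
      unfolding G_def[abs_def] using W(1) mui fm(1) by (simp add: prob_space)
    also have "\<dots> \<le> CG"
      unfolding CG_def n3[symmetric] using W(2) muE fm(2)
      by (intro max.coboundedI2 add_mono mult_left_mono order_refl) (auto simp: n3)
    finally have EG: "expectation G \<le> CG" .
    define K where "K = (V * 41496) powr q"
    have K0: "0 \<le> K" by (simp add: K_def)
    have pw: "AE \<omega> in M. \<bar>dual_hdir (sample \<omega>) x v T\<bar> powr q \<le> K * G \<omega>"
      using bound
    proof eventually_elim
      case (elim \<omega>)
      have "\<bar>dual_hdir (sample \<omega>) x v T\<bar> powr q \<le> (V * 41496 * H \<omega>) powr q"
        using elim assms(2) by (intro powr_mono2) auto
      also have "\<dots> = K * H \<omega> powr q"
        unfolding K_def by (rule powr_mult)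
      \<comment> \<open>Passing from the real exponent \<open>q\<close> to the integer
        \<open>n\<close> is monotone because \<open>1 \<le> H \<omega>\<close>; this is why all
        three factors of \<open>H\<close> have the form one plus a nonnegative quantity.\<close>
      also have "H \<omega> powr q \<le> H \<omega> powr real n" using n H1[of \<omega>] by (intro powr_mono) auto
      also have "H \<omega> powr real n = H \<omega> ^ n" using H1[of \<omega>] by (intro powr_realpow) linarith
      also have "\<dots> \<le> G \<omega>" by (rule HG)
      finally show ?case using K0 by (simp add: mult_left_mono)
    qed
    have dm: "(\<lambda>\<omega>. \<bar>dual_hdir (sample \<omega>) x v T\<bar> powr q) \<in> borel_measurable M"
      using dual_hdir_measurable[OF T(3)] by measurable
    have KG: "integrable M (\<lambda>\<omega>. K * G \<omega>)" using Gi by simp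
    have di: "integrable M (\<lambda>\<omega>. \<bar>dual_hdir (sample \<omega>) x v T\<bar> powr q)"
    proof (rule Bochner_Integration.integrable_bound[OF KG dm])
      show "AE \<omega> in M. norm (\<bar>dual_hdir (sample \<omega>) x v T\<bar> powr q) \<le> norm (K * G \<omega>)"
        using pw by eventually_elim simp
    qed
    have "expectation (\<lambda>\<omega>. \<bar>dual_hdir (sample \<omega>) x v T\<bar> powr q) \<le> expectation (\<lambda>\<omega>. K * G \<omega>)"
      by (rule integral_mono_AE[OF di KG pw])
    also have "\<dots> \<le> K * CG" using EG K0 by (simp add: mult_left_mono)
    finally have "expectation (\<lambda>\<omega>. \<bar>dual_hdir (sample \<omega>) x v T\<bar> powr q) powr (1 / q) \<le> (K * CG) powr (1 / q)"
      using assms(2) by (intro powr_mono2) (auto intro!: Bochner_Integration.integral_nonneg)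
    also have "\<dots> = K powr (1 / q) * CG powr (1 / q)" by (rule powr_mult)
    also have "K powr (1 / q) = V * 41496" unfolding K_def using V0 assms(2) by (simp add: powr_powr)
    finally show ?thesis using di by (simp add: C_def V_def mult_ac)
  qed
  moreover have "0 < C" using CG by (simp add: C_def)
  ultimately show ?thesis by blast
qed

end
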